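(* Let $(X,p_0)$ be a pointed tropical curve, let $\mu$ be a degree-$d$ polarization on $X$, and let $g=b_1(X)$ be the first Betti number of $X$. Then the polyhedral complex $J^{\mathrm{trop}}_{p_0,\mu}(X)$ has pure dimension $g$, is connected in codimension $1$, and is homeomorphic to $J^{\mathrm{trop}}(X)$.
   Context: **Tropical curves.** Graphs are finite and connected, with loops and multiple edges allowed. A tropical curve $X$ is the metric space obtained from a graph $\Gamma$ and a length function $\ell\colon E(\Gamma)\to\mathbb R_{>0}$ by gluing the intervals $[0,\ell(e)]$ along $\Gamma$; such a $\Gamma$ is called a model of $X$. $(X,p_0)$ is pointed if $p_0\in X$ is chosen. For $p\in X$, $\delta_{X,p}$ is the number of tangent directions of $X$ at $p$. $V(X)$ is the set of $p\in X$ with $\delta_{X,p}\ne2$, or $p=p_0$ (or $p$ of positive weight, if $X$ carries a weight function $w\colon X\to\mathbb Z_{\ge0}$ with finite support). A degree-$d$ polarization on $X$ is $\mu\colon X\to\mathbb R$ with finite support $\mathrm{supp}(\mu)$ and $\sum_p\mu(p)=d$. Let $\Gamma_X$ be the model of $X$ with vertex set $V(X)\cup\mathrm{supp}(\mu)$; then $\mu$ gives a function on $V(\Gamma_X)$. Fix an orientation on $\Gamma_X$; $s(e),t(e)$ denote source and target. **Quasistable pseudo-divisors.** For $\mathcal E\subset E(\Gamma_X)$, $\Gamma_X^{\mathcal E}$ is obtained by inserting one exceptional vertex in each edge of $\mathcal E$. For a graph $\Gamma$, $v_0\in V(\Gamma)$, $\mu\colon V(\Gamma)\to\mathbb R$ with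 sum $d$, a degree-$d$ divisor $D\colon V(\Gamma)\to\mathbb Z$ is $(v_0,\mu)$-quasistable if $\sum_{v\in V}(D(v)-\mu(v))+\delta_V/2\ge0$ for all $V\subsetneq V(\Gamma)$, with strict inequality if $v_0\in V$; $\delta_V$ is the number of edges joining $V$ and $V^c$. A degree-$d$ pseudo-divisor $(\mathcal E,D)$ on $\Gamma_X$ consists of $\mathcal E\subset E(\Gamma_X)$ and a degree-$d$ divisor $D$ on $\Gamma_X^{\mathcal E}$ with value $-1$ on every exceptional vertex; it is $(p_0,\mu)$-quasistable if $D$ is $(p_0,\mu^{\mathcal E})$-quasistable on $\Gamma_X^{\mathcal E}$, with $\mu^{\mathcal E}$ equal to $\mu$ on $V(\Gamma_X)$ and $0$ on exceptional vertices. A specialization $(\mathcal E,D)\to(\mathcal E',D')$, with $\mathcal E'\subset\mathcal E$, is the contraction $\Gamma_X^{\mathcal E}\to\Gamma_X^{\mathcal E'}$, for each $e\in\mathcal E\setminus\mathcal E'$, of one of the two edges over $e$, such that $D$ pushes forward to $D'$ (values added over merged vertices). **The complex.** $J^{\mathrm{trop}}_{p_0,\mu}(X)=\varinjlim\mathcal P_{(\mathcal E,D)}$, $\mathcal P_{(\mathcal E,D)}=\prod_{e\in\mathcal E}[0,\ell(e)]$, over all $(p_0,\mu)$-quasistable degree-$d$ pseudo-divisors on $\Gamma_X$ and the face morphisms $\mathcal P_{(\mathcal E',D')}\to\mathcal P_{(\mathcal E,D)}$ attached to all specializations: for $e\in\mathcal E\setminus\mathcal E'$ one sets $x_e=0$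 if the contracted edge over $e$ is the one adjacent to $s(e)$ and $x_e=\ell(e)$ if it is the one adjacent to $t(e)$. It is of pure dimension $n$ if all maximal cells have dimension $n$. It is connected in codimension $1$ if for any two maximal cells $\sigma,\sigma'$ there are maximal cells $\sigma=\sigma_0,\dots,\sigma_m=\sigma'$ and codimension-$1$ cells $\tau_1,\dots,\tau_m$ with $\tau_i$ a face of both $\sigma_{i-1}$ and $\sigma_i$. **The tropical Jacobian.** With respect to an oriented model $\Gamma_X$, a harmonic $1$-form is a formal sum $\omega=\sum_e\omega_e\,de$, $\omega_e\in\mathbb R$, with $\sum_{s(e)=v}\omega_e=\sum_{t(e)=v}\omega_e$ for every vertex $v$; $\Omega(X)$ is the real vector space of these. Integration ($\int_e de=\ell(e)$, $\int_{e'}de=0$ for $e'\neq e$) gives an isomorphism $H_1(\Gamma_X,\mathbb R)\cong\Omega(X)^\vee$, and $J^{\mathrm{trop}}(X):=\Omega(X)^\vee/H_1(\Gamma_X,\mathbb Z)$. *)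

theory Defs
  imports
    "HOL-Analysis.Analysis"
    "HOL-Library.Function_Algebras"
    "Graph_Theory.Graph_Theory"
begin

section \<open>Quotient topologies\<close>

definition quotient_topology :: "'a topology \<Rightarrow> ('a \<times> 'a) set \<Rightarrow> 'a set topology" where
  "quotient_topology T R =
     topology (\<lambda>U. U \<subseteq> topspace T // R \<and> openin T {x \<in> topspace T. R `` {x} \<in> U})"

lemma openin_quotient_topology:
  "openin (quotient_topology T R) U \<longleftrightarrow>
     U \<subseteq> topspace T // R \<and> openin T {x \<in> topspace T. R `` {x} \<in> U}"
proof -
  have "istopology (\<lambda>U. U \<subseteq> topspace T // R \<and> openin T {x \<in> topspace T. R `` {x} \<in> U})"
    unfolding istopology_def
  proof (intro conjI allI impI)
    fix S S'
    assume S: "S \<subseteq> topspace T // R \<and> openin T {x \<in> topspace T. R `` {x} \<in> S}"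
      and S': "S' \<subseteq> topspace T // R \<and> openin T {x \<in> topspace T. R `` {x} \<in> S'}"
    show "S \<inter> S' \<subseteq> topspace T // R" using S by blast
    have "{x \<in> topspace T. R `` {x} \<in> S \<inter> S'} =
        {x \<in> topspace T. R `` {x} \<in> S} \<inter> {x \<in> topspace T. R `` {x} \<in> S'}" by blast
    then show "openin T {x \<in> topspace T. R `` {x} \<in> S \<inter> S'}"
      using openin_Int[OF conjunct2[OF S] conjunct2[OF S']] by (simp only:)
  next
    fix \<K>
    assume K: "\<forall>S\<in>\<K>. S \<subseteq> topspace T // R \<and> openin T {x \<in> topspace T. R `` {x} \<in> S}"
    then show "\<Union>\<K> \<subseteq> topspace T // R" by blast
    have "{x \<in> topspace T. R `` {x} \<in> \<Union>\<K>} = (\<Union>S\<in>\<K>. {x \<in> topspace T. R `` {x} \<in> S})" by blast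
    then show "openin T {x \<in> topspace T. R `` {x} \<in> \<Union>\<K>}"
      using K by (metis (no_types, lifting) openin_Union image_iff)
  qed
  then show ?thesis unfolding quotient_topology_def by simp
qed

lemma topspace_quotient_topology [simp]: "topspace (quotient_topology T R) = topspace T // R"
proof
  show "topspace (quotient_topology T R) \<subseteq> topspace T // R"
    using openin_topspace openin_quotient_topology by blast
  have "{x \<in> topspace T. R `` {x} \<in> topspace T // R} = topspace T"
    by (auto simp: quotient_def)
  then have "openin (quotient_topology T R) (topspace T // R)"
    by (simp add: openin_quotient_topology)
  then show "topspace T // R \<subseteq> topspace (quotient_topology T R)" by (rule openin_subset)
qed

lemma quotient_map_quotient_topology:
  "quotient_map T (quotient_topology T R) (\<lambda>x. R `` {x})"
  unfolding quotient_map_def openin_quotient_topology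
  by (auto simp: quotient_def)

section \<open>Tropical curves and their models\<close>

text \<open>
  An oriented graph, with loops and multiple edges, is a digraph \<open>G\<close>: the source and the target
  of an edge are its tail and its head. A length function is \<open>l :: 'e \<Rightarrow> real\<close>.
\<close>

datatype ('v, 'e) glued_point = Vert 'v | Inner 'e real

definition glued_space :: "('v, 'e) pre_digraph \<Rightarrow> ('e \<Rightarrow> real) \<Rightarrow> ('v, 'e) glued_point set" where
  "glued_space G l =
     Vert ` verts G \<union> {Inner e t | e t. e \<in> arcs G \<and> 0 < t \<and> t < l e}"

text \<open>The image in the glued space of the point \<open>t\<close> of the interval \<open>{0..l e}\<close>.\<close>

definition glue ::
  "('v, 'e) pre_digraph \<Rightarrow> ('e \<Rightarrow> real) \<Rightarrow> 'e \<Rightarrow> real \<Rightarrow> ('v, 'e) glued_point" where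
  "glue G l e t =
     (if t = 0 then Vert (tail G e) else if t = l e then Vert (head G e) else Inner e t)"

text \<open>
  \<open>chain G l x y r\<close>: one can pass from \<open>x\<close> to \<open>y\<close> by finitely many moves inside the intervals, of
  total length \<open>r\<close>. The infimum of these lengths is the gluing (path) metric.
\<close>

inductive chain ::
  "('v, 'e) pre_digraph \<Rightarrow> ('e \<Rightarrow> real) \<Rightarrow> ('v, 'e) glued_point \<Rightarrow> ('v, 'e) glued_point \<Rightarrow> real \<Rightarrow> bool"
  for G l where
  chain_refl: "chain G l x x 0"
| chain_step: "\<lbrakk>e \<in> arcs G; a \<in> {0..l e}; b \<in> {0..l e}; chain G l (glue G l e b) y r\<rbrakk>
    \<Longrightarrow> chain G l (glue G l e a) y (\<bar>a - b\<bar> + r)"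

definition glued_dist ::
  "('v, 'e) pre_digraph \<Rightarrow> ('e \<Rightarrow> real) \<Rightarrow> ('v, 'e) glued_point \<Rightarrow> ('v, 'e) glued_point \<Rightarrow> real" where
  "glued_dist G l x y = Inf {r. chain G l x y r}"

text \<open>The vertices of a model of \<open>X\<close> are points of \<open>X\<close>.\<close>

definition model_of :: "'a metric \<Rightarrow> ('a, 'e) pre_digraph \<Rightarrow> ('e \<Rightarrow> real) \<Rightarrow> bool" where
  "model_of X G l \<longleftrightarrow>
     fin_digraph G \<and> Digraph_Component.connected G \<and> (\<forall>e \<in> arcs G. 0 < l e) \<and>
     (\<exists>f. bij_betw f (glued_space G l) (mspace X) \<and>
          (\<forall>x \<in> glued_space G l. \<forall>y \<in> glued_space G l. mdist X (f x) (f y) = glued_dist G l x y) \<and>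
          (\<forall>v \<in> verts G. f (Vert v) = v))"

text \<open>As graphs are finite, edges may be taken to be natural numbers here.\<close>

definition tropical_curve :: "'a metric \<Rightarrow> bool" where
  "tropical_curve X \<longleftrightarrow> (\<exists>(G :: ('a, nat) pre_digraph) l. model_of X G l)"

text \<open>A tangent direction at \<open>p\<close> is the germ of a unit speed geodesic leaving \<open>p\<close>.\<close>

definition geodesics_from :: "'a metric \<Rightarrow> 'a \<Rightarrow> (real \<Rightarrow> 'a) set" where
  "geodesics_from X p =
     {\<gamma>. \<gamma> 0 = p \<and> (\<exists>\<epsilon>>0. \<gamma> ` {0..\<epsilon>} \<subseteq> mspace X \<and>
            (\<forall>s \<in> {0..\<epsilon>}. \<forall>t \<in> {0..\<epsilon>}. mdist X (\<gamma> s) (\<gamma> t) = \<bar>s - t\<bar>))}"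

definition tangent_directions :: "'a metric \<Rightarrow> 'a \<Rightarrow> (real \<Rightarrow> 'a) set set" where
  "tangent_directions X p =
     geodesics_from X p //
       {(\<gamma>, \<gamma>'). \<gamma> \<in> geodesics_from X p \<and> \<gamma>' \<in> geodesics_from X p \<and>
                 (\<exists>\<epsilon>>0. \<forall>t \<in> {0..\<epsilon>}. \<gamma> t = \<gamma>' t)}"

definition curve_valence :: "'a metric \<Rightarrow> 'a \<Rightarrow> nat" where
  "curve_valence X p = card (tangent_directions X p)"

definition supp_on :: "'a metric \<Rightarrow> ('a \<Rightarrow> 'b::zero) \<Rightarrow> 'a set" where
  "supp_on X f = {p \<in> mspace X. f p \<noteq> 0}"

text \<open>A curve without a weight function is the case \<open>w = (\<lambda>_. 0)\<close>.\<close>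

definition curve_vertices :: "'a metric \<Rightarrow> 'a \<Rightarrow> ('a \<Rightarrow> nat) \<Rightarrow> 'a set" where
  "curve_vertices X p\<^sub>0 w = {p \<in> mspace X. curve_valence X p \<noteq> 2 \<or> p = p\<^sub>0 \<or> 0 < w p}"

definition polarization :: "'a metric \<Rightarrow> ('a \<Rightarrow> real) \<Rightarrow> int \<Rightarrow> bool" where
  "polarization X \<mu> d \<longleftrightarrow> finite (supp_on X \<mu>) \<and> (\<Sum>p \<in> supp_on X \<mu>. \<mu> p) = of_int d"

section \<open>Quasistable pseudo-divisors\<close>

datatype ('v, 'e) sub_vertex = Orig 'v | Exc 'e

datatype 'e sub_edge = Whole 'e | Src_Half 'e | Tgt_Half 'e

definition subdivision ::
  "('v, 'e) pre_digraph \<Rightarrow> 'e set \<Rightarrow> (('v, 'e) sub_vertex, 'e sub_edge) pre_digraph" where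
  "subdivision G E =
     \<lparr>verts = Orig ` verts G \<union> Exc ` E,
      arcs = Whole ` (arcs G - E) \<union> Src_Half ` E \<union> Tgt_Half ` E,
      tail = (\<lambda>a. case a of Whole e \<Rightarrow> Orig (tail G e) | Src_Half e \<Rightarrow> Orig (tail G e)
                          | Tgt_Half e \<Rightarrow> Exc e),
      head = (\<lambda>a. case a of Whole e \<Rightarrow> Orig (head G e) | Src_Half e \<Rightarrow> Exc e
                          | Tgt_Half e \<Rightarrow> Orig (head G e))\<rparr>"

definition cut_size :: "('v, 'e) pre_digraph \<Rightarrow> 'v set \<Rightarrow> nat" where
  "cut_size G V = card {e \<in> arcs G. (tail G e \<in> V) \<noteq> (head G e \<in> V)}"

text \<open>Divisors are extended by zero outside the vertex set.\<close>

definition divisor :: "('v, 'e) pre_digraph \<Rightarrow> int \<Rightarrow> ('v \<Rightarrow> int) \<Rightarrow> bool" where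
  "divisor G d D \<longleftrightarrow> (\<forall>v. v \<notin> verts G \<longrightarrow> D v = 0) \<and> (\<Sum>v \<in> verts G. D v) = d"

definition quasistable :: "('v, 'e) pre_digraph \<Rightarrow> 'v \<Rightarrow> ('v \<Rightarrow> real) \<Rightarrow> ('v \<Rightarrow> int) \<Rightarrow> bool" where
  "quasistable G v\<^sub>0 \<mu> D \<longleftrightarrow>
     (\<forall>V. V \<subset> verts G \<longrightarrow>
        0 \<le> (\<Sum>v \<in> V. of_int (D v) - \<mu> v) + real (cut_size G V) / 2 \<and>
        (v\<^sub>0 \<in> V \<longrightarrow> 0 < (\<Sum>v \<in> V. of_int (D v) - \<mu> v) + real (cut_size G V) / 2))"

fun extend_pol :: "('v \<Rightarrow> real) \<Rightarrow> ('v, 'e) sub_vertex \<Rightarrow> real" where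
  "extend_pol \<mu> (Orig v) = \<mu> v"
| "extend_pol \<mu> (Exc e) = 0"

type_synonym ('v, 'e) pseudo_divisor = "'e set \<times> (('v, 'e) sub_vertex \<Rightarrow> int)"

definition quasistable_pseudo_divisors ::
  "('v, 'e) pre_digraph \<Rightarrow> 'v \<Rightarrow> ('v \<Rightarrow> real) \<Rightarrow> int \<Rightarrow> ('v, 'e) pseudo_divisor set" where
  "quasistable_pseudo_divisors G v\<^sub>0 \<mu> d =
     {(E, D). E \<subseteq> arcs G \<and> divisor (subdivision G E) d D \<and> (\<forall>e \<in> E. D (Exc e) = -1) \<and>
              quasistable (subdivision G E) (Orig v\<^sub>0) (extend_pol \<mu>) D}"

text \<open>
  A contraction from the subdivision along \<open>E\<close> to the subdivision along \<open>E' \<subseteq> E\<close> is given by the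
  set \<open>S \<subseteq> E - E'\<close> of those edges over which the half adjacent to the source is contracted; over
  the edges in \<open>E - E' - S\<close> the half adjacent to the target is contracted. For a loop the two
  choices have the same effect on vertices, but they are different specializations.
\<close>

fun contract_vertex ::
  "('v, 'e) pre_digraph \<Rightarrow> 'e set \<Rightarrow> 'e set \<Rightarrow> ('v, 'e) sub_vertex \<Rightarrow> ('v, 'e) sub_vertex" where
  "contract_vertex G E' S (Orig v) = Orig v"
| "contract_vertex G E' S (Exc e) =
     (if e \<in> E' then Exc e else if e \<in> S then Orig (tail G e) else Orig (head G e))"

definition specialization ::
  "('v, 'e) pre_digraph \<Rightarrow> ('v, 'e) pseudo_divisor \<Rightarrow> ('v, 'e) pseudo_divisor \<Rightarrow> 'e set \<Rightarrow> bool" where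
  "specialization G \<sigma> \<tau> S \<longleftrightarrow>
     (case (\<sigma>, \<tau>) of ((E, D), (E', D')) \<Rightarrow>
        E' \<subseteq> E \<and> S \<subseteq> E - E' \<and>
        (\<forall>v \<in> verts (subdivision G E').
           D' v = (\<Sum>u \<in> {u \<in> verts (subdivision G E). contract_vertex G E' S u = v}. D u)))"

section \<open>The polyhedral complex\<close>

text \<open>
  The cells of the complex are indexed by a set \<open>C\<close> of pseudo-divisors; \<open>(E, D)\<close> is the index of a
  copy of the box \<open>cell_topology l (E, D)\<close>, which has dimension \<open>card E\<close>. The faces of a
  cell are the cells to which it specializes.
\<close>

definition cell_dim :: "('v, 'e) pseudo_divisor \<Rightarrow> nat" where
  "cell_dim \<sigma> = card (fst \<sigma>)"

definition is_face :: "('v, 'e) pre_digraph \<Rightarrow> ('v, 'e) pseudo_divisor \<Rightarrow> ('v, 'e) pseudo_divisor \<Rightarrow> bool" where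
  "is_face G \<tau> \<sigma> \<longleftrightarrow> (\<exists>S. specialization G \<sigma> \<tau> S)"

definition maximal_cells ::
  "('v, 'e) pre_digraph \<Rightarrow> ('v, 'e) pseudo_divisor set \<Rightarrow> ('v, 'e) pseudo_divisor set" where
  "maximal_cells G C = {\<sigma> \<in> C. \<forall>\<sigma>' \<in> C. is_face G \<sigma> \<sigma>' \<longrightarrow> \<sigma>' = \<sigma>}"

definition pure_dimensional ::
  "('v, 'e) pre_digraph \<Rightarrow> ('v, 'e) pseudo_divisor set \<Rightarrow> nat \<Rightarrow> bool" where
  "pure_dimensional G C n \<longleftrightarrow> (\<forall>\<sigma> \<in> maximal_cells G C. cell_dim \<sigma> = n)"

definition complex_dim :: "('v, 'e) pseudo_divisor set \<Rightarrow> nat" where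
  "complex_dim C = Max (cell_dim ` C)"

definition connected_in_codim_1 ::
  "('v, 'e) pre_digraph \<Rightarrow> ('v, 'e) pseudo_divisor set \<Rightarrow> bool" where
  "connected_in_codim_1 G C \<longleftrightarrow>
     (\<forall>\<sigma> \<in> maximal_cells G C. \<forall>\<sigma>' \<in> maximal_cells G C.
        \<exists>(m::nat) s t. s 0 = \<sigma> \<and> s m = \<sigma>' \<and>
          (\<forall>i \<le> m. s i \<in> maximal_cells G C) \<and>
          (\<forall>i \<in> {1..m}. t i \<in> C \<and> cell_dim (t i) + 1 = complex_dim C \<and>
                         is_face G (t i) (s (i - 1)) \<and> is_face G (t i) (s i)))"

definition cell_topology :: "('e \<Rightarrow> real) \<Rightarrow> ('v, 'e) pseudo_divisor \<Rightarrow> ('e \<Rightarrow> real) topology" where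
  "cell_topology l \<sigma> = product_topology (\<lambda>e. top_of_set {0..l e}) (fst \<sigma>)"

definition face_map ::
  "('e \<Rightarrow> real) \<Rightarrow> ('v, 'e) pseudo_divisor \<Rightarrow> ('v, 'e) pseudo_divisor \<Rightarrow> 'e set
     \<Rightarrow> ('e \<Rightarrow> real) \<Rightarrow> ('e \<Rightarrow> real)" where
  "face_map l \<sigma> \<tau> S x =
     (\<lambda>e \<in> fst \<sigma>. if e \<in> fst \<tau> then x e else if e \<in> S then 0 else l e)"

definition face_gluing ::
  "('v, 'e) pre_digraph \<Rightarrow> ('e \<Rightarrow> real) \<Rightarrow> ('v, 'e) pseudo_divisor set
     \<Rightarrow> ((('v, 'e) pseudo_divisor \<times> ('e \<Rightarrow> real)) \<times> (('v, 'e) pseudo_divisor \<times> ('e \<Rightarrow> real))) set" where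
  "face_gluing G l C =
     {((\<tau>, x), (\<sigma>, face_map l \<sigma> \<tau> S x)) | \<tau> \<sigma> S x.
        \<tau> \<in> C \<and> \<sigma> \<in> C \<and> specialization G \<sigma> \<tau> S \<and> x \<in> topspace (cell_topology l \<tau>)}"

text \<open>
  The colimit in topological spaces: the quotient of the disjoint union of the cells by the
  equivalence relation generated by the face morphisms.
\<close>

definition complex_space ::
  "('v, 'e) pre_digraph \<Rightarrow> ('e \<Rightarrow> real) \<Rightarrow> ('v, 'e) pseudo_divisor set
     \<Rightarrow> (('v, 'e) pseudo_divisor \<times> ('e \<Rightarrow> real)) set topology" where
  "complex_space G l C =
     quotient_topology (sum_topology (cell_topology l) C)
       ((face_gluing G l C \<union> (face_gluing G l C)\<inverse>)\<^sup>*)"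

section \<open>The tropical Jacobian\<close>

text \<open>
  First homology of \<open>G\<close> with coefficients in \<open>'r\<close>: the kernel of the boundary map
  on 1-chains, which sends an edge to its target minus its source.
\<close>

definition H1 :: "('v, 'e) pre_digraph \<Rightarrow> ('e \<Rightarrow> 'r::ab_group_add) set" where
  "H1 G = {c. (\<forall>e. e \<notin> arcs G \<longrightarrow> c e = 0) \<and>
              (\<forall>v \<in> verts G. (\<Sum>e \<in> in_arcs G v. c e) - (\<Sum>e \<in> out_arcs G v. c e) = 0)}"

definition betti_number_1 :: "('v, 'e) pre_digraph \<Rightarrow> nat" where
  "betti_number_1 G = vector_space.dim (\<lambda>(r::real) c e. r * c e) (H1 G :: ('e \<Rightarrow> real) set)"

definition harmonic_forms :: "('v, 'e) pre_digraph \<Rightarrow> ('e \<Rightarrow> real) set" where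
  "harmonic_forms G =
     {\<omega>. (\<forall>e. e \<notin> arcs G \<longrightarrow> \<omega> e = 0) \<and>
         (\<forall>v \<in> verts G. (\<Sum>e \<in> out_arcs G v. \<omega> e) = (\<Sum>e \<in> in_arcs G v. \<omega> e))}"

definition integral_along ::
  "('v, 'e) pre_digraph \<Rightarrow> ('e \<Rightarrow> real) \<Rightarrow> ('e \<Rightarrow> real) \<Rightarrow> ('e \<Rightarrow> real) \<Rightarrow> real" where
  "integral_along G l c \<omega> = (\<Sum>e \<in> arcs G. c e * \<omega> e * l e)"

definition harmonic_dual :: "('v, 'e) pre_digraph \<Rightarrow> (('e \<Rightarrow> real) \<Rightarrow> real) set" where
  "harmonic_dual G =
     {\<phi> \<in> extensional (harmonic_forms G).
        (\<forall>\<omega> \<in> harmonic_forms G. \<forall>\<eta> \<in> harmonic_forms G. \<phi> (\<lambda>e. \<omega> e + \<eta> e) = \<phi> \<omega> + \<phi> \<eta>) \<and>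
        (\<forall>r. \<forall>\<omega> \<in> harmonic_forms G. \<phi> (\<lambda>e. r * \<omega> e) = r * \<phi> \<omega>)}"

text \<open>
  The dual carries the topology of pointwise convergence, which is the usual vector space
  topology since the space of harmonic forms is finite-dimensional.
\<close>

definition harmonic_dual_topology :: "('v, 'e) pre_digraph \<Rightarrow> (('e \<Rightarrow> real) \<Rightarrow> real) topology" where
  "harmonic_dual_topology G =
     subtopology (product_topology (\<lambda>_. euclideanreal) (harmonic_forms G)) (harmonic_dual G)"

definition lattice_relation ::
  "('v, 'e) pre_digraph \<Rightarrow> ('e \<Rightarrow> real) \<Rightarrow> ((('e \<Rightarrow> real) \<Rightarrow> real) \<times> (('e \<Rightarrow> real) \<Rightarrow> real)) set" where
  "lattice_relation G l =
     {(\<phi>, \<psi>). \<phi> \<in> harmonic_dual G \<and> \<psi> \<in> harmonic_dual G \<and>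
        (\<exists>c \<in> (H1 G :: ('e \<Rightarrow> int) set). \<forall>\<omega> \<in> harmonic_forms G.
           \<psi> \<omega> - \<phi> \<omega> = integral_along G l (\<lambda>e. of_int (c e)) \<omega>)}"

definition tropical_jacobian ::
  "('v, 'e) pre_digraph \<Rightarrow> ('e \<Rightarrow> real) \<Rightarrow> (('e \<Rightarrow> real) \<Rightarrow> real) set topology" where
  "tropical_jacobian G l = quotient_topology (harmonic_dual_topology G) (lattice_relation G l)"

end

theory Submission
  imports Defs
begin

text \<open>
  Encode a point of the complex by a real 1-chain \<open>z\<close>: on an edge \<open>e\<close> with non-integral \<open>z e\<close> an integral
  flow \<open>\<lfloor>z e\<rfloor>\<close> runs from the source to an exceptional vertex and \<open>\<lceil>z e\<rceil>\<close> runs on to the target, so that the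
  vertex carries the value \<open>-1\<close>, and its position is chosen such that the average flow is \<open>z e\<close>. Then the
  functional attached to the point is \<open>\<omega> \<mapsto> \<Sum>e. z e * \<omega> e * l e\<close>, and two chains define the same
  functional iff they differ by \<open>dh/l\<close> for a potential \<open>h\<close> on the vertices. Quasistability of \<open>z + dh/l\<close>
  says that every one-sided derivative of the convex function
  \<open>h \<mapsto> \<Sum>v. q v * h v + \<Sum>e. l e * \<Phi> ((z + dh/l) e)\<close> in the direction of the indicator of a vertex set is
  nonnegative, and positive if the set contains the base point; here \<open>\<Phi>\<close> is the piecewise linear
  interpolation of \<open>x\<^sup>2/2\<close> at the integers. A minimizer with smallest coordinate sum exists and is the
  only such \<open>h\<close> up to constants, so every class in the Jacobian has exactly one quasistable
  representative. Comparing two quasistable chains along the level sets of the potential between them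
  also shows that the representative depends continuously on the class, up to passing to a
  coface; the homeomorphism, the purity and (along a generic segment in the Jacobian) the
  connectedness in codimension 1 follow from this.
\<close>

section \<open>Boundaries and cuts\<close>

text \<open>The flow starts from \<open>d\<close> times the base point, so \<open>q\<close> is that
  divisor minus \<mu>. A pseudo-divisor determines its flow only up to integral cycles, and this
  ambiguity is exactly the lattice of the Jacobian. The half-integral slopes of \<Phi> absorb the
  term \<delta>/2 of quasistability on whole and on subdivided edges alike. The price is that \<Phi>
  is not strictly convex: minimizers of the energy may be non-unique even up to constants, and the
  strict inequality at the base point is what selects one of them. In terms of chains a closed cell
  is a product of intervals between consecutive integers, and a face arises by moving coordinates to
  endpoints. The endpoint reached tells which half is contracted, so the two specializations along a
  loop are kept apart without extra bookkeeping. The obstacle on the topological side is that the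
  complex is a colimit: the representative of a class jumps between disjoint cells while its image
  in the quotient moves continuously. The homeomorphism is therefore built from maps between the two
  spaces before dividing out, which are inverse to each other only modulo the relations.\<close>

definition boundary :: "('v, 'e) pre_digraph \<Rightarrow> ('e \<Rightarrow> 'r::ab_group_add) \<Rightarrow> 'v \<Rightarrow> 'r" where
  "boundary G f v = (\<Sum>e \<in> in_arcs G v. f e) - (\<Sum>e \<in> out_arcs G v. f e)"

text \<open>Connectedness of the spanning subgraph with edge set \<open>F\<close>, phrased through
  cuts because stability gives inequalities about cuts rather than paths.\<close>

definition cut_connected :: "('v, 'e) pre_digraph \<Rightarrow> 'e set \<Rightarrow> bool" where
  "cut_connected G F \<longleftrightarrow> F \<subseteq> arcs G \<and>
     (\<forall>W. W \<subset> verts G \<longrightarrow> W \<noteq> {} \<longrightarrow> (\<exists>e\<in>F. (tail G e \<in> W) \<noteq> (head G e \<in> W)))"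

lemma boundary_add: "boundary G (\<lambda>e. f e + g e) v = boundary G f v + boundary G g v"
  by (simp add: boundary_def sum.distrib)

lemma boundary_diff: "boundary G (\<lambda>e. f e - g e) v = boundary G f v - boundary G g v"
  by (simp add: boundary_def sum_subtractf)

lemma boundary_zero [simp]: "boundary G (\<lambda>e. 0) v = 0"
  by (simp add: boundary_def)

lemma boundary_cong:
  "(\<And>e. e \<in> arcs G \<Longrightarrow> f e = g e) \<Longrightarrow> boundary G f v = boundary G g v"
  unfolding boundary_def by (intro arg_cong2[where f = minus] sum.cong) auto

lemma boundary_scale: "boundary G (\<lambda>e. r * f e) v = (r::'r::ring) * boundary G f v"
  by (simp add: boundary_def sum_distrib_left right_diff_distrib)

lemma H1_iff: "c \<in> H1 G \<longleftrightarrow> (\<forall>e. e \<notin> arcs G \<longrightarrow> c e = 0) \<and> (\<forall>v \<in> verts G. boundary G c v = 0)"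
  by (auto simp: H1_def boundary_def)

lemma harmonic_forms_eq_H1: "harmonic_forms G = H1 G"
  by (auto simp: harmonic_forms_def H1_def)

lemma H1_combination:
  fixes c c' :: "'e \<Rightarrow> 'r::ring"
  shows "\<lbrakk>c \<in> H1 G; c' \<in> H1 G\<rbrakk> \<Longrightarrow> (\<lambda>e. r * c e + s * c' e) \<in> H1 G"
  by (simp add: H1_iff boundary_add boundary_scale)

lemma H1_sum:
  fixes c :: "'i \<Rightarrow> 'e \<Rightarrow> 'r::ring"
  shows "(\<And>i. i \<in> I \<Longrightarrow> c i \<in> H1 G) \<Longrightarrow> (\<lambda>e. \<Sum>i\<in>I. r i * c i e) \<in> H1 G"
proof (induction I rule: infinite_finite_induct)
  case (insert x F)
  then show ?case
    by (simp add: H1_iff boundary_add boundary_scale)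
qed (simp_all add: H1_iff)

context fin_digraph
begin

lemma sum_in_arcs: "(\<Sum>e\<in>in_arcs G v. f e) = (\<Sum>e\<in>arcs G. if head G e = v then f e else 0)"
  by (simp add: in_arcs_def sum.inter_filter)

lemma sum_out_arcs: "(\<Sum>e\<in>out_arcs G v. f e) = (\<Sum>e\<in>arcs G. if tail G e = v then f e else 0)"
  by (simp add: out_arcs_def sum.inter_filter)

lemma boundary_eq:
  "boundary G f v =
    (\<Sum>e\<in>arcs G. (if head G e = v then f e else 0) - (if tail G e = v then f e else 0))"
  by (simp add: boundary_def sum_in_arcs sum_out_arcs sum_subtractf)

lemma sum_fibre_head:
  assumes "W \<subseteq> verts G"
  shows "(\<Sum>v\<in>W. \<Sum>e\<in>in_arcs G v. f e) = (\<Sum>e\<in>arcs G. if head G e \<in> W then f e else 0)"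
proof -
  have "finite W" by (rule finite_subset[OF assms finite_verts])
  then show ?thesis
    unfolding sum_in_arcs
    by (subst sum.swap, intro sum.cong) (simp_all add: sum.delta' sum.delta)
qed

lemma sum_fibre_tail:
  assumes "W \<subseteq> verts G"
  shows "(\<Sum>v\<in>W. \<Sum>e\<in>out_arcs G v. f e) = (\<Sum>e\<in>arcs G. if tail G e \<in> W then f e else 0)"
proof -
  have "finite W" by (rule finite_subset[OF assms finite_verts])
  then show ?thesis
    unfolding sum_out_arcs
    by (subst sum.swap, intro sum.cong) (simp_all add: sum.delta' sum.delta)
qed

text \<open>Summation by parts: the boundary is adjoint to taking differences of potentials. It
  gives the orthogonality of cycles and exact chains, and it rewrites the charge term of the energy
  as a sum over edges.\<close>

lemma sum_boundary_mult:
  fixes f :: "'b \<Rightarrow> real"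
  shows "(\<Sum>v\<in>verts G. boundary G f v * h v) = (\<Sum>e\<in>arcs G. f e * (h (head G e) - h (tail G e)))"
proof -
  have "(\<Sum>v\<in>verts G. boundary G f v * h v) =
      (\<Sum>v\<in>verts G. \<Sum>e\<in>in_arcs G v. f e * h (head G e)) - (\<Sum>v\<in>verts G. \<Sum>e\<in>out_arcs G v. f e * h (tail G e))"
  proof -
    have "(\<Sum>e\<in>in_arcs G v. f e) * h v = (\<Sum>e\<in>in_arcs G v. f e * h (head G e))" for v
      unfolding sum_distrib_right by (rule sum.cong) auto
    moreover have "(\<Sum>e\<in>out_arcs G v. f e) * h v = (\<Sum>e\<in>out_arcs G v. f e * h (tail G e))" for v
      unfolding sum_distrib_right by (rule sum.cong) auto
    ultimately show ?thesis
      by (simp add: boundary_def left_diff_distrib sum_subtractf)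
  qed
  also have "\<dots> = (\<Sum>e\<in>arcs G. f e * h (head G e)) - (\<Sum>e\<in>arcs G. f e * h (tail G e))"
    unfolding sum_fibre_head[OF subset_refl] sum_fibre_tail[OF subset_refl] by simp
  finally show ?thesis
    by (simp add: sum_subtractf right_diff_distrib)
qed

text \<open>If no edge crossed \<open>W\<close>, a walk starting in \<open>W\<close> could never
  reach a vertex outside.\<close>

lemma connected_imp_cut_connected:
  assumes "Digraph_Component.connected G"
  shows "cut_connected G (arcs G)"
  unfolding cut_connected_def
proof (intro conjI allI impI subset_refl)
  fix W assume "W \<subset> verts G" "W \<noteq> {}"
  then obtain u v where uv: "u \<in> W" "v \<notin> W" "u \<in> verts G" "v \<in> verts G" by blast
  show "\<exists>e\<in>arcs G. (tail G e \<in> W) \<noteq> (head G e \<in> W)"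
  proof (rule ccontr)
    assume no: "\<not> ?thesis"
    have "u \<rightarrow>\<^sup>*\<^bsub>mk_symmetric G\<^esub> v"
      using assms uv by (auto simp: Digraph_Component.connected_def strongly_connected_def)
    then have "(u, v) \<in> rtrancl_on (verts (mk_symmetric G)) (arcs_ends (mk_symmetric G))"
      by (simp add: reachable_def)
    from this uv(1) have "v \<in> W"
    proof (induction rule: rtrancl_on.induct)
      case (rtrancl_on_into_rtrancl_on x y z)
      then have "(y, z) \<in> arcs_ends G \<or> (z, y) \<in> arcs_ends G"
        by (simp add: mk_symmetric_def arcs_ends_conv) blast
      then show ?case
        using rtrancl_on_into_rtrancl_on.IH rtrancl_on_into_rtrancl_on.prems no by (auto simp: arcs_ends_conv)
    qed (use uv in simp)
    with uv show False by simp
  qed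
qed

text \<open>The vertices that a flow of value \<open>r\<close> from \<open>u\<close> can reach form
  a set that no edge of \<open>F\<close> leaves, since \<open>r\<close> or \<open>-r\<close> on such
  an edge extends the flow. Coefficients are general: divisors call for integral flows, charges and
  forms for real ones.\<close>

lemma boundary_surj_pair:
  assumes F: "cut_connected G F" and "u \<in> verts G" "v \<in> verts G"
  shows "\<exists>n. (\<forall>e. e \<notin> F \<longrightarrow> n e = 0) \<and>
    (\<forall>w. boundary G n w = (if w = v then r else 0) - (if w = u then r else (0::'r::ab_group_add)))"
proof -
  define P where "P v n \<longleftrightarrow> (\<forall>e. e \<notin> F \<longrightarrow> n e = 0) \<and>
    (\<forall>w. boundary G n w = (if w = v then r else 0) - (if w = u then r else 0))" for v n
  define W where "W = {v \<in> verts G. \<exists>n. P v n}"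
  have "P u (\<lambda>e. 0)" by (simp add: P_def)
  then have u: "u \<in> W" using assms by (auto simp: W_def)
  have "W = verts G"
  proof (rule ccontr)
    assume "W \<noteq> verts G"
    then have "W \<subset> verts G" by (auto simp: W_def)
    then obtain e where e: "e \<in> F" "(tail G e \<in> W) \<noteq> (head G e \<in> W)"
      using F u unfolding cut_connected_def by blast
    have ea: "e \<in> arcs G" using F e by (auto simp: cut_connected_def)
    have ends: "tail G e \<in> verts G" "head G e \<in> verts G" using ea by auto
    \<comment> \<open>Valid for a loop as well, where the two corrections cancel.\<close>
    have bd: "boundary G (\<lambda>x. n x + (if x = e then s else 0)) w =
      boundary G n w + (if w = head G e then s else 0) - (if w = tail G e then s else 0)" for n s w
    proof -
      have "boundary G (\<lambda>x. if x = e then s else 0) w =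
          (\<Sum>x\<in>arcs G. if x = e then (if w = head G e then s else 0) - (if w = tail G e then s else 0) else 0)"
        unfolding boundary_eq by (intro sum.cong) auto
      then show ?thesis
        using ea by (simp add: boundary_add)
    qed
    show False
    proof (cases "tail G e \<in> W")
      case True
      then obtain n where "P (tail G e) n" by (auto simp: W_def)
      then have "P (head G e) (\<lambda>x. n x + (if x = e then r else 0))"
        using e unfolding P_def bd by auto
      with True e ends show False by (auto simp: W_def)
    next
      case False
      with e obtain n where "P (head G e) n" by (auto simp: W_def)
      then have "P (tail G e) (\<lambda>x. n x + (if x = e then -r else 0))"
        using e unfolding P_def bd by auto
      with False e ends show False by (auto simp: W_def)
    qed
  qed
  then have "v \<in> W" using assms by simp
  then obtain n where "P v n" by (auto simp: W_def)
  then show ?thesis unfolding P_def by (intro exI[of _ n])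
qed

lemma boundary_sum:
  "boundary G (\<lambda>e. \<Sum>i\<in>I. f i e) v = (\<Sum>i\<in>I. boundary G (f i) v)"
proof -
  have "(\<Sum>e\<in>A. \<Sum>i\<in>I. f i e) = (\<Sum>i\<in>I. \<Sum>e\<in>A. f i e)" for A
    by (rule sum.swap)
  then show ?thesis by (simp add: boundary_def sum_subtractf)
qed

text \<open>Send \<open>b v\<close> from a common root \<open>u\<close> to every \<open>v\<close>;
  the root loses the total of \<open>b\<close>, which is 0.\<close>

lemma boundary_surj:
  fixes b :: "'a \<Rightarrow> 'r::ab_group_add"
  assumes F: "cut_connected G F" and "sum b (verts G) = 0"
  shows "\<exists>n. (\<forall>e. e \<notin> F \<longrightarrow> n e = 0) \<and> (\<forall>v \<in> verts G. boundary G n v = b v)"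
proof (cases "verts G = {}")
  case True
  then show ?thesis by (intro exI[of _ "\<lambda>_. 0"]) auto
next
  case False
  then obtain u where u: "u \<in> verts G" by blast
  define P where "P v n \<longleftrightarrow> (\<forall>e. e \<notin> F \<longrightarrow> n e = 0) \<and>
    (\<forall>w. boundary G n w = (if w = v then b v else 0) - (if w = u then b v else 0))" for v n
  have "\<forall>v\<in>verts G. \<exists>n. P v n"
    unfolding P_def using boundary_surj_pair[OF F u] by blast
  then obtain n where n: "\<forall>v\<in>verts G. P v (n v)" using bchoice by metis
  have "boundary G (\<lambda>e. \<Sum>v\<in>verts G. n v e) w = b w" if w: "w \<in> verts G" for w
  proof -
    have "boundary G (\<lambda>e. \<Sum>v\<in>verts G. n v e) w =
        (\<Sum>v\<in>verts G. (if w = v then b v else 0) - (if w = u then b v else 0))"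
      unfolding boundary_sum using n by (intro sum.cong) (auto simp: P_def)
    also have "\<dots> = b w - (if w = u then sum b (verts G) else 0)"
      using w by (simp add: sum_subtractf)
    finally show ?thesis using assms(2) by simp
  qed
  moreover have "(\<Sum>v\<in>verts G. n v e) = 0" if e: "e \<notin> F" for e
  proof (intro sum.neutral ballI)
    fix v assume "v \<in> verts G"
    with n have "P v (n v)" by blast
    then show "n v e = 0" using e by (simp add: P_def)
  qed
  ultimately show ?thesis by (intro exI[of _ "\<lambda>e. \<Sum>v\<in>verts G. n v e"]) simp
qed

end

text \<open>Walk from \<open>v\<close> up to \<open>u\<close> through the superlevel sets of \<open>h\<close>, of which at most \<open>card V\<close> are distinct.\<close>

lemma level_gap:
  fixes h :: "'v \<Rightarrow> real"
  assumes "finite V" "0 \<le> M" and u: "u \<in> V" "v \<in> V"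
    and gap: "\<And>a. {x \<in> V. a < h x} \<noteq> {} \<Longrightarrow> {x \<in> V. a < h x} \<noteq> V \<Longrightarrow>
      \<exists>x\<in>V. \<exists>y\<in>V. h x \<le> a \<and> a < h y \<and> h y - h x \<le> M"
  shows "h u - h v \<le> real (card V) * M"
proof -
  have *: "h u - h v \<le> real (card {x \<in> V. h v < h x}) * M" if "v \<in> V" for v
    using that
  proof (induction "card {x \<in> V. h v < h x}" arbitrary: v rule: less_induct)
    case less
    show ?case
    proof (cases "h u \<le> h v")
      case True
      then show ?thesis using assms(2) by (smt (verit) mult_nonneg_nonneg of_nat_0_le_iff)
    next
      case False
      then obtain x y where xy: "x \<in> V" "y \<in> V" "h x \<le> h v" "h v < h y" "h y - h x \<le> M"
        using gap[of "h v"] u less.prems by fastforce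
      have lt: "card {x \<in> V. h y < h x} < card {x \<in> V. h v < h x}"
        using xy assms(1) by (intro psubset_card_mono) auto
      have "h u - h v \<le> real (card {x \<in> V. h y < h x}) * M + M"
        using less.hyps[OF lt xy(2)] xy by linarith
      also have "\<dots> = real (Suc (card {x \<in> V. h y < h x})) * M"
        by (simp add: algebra_simps)
      also have "\<dots> \<le> real (card {x \<in> V. h v < h x}) * M"
        using lt assms(2) by (intro mult_right_mono) auto
      finally show ?thesis .
    qed
  qed
  also have "real (card {x \<in> V. h v < h x}) * M \<le> real (card V) * M"
    using assms by (intro mult_right_mono) (auto intro: card_mono)
  finally show ?thesis using u by blast
qed

section \<open>Stable chains\<close>

text \<open>The slope on [n, n + 1] is n + 1/2. Hence at every \<open>x\<close>, integral or not,
  the right derivative is \<open>\<lfloor>x\<rfloor> + 1 / 2\<close> and the left derivative is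
  \<open>\<lceil>x\<rceil> - 1 / 2\<close>.\<close>

definition quad_interp :: "real \<Rightarrow> real" where
  "quad_interp x = of_int \<lfloor>x\<rfloor> ^ 2 / 2 + (of_int \<lfloor>x\<rfloor> + 1 / 2) * (x - of_int \<lfloor>x\<rfloor>)"

lemma quad_interp_right:
  assumes "0 \<le> t" "t \<le> of_int \<lfloor>x\<rfloor> + 1 - x"
  shows "quad_interp (x + t) = quad_interp x + t * (of_int \<lfloor>x\<rfloor> + 1 / 2)"
proof (cases "t < of_int \<lfloor>x\<rfloor> + 1 - x")
  case True
  then have "\<lfloor>x + t\<rfloor> = \<lfloor>x\<rfloor>" using assms by linarith
  then show ?thesis by (simp add: quad_interp_def field_simps)
next
  case False
  then have "x + t = of_int (\<lfloor>x\<rfloor> + 1)" using assms by simp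
  then have f: "\<lfloor>x + t\<rfloor> = \<lfloor>x\<rfloor> + 1" and t: "t = of_int \<lfloor>x\<rfloor> + 1 - x" by (metis floor_of_int, simp)
  show ?thesis unfolding quad_interp_def f by (simp add: t field_simps power2_eq_square)
qed

lemma quad_interp_left:
  assumes "0 \<le> t" "t \<le> x - of_int \<lceil>x\<rceil> + 1"
  shows "quad_interp (x - t) = quad_interp x - t * (of_int \<lceil>x\<rceil> - 1 / 2)"
proof (cases "t = 0")
  case False
  then have f: "\<lfloor>x - t\<rfloor> = \<lceil>x\<rceil> - 1" using assms by linarith
  have "quad_interp (x - t + t) = quad_interp (x - t) + t * (of_int \<lfloor>x - t\<rfloor> + 1 / 2)"
    using assms f by (intro quad_interp_right) simp_all
  then show ?thesis unfolding f by (simp add: algebra_simps)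
qed simp

text \<open>A chord of a convex function lies above it. This quadratic lower bound makes the energy
  coercive.\<close>

lemma quad_interp_ge: "x ^ 2 / 2 \<le> quad_interp x"
proof -
  define f where "f = x - of_int \<lfloor>x\<rfloor>"
  have "0 \<le> f" "f \<le> 1" unfolding f_def by linarith+
  then have "0 \<le> f * (1 - f) / 2" by simp
  also have "f * (1 - f) / 2 = quad_interp x - x ^ 2 / 2"
    by (simp add: f_def quad_interp_def field_simps power2_eq_square)
  finally show ?thesis by simp
qed

lemma continuous_quad_interp: "isCont quad_interp x"
  unfolding continuous_at_eps_delta
proof (intro allI impI)
  fix e :: real assume e: "0 < e"
  define r where "r = min (of_int \<lfloor>x\<rfloor> + 1 - x) (x - of_int \<lceil>x\<rceil> + 1)"
  have r: "0 < r" unfolding r_def by (simp, linarith)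
  \<comment> \<open>A bound for both one-sided slopes at \<open>x\<close>.\<close>
  define C where "C = \<bar>x\<bar> + 2"
  have C: "0 < C" "\<bar>of_int \<lfloor>x\<rfloor> + 1 / 2\<bar> \<le> C" "\<bar>of_int \<lceil>x\<rceil> - 1 / 2\<bar> \<le> C"
    unfolding C_def by linarith+
  show "\<exists>d>0. \<forall>x'. dist x' x < d \<longrightarrow> dist (quad_interp x') (quad_interp x) < e"
  proof (intro exI[of _ "min r (e / C)"] conjI allI impI)
    show "0 < min r (e / C)" using r e C by simp
    fix x' assume "dist x' x < min r (e / C)"
    then have d: "\<bar>x' - x\<bar> < r" "\<bar>x' - x\<bar> * C < e" using C by (auto simp: dist_real_def field_simps)
    have "\<bar>quad_interp x' - quad_interp x\<bar> \<le> \<bar>x' - x\<bar> * C"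
    proof (cases "x \<le> x'")
      case True
      then have "quad_interp (x + (x' - x)) = quad_interp x + (x' - x) * (of_int \<lfloor>x\<rfloor> + 1 / 2)"
        using d by (intro quad_interp_right) (auto simp: r_def)
      then show ?thesis using C by (simp add: abs_mult mult_left_mono)
    next
      case False
      then have "quad_interp (x - (x - x')) = quad_interp x - (x - x') * (of_int \<lceil>x\<rceil> - 1 / 2)"
        using d by (intro quad_interp_left) (auto simp: r_def)
      then have "\<bar>quad_interp x' - quad_interp x\<bar> = \<bar>x - x'\<bar> * \<bar>of_int \<lceil>x\<rceil> - 1 / 2\<bar>"
        by (simp add: abs_mult[symmetric])
      then show ?thesis using C by (simp add: abs_minus_commute mult_left_mono)
    qed
    then show "dist (quad_interp x') (quad_interp x) < e"
      using d by (simp add: dist_real_def)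
  qed
qed

lemma finite_positive_lower_bound:
  fixes f :: "'i \<Rightarrow> real"
  assumes "finite A" "\<And>a. a \<in> A \<Longrightarrow> 0 < f a"
  obtains \<epsilon> where "0 < \<epsilon>" "\<And>a. a \<in> A \<Longrightarrow> \<epsilon> \<le> f a"
proof
  \<comment> \<open>The extra 1 keeps the minimum meaningful when \<open>A\<close> is empty.\<close>
  show "0 < Min (insert 1 (f ` A))" using assms by (subst Min_gr_iff) auto
  show "Min (insert 1 (f ` A)) \<le> f a" if "a \<in> A" for a using assms that by (intro Min_le) auto
qed

locale polarized_graph = fin_digraph G
  for G :: "('v, 'e) pre_digraph" +
  fixes l :: "'e \<Rightarrow> real" and v\<^sub>0 :: 'v and \<mu> :: "'v \<Rightarrow> real" and d :: int
  assumes conn: "Digraph_Component.connected G"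
    and l_pos: "e \<in> arcs G \<Longrightarrow> 0 < l e"
    and base_vertex: "v\<^sub>0 \<in> verts G"
    and total_pol: "(\<Sum>v\<in>verts G. \<mu> v) = of_int d"
begin

lemma cut_conn: "cut_connected G (arcs G)"
  using conn by (rule connected_imp_cut_connected)

text \<open>Its total being 0 is what makes the energy invariant under adding a constant to the
  potential.\<close>

definition charge :: "'v \<Rightarrow> real" where
  "charge v = (if v = v\<^sub>0 then of_int d else 0) - \<mu> v"

lemma sum_charge: "sum charge (verts G) = 0"
  using base_vertex by (simp add: charge_def sum_subtractf total_pol)

definition shift :: "('e \<Rightarrow> real) \<Rightarrow> ('v \<Rightarrow> real) \<Rightarrow> 'e \<Rightarrow> real" where
  "shift y h e = y e + (h (head G e) - h (tail G e)) / l e"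

text \<open>Raising \<open>W\<close> increases the chain on edges into \<open>W\<close> and
  decreases it on edges out of \<open>W\<close>: hence the right slope in the first case and the
  negated left slope in the second.\<close>

definition cut_term :: "('e \<Rightarrow> real) \<Rightarrow> 'v set \<Rightarrow> 'e \<Rightarrow> real" where
  "cut_term z W e =
    (if head G e \<in> W \<and> tail G e \<notin> W then of_int \<lfloor>z e\<rfloor> + 1 / 2
     else if tail G e \<in> W \<and> head G e \<notin> W then 1 / 2 - of_int \<lceil>z e\<rceil> else 0)"

text \<open>The right derivative of the energy (defined below) in the direction of the indicator of \<open>W\<close>.\<close>

definition margin :: "('e \<Rightarrow> real) \<Rightarrow> 'v set \<Rightarrow> real" where
  "margin z W = sum charge W + (\<Sum>e\<in>arcs G. cut_term z W e)"

definition stable :: "('e \<Rightarrow> real) \<Rightarrow> bool" where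
  "stable z \<longleftrightarrow> (\<forall>W. W \<subset> verts G \<longrightarrow> 0 \<le> margin z W \<and> (v\<^sub>0 \<in> W \<longrightarrow> 0 < margin z W))"

lemma shift_shift: "shift (shift y h) k = shift y (\<lambda>v. h v + k v)"
  by (simp add: shift_def fun_eq_iff add_divide_distrib diff_divide_distrib)

lemma margin_complement:
  assumes "W \<subseteq> verts G"
  shows "margin z W + margin z' (verts G - W) =
    (\<Sum>e\<in>arcs G. cut_term z W e + cut_term z' (verts G - W) e)"
proof -
  have "sum charge (verts G - W) = - sum charge W"
    using sum_charge assms by (simp add: sum_diff)
  then show ?thesis by (simp add: margin_def sum.distrib)
qed

text \<open>Both margins are nonnegative, and the base point lies in exactly one of the two sets,
  whose margin is then positive.\<close>

lemma stable_complement_pos: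
  assumes "stable z" "stable z'" "W \<subset> verts G" "W \<noteq> {}"
  shows "0 < (\<Sum>e\<in>arcs G. cut_term z W e + cut_term z' (verts G - W) e)"
proof -
  have "verts G - W \<subset> verts G" using assms by blast
  then have "0 < margin z W + margin z' (verts G - W)"
    using assms base_vertex unfolding stable_def
    by (metis Diff_iff add_nonneg_pos add_pos_nonneg)
  then show ?thesis using assms by (simp add: margin_complement)
qed

text \<open>On a non-integral edge across the cut the terms for \<open>W\<close> and for its
  complement cancel, while the sum over the cut is positive. As a consequence every fractional edge
  closes up to a cycle through integral edges.\<close>

lemma stable_cut_connected:
  assumes "stable z"
  shows "cut_connected G {e \<in> arcs G. z e \<in> \<int>}"
  unfolding cut_connected_def
proof (intro conjI allI impI)
  fix W assume W: "W \<subset> verts G" "W \<noteq> {}"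
  show "\<exists>e\<in>{e \<in> arcs G. z e \<in> \<int>}. (tail G e \<in> W) \<noteq> (head G e \<in> W)"
  proof (rule ccontr)
    assume no: "\<not> ?thesis"
    have "cut_term z W e + cut_term z (verts G - W) e \<le> 0" if e: "e \<in> arcs G" for e
    proof (cases "(tail G e \<in> W) = (head G e \<in> W)")
      case True
      then show ?thesis using e by (auto simp: cut_term_def)
    next
      case False
      with no e have "z e \<notin> \<int>" by blast
      then have "\<lceil>z e\<rceil> = \<lfloor>z e\<rfloor> + 1" by (simp add: ceiling_altdef) (metis Ints_of_int)
      then show ?thesis using e False by (auto simp: cut_term_def)
    qed
    then show False
      using stable_complement_pos[OF assms assms W] by (meson leD sum_nonpos)
  qed
qed auto

text \<open>
  If all jumps of \<open>h\<close> across the boundary of a superlevel set \<open>W\<close> exceeded \<open>M\<close>, then \<open>z'\<close> would be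
  larger than \<open>z\<close> on the edges into \<open>W\<close> and smaller on those out of \<open>W\<close>, so that the margins of \<open>z\<close> at
  \<open>W\<close> and of \<open>z'\<close> at the complement of \<open>W\<close> would have sum at most 0.
\<close>

lemma stable_potential_bound:
  assumes z: "stable z" "stable z'"
    and eq: "\<And>e. e \<in> arcs G \<Longrightarrow> z' e = shift z h e + u e"
    and u: "\<And>e. e \<in> arcs G \<Longrightarrow> l e * \<bar>u e\<bar> \<le> M" and "0 \<le> M"
    and v: "v \<in> verts G" "v' \<in> verts G"
  shows "h v - h v' \<le> real (card (verts G)) * M"
proof (rule level_gap[OF finite_verts \<open>0 \<le> M\<close> v])
  fix a
  define W where "W = {x \<in> verts G. a < h x}"
  assume "{x \<in> verts G. a < h x} \<noteq> {}" "{x \<in> verts G. a < h x} \<noteq> verts G"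
  then have W: "W \<subset> verts G" "W \<noteq> {}" by (auto simp: W_def)
  show "\<exists>x\<in>verts G. \<exists>y\<in>verts G. h x \<le> a \<and> a < h y \<and> h y - h x \<le> M"
  proof (rule ccontr)
    assume no: "\<not> ?thesis"
    have "cut_term z W e + cut_term z' (verts G - W) e \<le> 0" if e: "e \<in> arcs G" for e
    proof -
      have ends: "head G e \<in> verts G" "tail G e \<in> verts G" using e by auto
      have z': "(z' e - z e) * l e = h (head G e) - h (tail G e) + l e * u e"
        using eq[OF e] l_pos[OF e] by (simp add: shift_def field_simps)
      have ub: "\<bar>l e * u e\<bar> \<le> M" using u[OF e] l_pos[OF e] by (simp add: abs_mult)
      consider "(head G e \<in> W) = (tail G e \<in> W)" | "head G e \<in> W" "tail G e \<notin> W"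
        | "tail G e \<in> W" "head G e \<notin> W" by blast
      then show ?thesis
      proof cases
        case 1
        then show ?thesis using ends by (auto simp: cut_term_def)
      next
        case 2
        then have "h (tail G e) \<le> a" "a < h (head G e)" using ends by (auto simp: W_def)
        then have "M < h (head G e) - h (tail G e)" using no ends by force
        then have "0 < (z' e - z e) * l e" using z' ub by linarith
        then have "z e < z' e" using l_pos[OF e] by (simp add: zero_less_mult_iff)
        \<comment> \<open>The strict inequality survives rounding, and the two cut terms add up to
          \<open>\<lfloor>z e\<rfloor> + 1 - \<lceil>z' e\<rceil>\<close>.\<close>
        then have "\<lfloor>z e\<rfloor> + 1 \<le> \<lceil>z' e\<rceil>" by linarith
        then show ?thesis using 2 ends by (simp add: cut_term_def)
      next
        case 3
        then have "h (head G e) \<le> a" "a < h (tail G e)" using ends by (auto simp: W_def)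
        then have "M < h (tail G e) - h (head G e)" using no ends by force
        then have "(z' e - z e) * l e < 0" using z' ub by linarith
        then have "z' e < z e" using l_pos[OF e] by (simp add: mult_less_0_iff)
        then have "\<lfloor>z' e\<rfloor> + 1 \<le> \<lceil>z e\<rceil>" by linarith
        then show ?thesis using 3 ends by (simp add: cut_term_def)
      qed
    qed
    then show False
      using stable_complement_pos[OF z W] by (meson leD sum_nonpos)
  qed
qed

lemma stable_unique:
  assumes "stable z" "stable (shift z h)" "e \<in> arcs G"
  shows "shift z h e = z e"
proof -
  have "h v - h v' \<le> real (card (verts G)) * 0" if "v \<in> verts G" "v' \<in> verts G" for v v'
    using assms that by (intro stable_potential_bound[of z "shift z h" h "\<lambda>_. 0"]) auto
  then have "h (head G e) = h (tail G e)" using assms(3)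
    by (metis antisym diff_le_0_iff_le head_in_verts mult_zero_right tail_in_verts)
  then show ?thesis by (simp add: shift_def)
qed

text \<open>Continuity of the stable representative: \<open>u\<close> is a small change of the chain
  and \<open>h\<close> a potential that restores stability. The bound on potentials with
  \<open>M\<close> proportional to the size of \<open>u\<close> controls the total change.\<close>

lemma stable_perturb:
  assumes z: "stable z" and "0 < \<eta>"
  obtains \<epsilon> where "0 < \<epsilon>"
    "\<And>u h e. \<lbrakk>\<And>e. e \<in> arcs G \<Longrightarrow> \<bar>u e\<bar> < \<epsilon>; stable (\<lambda>e. shift z h e + u e); e \<in> arcs G\<rbrakk>
      \<Longrightarrow> \<bar>shift z h e + u e - z e\<bar> < \<eta>"
proof -
  define L where "L = (\<Sum>e\<in>arcs G. l e)"
  define N where "N = real (card (verts G))"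
  have L: "l e \<le> L" if "e \<in> arcs G" for e
    unfolding L_def using that l_pos by (intro member_le_sum) (auto intro: less_imp_le)
  have L0: "0 \<le> L" unfolding L_def using l_pos by (intro sum_nonneg) (auto intro: less_imp_le)
  have N0: "0 \<le> N" by (simp add: N_def)
  obtain m where m: "0 < m" "\<And>e. e \<in> arcs G \<Longrightarrow> m \<le> l e"
    using finite_positive_lower_bound[of "arcs G" l] l_pos by auto
  \<comment> \<open>\<open>N * L / m\<close> is the effect of the potential on an edge per unit of
    perturbation, and 1 accounts for the perturbation itself. The factor 2 in
    \<open>\<eta> / (2 * C)\<close> makes the conclusion strict.\<close>
  define C where "C = N * L / m + 1"
  have C: "0 < C" using N0 L0 m by (simp add: C_def add_nonneg_pos)
  show ?thesis
  proof (rule that[of "\<eta> / (2 * C)"])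
    show e0: "0 < \<eta> / (2 * C)" using C assms by simp
    fix u h e
    assume u: "\<And>e. e \<in> arcs G \<Longrightarrow> \<bar>u e\<bar> < \<eta> / (2 * C)"
      and st: "stable (\<lambda>e. shift z h e + u e)" and e: "e \<in> arcs G"
    define \<epsilon> where "\<epsilon> = \<eta> / (2 * C)"
    have bd: "h v - h v' \<le> N * (L * \<epsilon>)" if "v \<in> verts G" "v' \<in> verts G" for v v'
      unfolding N_def
    proof (rule stable_potential_bound[OF z st _ _ _ that])
      show "l e * \<bar>u e\<bar> \<le> L * \<epsilon>" if "e \<in> arcs G" for e
        using u[OF that] L[OF that] l_pos[OF that] L0 unfolding \<epsilon>_def by (intro mult_mono) auto
      show "0 \<le> L * \<epsilon>" using mult_nonneg_nonneg[OF L0 less_imp_le[OF e0]] by (simp add: \<epsilon>_def)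
    qed simp
    have "\<bar>h (head G e) - h (tail G e)\<bar> \<le> N * (L * \<epsilon>)"
      using bd[of "head G e" "tail G e"] bd[of "tail G e" "head G e"] e by auto
    then have "\<bar>(h (head G e) - h (tail G e)) / l e\<bar> \<le> N * (L * \<epsilon>) / m"
      using m(1) m(2)[OF e] l_pos[OF e] by (simp only: abs_divide) (intro frac_le; simp)
    then have "\<bar>shift z h e + u e - z e\<bar> \<le> N * (L * \<epsilon>) / m + \<bar>u e\<bar>"
      unfolding shift_def by linarith
    also have "\<dots> \<le> N * (L * \<epsilon>) / m + \<epsilon>" using u[OF e] by (simp add: \<epsilon>_def)
    also have "\<dots> = C * \<epsilon>" by (simp add: C_def algebra_simps)
    also have "\<dots> < \<eta>" using C assms by (simp add: \<epsilon>_def)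
    finally show "\<bar>shift z h e + u e - z e\<bar> < \<eta>" .
  qed
qed


section \<open>Existence of stable chains by minimizing the energy\<close>

lemma energy_step:
  assumes "W \<subseteq> verts G"
  obtains \<epsilon> where "0 < \<epsilon>"
    "(\<Sum>e\<in>arcs G. l e * quad_interp (z e + (if head G e \<in> W then \<epsilon> else 0) / l e - (if tail G e \<in> W then \<epsilon> else 0) / l e)) =
     (\<Sum>e\<in>arcs G. l e * quad_interp (z e)) + \<epsilon> * (\<Sum>e\<in>arcs G. cut_term z W e)"
proof -
  \<comment> \<open>The minimum is the distance from \<open>z e\<close> to the nearest integer other
    than \<open>z e\<close>. Up to that distance the potential is linear in each direction, so the
    formula is exact and not only of first order.\<close>
  have "0 < l e * min (of_int \<lfloor>z e\<rfloor> + 1 - z e) (z e - of_int \<lceil>z e\<rceil> + 1)" if "e \<in> arcs G" for e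
    using l_pos[OF that] by (intro mult_pos_pos) (simp_all, linarith)
  then obtain \<epsilon> where \<epsilon>: "0 < \<epsilon>"
    "\<And>e. e \<in> arcs G \<Longrightarrow> \<epsilon> \<le> l e * min (of_int \<lfloor>z e\<rfloor> + 1 - z e) (z e - of_int \<lceil>z e\<rceil> + 1)"
    by (rule finite_positive_lower_bound[OF finite_arcs]) blast+
  have "l e * quad_interp (z e + (if head G e \<in> W then \<epsilon> else 0) / l e - (if tail G e \<in> W then \<epsilon> else 0) / l e) =
      l e * quad_interp (z e) + \<epsilon> * cut_term z W e" if e: "e \<in> arcs G" for e
  proof -
    have le: "0 < l e" using e by (rule l_pos)
    have "\<epsilon> / l e \<le> min (of_int \<lfloor>z e\<rfloor> + 1 - z e) (z e - of_int \<lceil>z e\<rceil> + 1)"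
      unfolding pos_divide_le_eq[OF le] using \<epsilon>(2)[OF e] by (simp only: mult.commute)
    then have r: "quad_interp (z e + \<epsilon> / l e) = quad_interp (z e) + \<epsilon> / l e * (of_int \<lfloor>z e\<rfloor> + 1 / 2)"
      and m: "quad_interp (z e - \<epsilon> / l e) = quad_interp (z e) - \<epsilon> / l e * (of_int \<lceil>z e\<rceil> - 1 / 2)"
      using \<epsilon>(1) le by (intro quad_interp_right quad_interp_left; simp)+
    have "l e \<noteq> 0" using le by simp
    then show ?thesis
      using r m by (auto simp: cut_term_def right_diff_distrib distrib_left)
  qed
  then show ?thesis
    by (intro that[OF \<epsilon>(1)]) (simp only: sum_distrib_left sum.distrib[symmetric] cong: sum.cong)
qed

definition energy :: "('e \<Rightarrow> real) \<Rightarrow> ('v \<Rightarrow> real) \<Rightarrow> real" where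
  "energy y h = (\<Sum>v\<in>verts G. charge v * h v) + (\<Sum>e\<in>arcs G. l e * quad_interp (shift y h e))"

lemma continuous_energy: "continuous_on UNIV (energy y)"
proof -
  have c: "continuous_on UNIV (\<lambda>h. h v)" for v :: 'v
    by simp
  have q: "continuous_on UNIV quad_interp"
    by (simp add: continuous_on_eq_continuous_at continuous_quad_interp)
  have "continuous_on UNIV (\<lambda>h. quad_interp (shift y h e))" for e
    unfolding shift_def
    by (rule continuous_on_compose2[OF q]) (auto intro!: continuous_intros c simp: divide_inverse)
  then show ?thesis
    unfolding energy_def by (intro continuous_intros c)
qed

text \<open>
  As the charge has sum 0, it is a boundary, so the linear part of the energy is a sum over edges
  that each quadratic term dominates.
\<close>

lemma energy_coercive:
  obtains B where "\<And>h v. \<lbrakk>energy y h \<le> c; h v\<^sub>0 = 0; v \<in> verts G\<rbrakk> \<Longrightarrow> \<bar>h v\<bar> \<le> B"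
proof -
  obtain p where p: "\<And>v. v \<in> verts G \<Longrightarrow> boundary G p v = charge v"
    using boundary_surj[OF cut_conn sum_charge] by blast
  define C where "C = \<bar>c\<bar> + (\<Sum>e\<in>arcs G. l e * (p e ^ 2 + \<bar>p e * y e\<bar>))"
  \<comment> \<open>A bound for the jump of the potential on \<open>e\<close>: it is at most
    \<open>l e * \<bar>x\<bar> + l e * \<bar>y e\<bar>\<close> for the shifted value
    \<open>x\<close>, and \<open>\<bar>x\<bar> \<le> 1 + x ^ 2\<close> together with
    \<open>l e * x ^ 2 \<le> 4 * C\<close> bounds the first term.\<close>
  define m where "m e = 4 * C + l e * (1 + \<bar>y e\<bar>)" for e
  define M where "M = (\<Sum>e\<in>arcs G. m e)"
  have t0: "0 \<le> (\<Sum>e\<in>arcs G. l e * (p e ^ 2 + \<bar>p e * y e\<bar>))"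
    using l_pos by (intro sum_nonneg mult_nonneg_nonneg) (auto intro: less_imp_le)
  then have C0: "0 \<le> C" by (simp add: C_def)
  have m0: "0 \<le> m e" if "e \<in> arcs G" for e
    using C0 l_pos[OF that] by (simp add: m_def)
  have M: "0 \<le> M" "\<And>e. e \<in> arcs G \<Longrightarrow> m e \<le> M"
    unfolding M_def using m0 by (auto intro!: sum_nonneg member_le_sum)
  have "\<bar>h v\<bar> \<le> real (card (verts G)) * M"
    if h: "energy y h \<le> c" "h v\<^sub>0 = 0" and v: "v \<in> verts G" for h v
  proof -
    let ?x = "shift y h"
    have dh: "h (head G e) - h (tail G e) = l e * (?x e - y e)" if "e \<in> arcs G" for e
      using l_pos[OF that] by (simp add: shift_def)
    have "(\<Sum>v\<in>verts G. charge v * h v) = (\<Sum>v\<in>verts G. boundary G p v * h v)"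
      using p by simp
    also have "\<dots> = (\<Sum>e\<in>arcs G. p e * (l e * (?x e - y e)))"
      unfolding sum_boundary_mult using dh by (intro sum.cong) auto
    finally have en: "energy y h = (\<Sum>e\<in>arcs G. l e * (quad_interp (?x e) + p e * (?x e - y e)))"
      unfolding energy_def by (simp add: sum.distrib[symmetric] algebra_simps)
    have "l e * (?x e ^ 2 / 4) \<le> l e * (quad_interp (?x e) + p e * (?x e - y e)) + l e * (p e ^ 2 + \<bar>p e * y e\<bar>)"
      if e: "e \<in> arcs G" for e
    proof -
      \<comment> \<open>Completing the square spends half of the quadratic lower bound on the linear
        term and leaves \<open>x ^ 2 / 4\<close>.\<close>
      have "0 \<le> (?x e / 2 + p e) ^ 2" by simp
      then have "- (?x e ^ 2 / 4) - p e ^ 2 \<le> p e * ?x e"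
        by (simp add: power2_eq_square field_simps)
      moreover have "- \<bar>p e * y e\<bar> \<le> - (p e * y e)" by simp
      moreover have "p e * (?x e - y e) = p e * ?x e - p e * y e" by (simp add: right_diff_distrib)
      ultimately have "?x e ^ 2 / 4 \<le> quad_interp (?x e) + p e * (?x e - y e) + (p e ^ 2 + \<bar>p e * y e\<bar>)"
        using quad_interp_ge[of "?x e"] by linarith
      then show ?thesis
        using l_pos[OF e] unfolding distrib_left[symmetric] by (intro mult_left_mono) auto
    qed
    then have "(\<Sum>e\<in>arcs G. l e * (?x e ^ 2 / 4)) \<le>
        (\<Sum>e\<in>arcs G. l e * (quad_interp (?x e) + p e * (?x e - y e)) + l e * (p e ^ 2 + \<bar>p e * y e\<bar>))"
      by (rule sum_mono)
    then have S: "(\<Sum>e\<in>arcs G. l e * (?x e ^ 2 / 4)) \<le> C"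
      using h(1) en by (simp add: sum.distrib C_def)
    have edge: "\<bar>h (head G e) - h (tail G e)\<bar> \<le> M" if e: "e \<in> arcs G" for e
    proof -
      have le: "0 < l e" using e by (rule l_pos)
      have "l e * (?x e ^ 2 / 4) \<le> (\<Sum>e\<in>arcs G. l e * (?x e ^ 2 / 4))"
        using e l_pos by (intro member_le_sum) (auto intro!: mult_nonneg_nonneg simp: less_imp_le)
      with S have "l e * ?x e ^ 2 \<le> 4 * C" by simp
      moreover have "\<bar>?x e\<bar> \<le> 1 + ?x e ^ 2"
      proof -
        have "0 \<le> (\<bar>?x e\<bar> - 1) ^ 2" by simp
        then have "2 * \<bar>?x e\<bar> \<le> 1 + ?x e ^ 2" by (simp add: power2_diff)
        then show ?thesis by (smt (verit) abs_ge_zero)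
      qed
      then have "l e * \<bar>?x e\<bar> \<le> l e + l e * ?x e ^ 2"
        using mult_left_mono[of "\<bar>?x e\<bar>" "1 + ?x e ^ 2" "l e"] le by (simp add: distrib_left)
      moreover have "\<bar>l e * (?x e - y e)\<bar> \<le> l e * \<bar>?x e\<bar> + l e * \<bar>y e\<bar>"
        using mult_left_mono[OF abs_triangle_ineq4[of "?x e" "y e"], of "l e"] le
        by (simp add: abs_mult distrib_left)
      ultimately have "\<bar>l e * (?x e - y e)\<bar> \<le> m e"
        by (simp add: m_def distrib_left)
      then show ?thesis using M(2)[OF e] dh[OF e] by simp
    qed
    have gap: "h u - h v \<le> real (card (verts G)) * M" if "u \<in> verts G" "v \<in> verts G" for u v
    proof (rule level_gap[OF finite_verts M(1) that])
      fix a
      define W where "W = {x \<in> verts G. a < h x}"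
      assume "{x \<in> verts G. a < h x} \<noteq> {}" "{x \<in> verts G. a < h x} \<noteq> verts G"
      then have "W \<subset> verts G" "W \<noteq> {}" by (auto simp: W_def)
      then obtain e where e: "e \<in> arcs G" "(tail G e \<in> W) \<noteq> (head G e \<in> W)"
        using cut_conn unfolding cut_connected_def by blast
      then show "\<exists>x\<in>verts G. \<exists>y\<in>verts G. h x \<le> a \<and> a < h y \<and> h y - h x \<le> M"
        using edge[OF e(1)] head_in_verts[OF e(1)] tail_in_verts[OF e(1)] unfolding W_def
        by (smt (verit) mem_Collect_eq)
    qed
    show ?thesis using gap[OF v base_vertex] gap[OF base_vertex v] h(2) by simp
  qed
  then show ?thesis by (rule that)
qed

text \<open>Two successive minimizations over compact sets: of the energy over a box that contains
  the sublevel set of the zero potential, then of the coordinate sum over the minimizers. Fixing the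
  value 0 at the base point and off the graph makes the box compact.\<close>

lemma energy_minimizer:
  obtains h where "h v\<^sub>0 = 0"
    "\<And>k. \<lbrakk>k v\<^sub>0 = 0; \<And>v. v \<notin> verts G \<Longrightarrow> k v = 0\<rbrakk> \<Longrightarrow> energy y h \<le> energy y k"
    "\<And>k. \<lbrakk>k v\<^sub>0 = 0; \<And>v. v \<notin> verts G \<Longrightarrow> k v = 0; energy y k = energy y h\<rbrakk>
      \<Longrightarrow> sum h (verts G) \<le> sum k (verts G)"
    "\<And>v. v \<notin> verts G \<Longrightarrow> h v = 0"
proof -
  obtain B where B: "\<And>h v. \<lbrakk>energy y h \<le> energy y (\<lambda>_. 0); h v\<^sub>0 = 0; v \<in> verts G\<rbrakk> \<Longrightarrow> \<bar>h v\<bar> \<le> B"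
    by (rule energy_coercive[of y "energy y (\<lambda>_. 0)"]) blast
  have B0: "0 \<le> B" using B[of "\<lambda>_. 0" v\<^sub>0] base_vertex by simp
  define I where "I v = (if v \<in> verts G - {v\<^sub>0} then {-B..B} else {0})" for v
  define S where "S = (\<Pi>\<^sub>E v\<in>UNIV. I v)"
  have S: "h \<in> S \<longleftrightarrow> h v\<^sub>0 = 0 \<and> (\<forall>v. v \<notin> verts G \<longrightarrow> h v = 0) \<and> (\<forall>v\<in>verts G. \<bar>h v\<bar> \<le> B)" for h
    unfolding S_def PiE_UNIV_domain Pi_iff I_def using B0 base_vertex by (force simp: abs_le_iff split: if_splits)
  have "compactin (product_topology (\<lambda>_. euclideanreal) UNIV) S"
    unfolding S_def compactin_PiE by (simp add: I_def)
  then have cS: "compact S" by (simp add: euclidean_product_topology)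
  have zS: "(\<lambda>_. 0) \<in> S" using B0 by (simp add: S)
  obtain h1 where h1: "h1 \<in> S" "\<And>k. k \<in> S \<Longrightarrow> energy y h1 \<le> energy y k"
    using continuous_attains_inf[OF cS _ continuous_on_subset[OF continuous_energy subset_UNIV]] zS by blast
  define S' where "S' = S \<inter> {h. energy y h \<le> energy y h1}"
  have "closed {h. energy y h \<le> energy y h1}"
    using continuous_energy by (intro closed_Collect_le) auto
  then have cS': "compact S'" unfolding S'_def using cS by blast
  have "continuous_on S' (\<lambda>h. sum h (verts G))"
    by (intro continuous_intros continuous_on_subset[OF continuous_on_product_coordinates]) auto
  moreover have "S' \<noteq> {}" using h1 by (auto simp: S'_def)
  ultimately obtain h where h: "h \<in> S'" "\<And>k. k \<in> S' \<Longrightarrow> sum h (verts G) \<le> sum k (verts G)"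
    using continuous_attains_inf[OF cS'] by blast
  have eq: "energy y h = energy y h1" using h h1 by (force simp: S'_def)
  have inS: "k \<in> S" if "k v\<^sub>0 = 0" "\<And>v. v \<notin> verts G \<Longrightarrow> k v = 0" "energy y k \<le> energy y (\<lambda>_. 0)" for k
    using that B by (simp add: S)
  have min: "energy y h \<le> energy y k" if "k v\<^sub>0 = 0" "\<And>v. v \<notin> verts G \<Longrightarrow> k v = 0" for k
  proof (cases "energy y k \<le> energy y (\<lambda>_. 0)")
    case True
    then show ?thesis using inS that h1 eq by simp
  next
    case False
    then show ?thesis using h1(2)[OF zS] eq by simp
  qed
  show ?thesis
  proof (rule that)
    show "h v\<^sub>0 = 0" "\<And>v. v \<notin> verts G \<Longrightarrow> h v = 0" using h(1) S by (auto simp: S'_def)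
    show "sum h (verts G) \<le> sum k (verts G)"
      if "k v\<^sub>0 = 0" "\<And>v. v \<notin> verts G \<Longrightarrow> k v = 0" "energy y k = energy y h" for k
      using that inS[of k] h1(2)[OF zS] eq by (intro h(2)) (simp add: S'_def)
  qed (use min in blast)
qed

text \<open>
  Raising \<open>W\<close> is the same as lowering its complement. If \<open>v\<^sub>0 \<in> W\<close>, the latter keeps the normalization
  \<open>h v\<^sub>0 = 0\<close> and decreases the coordinate sum, which is what forces the strict inequality.
\<close>

lemma exists_stable: "\<exists>h. stable (shift y h)"
proof -
  obtain h where h: "h v\<^sub>0 = 0"
    "\<And>k. \<lbrakk>k v\<^sub>0 = 0; \<And>v. v \<notin> verts G \<Longrightarrow> k v = 0\<rbrakk> \<Longrightarrow> energy y h \<le> energy y k"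
    "\<And>k. \<lbrakk>k v\<^sub>0 = 0; \<And>v. v \<notin> verts G \<Longrightarrow> k v = 0; energy y k = energy y h\<rbrakk>
      \<Longrightarrow> sum h (verts G) \<le> sum k (verts G)"
    "\<And>v. v \<notin> verts G \<Longrightarrow> h v = 0"
    using energy_minimizer[of y] by blast
  have "0 \<le> margin (shift y h) W \<and> (v\<^sub>0 \<in> W \<longrightarrow> 0 < margin (shift y h) W)" if W: "W \<subset> verts G" for W
  proof -
    have fW: "finite W" using W finite_verts finite_subset by blast
    obtain \<epsilon> where \<epsilon>: "0 < \<epsilon>"
      "(\<Sum>e\<in>arcs G. l e * quad_interp (shift y h e + (if head G e \<in> W then \<epsilon> else 0) / l e - (if tail G e \<in> W then \<epsilon> else 0) / l e)) =
       (\<Sum>e\<in>arcs G. l e * quad_interp (shift y h e)) + \<epsilon> * (\<Sum>e\<in>arcs G. cut_term (shift y h) W e)"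
      using energy_step[of W "shift y h"] W by blast
    define c where "c = (if v\<^sub>0 \<in> W then \<epsilon> else 0)"
    define k where "k v = (if v \<in> verts G then h v + (if v \<in> W then \<epsilon> else 0) - c else 0)" for v
    have k: "k v\<^sub>0 = 0" "\<And>v. v \<notin> verts G \<Longrightarrow> k v = 0"
      using h(1) base_vertex by (auto simp: k_def c_def)
    have "shift y k e = shift y h e + (if head G e \<in> W then \<epsilon> else 0) / l e - (if tail G e \<in> W then \<epsilon> else 0) / l e"
      if "e \<in> arcs G" for e
      using that by (simp add: k_def shift_def add_divide_distrib diff_divide_distrib)
    then have 1: "(\<Sum>e\<in>arcs G. l e * quad_interp (shift y k e)) =
        (\<Sum>e\<in>arcs G. l e * quad_interp (shift y h e)) + \<epsilon> * (\<Sum>e\<in>arcs G. cut_term (shift y h) W e)"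
      unfolding \<epsilon>(2)[symmetric] by (intro sum.cong) auto
    have "(\<Sum>v\<in>verts G. charge v * k v) =
        (\<Sum>v\<in>verts G. charge v * h v) + (\<Sum>v\<in>verts G. if v \<in> W then charge v * \<epsilon> else 0) - (\<Sum>v\<in>verts G. charge v * c)"
      unfolding sum.distrib[symmetric] sum_subtractf[symmetric]
      by (intro sum.cong) (auto simp: k_def algebra_simps)
    also have "(\<Sum>v\<in>verts G. charge v * c) = 0"
      using sum_charge by (simp add: sum_distrib_right[symmetric])
    also have "(\<Sum>v\<in>verts G. if v \<in> W then charge v * \<epsilon> else 0) = \<epsilon> * sum charge W"
      using W by (simp add: sum.inter_restrict[symmetric] Int_absorb1 sum_distrib_left mult.commute psubset_imp_subset)
    finally have E: "energy y k = energy y h + \<epsilon> * margin (shift y h) W"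
      using 1 by (simp add: energy_def margin_def distrib_left)
    have nonneg: "0 \<le> margin (shift y h) W"
      using h(2)[of k, OF k] E \<epsilon>(1) by (simp add: zero_le_mult_iff)
    have "margin (shift y h) W \<noteq> 0" if v0: "v\<^sub>0 \<in> W"
    proof
      assume "margin (shift y h) W = 0"
      then have "sum h (verts G) \<le> sum k (verts G)" using E by (intro h(3) k) simp_all
      moreover obtain u where "u \<in> verts G" "u \<notin> W" using W by blast
      then have "sum k (verts G) < sum h (verts G)"
        using \<epsilon>(1) v0 by (intro sum_strict_mono_ex1) (auto simp: k_def c_def)
      ultimately show False by simp
    qed
    then show ?thesis using nonneg by (auto simp: less_le)
  qed
  then show ?thesis unfolding stable_def by blast
qed

end

section \<open>Cells\<close>

lemma sum_verts_subdivision: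
  fixes f :: "('v, 'e) sub_vertex \<Rightarrow> 'r::comm_monoid_add"
  assumes "finite W" "finite E"
  shows "(\<Sum>u\<in>Orig ` W \<union> Exc ` E. f u) = (\<Sum>v\<in>W. f (Orig v)) + (\<Sum>e\<in>E. f (Exc e))"
  using assms by (subst sum.union_disjoint) (auto simp: sum.reindex inj_on_def)

lemma sum_arcs_subdivision:
  assumes "finite (arcs G)" "E \<subseteq> arcs G"
  shows "(\<Sum>a\<in>arcs (subdivision G E). f a) =
    (\<Sum>e\<in>arcs G. if e \<in> E then f (Src_Half e) + f (Tgt_Half e) else f (Whole e))"
proof -
  have fE: "finite E" using assms finite_subset by blast
  have "(\<Sum>a\<in>arcs (subdivision G E). f a) =
      (\<Sum>a\<in>Whole ` (arcs G - E) \<union> (Src_Half ` E \<union> Tgt_Half ` E). f a)"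
    by (simp add: subdivision_def Un_assoc)
  also have "\<dots> = (\<Sum>e\<in>arcs G - E. f (Whole e)) + ((\<Sum>e\<in>E. f (Src_Half e)) + (\<Sum>e\<in>E. f (Tgt_Half e)))"
    using assms fE by (subst sum.union_disjoint; (subst sum.union_disjoint)?)
      (auto simp: sum.reindex inj_on_def)
  also have "\<dots> = (\<Sum>e\<in>arcs G - E. if e \<in> E then f (Src_Half e) + f (Tgt_Half e) else f (Whole e)) +
      (\<Sum>e\<in>E. if e \<in> E then f (Src_Half e) + f (Tgt_Half e) else f (Whole e))"
    by (simp add: sum.distrib)
  also have "\<dots> = (\<Sum>e\<in>arcs G. if e \<in> E then f (Src_Half e) + f (Tgt_Half e) else f (Whole e))"
    using assms by (simp add: sum.subset_diff[of E "arcs G"])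
  finally show ?thesis .
qed

lemma verts_subdivision [simp]: "verts (subdivision G E) = Orig ` verts G \<union> Exc ` E"
  by (simp add: subdivision_def)

lemma Ints_iff_floor: "(x::real) \<in> \<int> \<longleftrightarrow> x = of_int \<lfloor>x\<rfloor>"
proof
  show "x \<in> \<int>" if "x = of_int \<lfloor>x\<rfloor>" by (subst that) (rule Ints_of_int)
qed (auto elim: Ints_cases)

lemma real_card_filter:
  "finite A \<Longrightarrow> real (card {a \<in> A. P a}) = (\<Sum>a\<in>A. if P a then 1 else 0)"
  by (simp add: sum.inter_filter[symmetric])

lemma cut_size_subdivision:
  assumes "finite (arcs G)" "E \<subseteq> arcs G" "F \<subseteq> E"
  shows "real (cut_size (subdivision G E) (Orig ` W \<union> Exc ` F)) =
    (\<Sum>e\<in>arcs G. if e \<in> E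
       then (if (tail G e \<in> W) \<noteq> (e \<in> F) then 1 else 0) + (if (e \<in> F) \<noteq> (head G e \<in> W) then 1 else 0)
       else (if (tail G e \<in> W) \<noteq> (head G e \<in> W) then 1 else 0))"
proof -
  have "finite E" using assms finite_subset by blast
  then have "finite (arcs (subdivision G E))" using assms by (simp add: subdivision_def)
  then show ?thesis
    unfolding cut_size_def real_card_filter[OF \<open>finite (arcs (subdivision G E))\<close>]
      sum_arcs_subdivision[OF assms(1,2)]
    by (intro sum.cong) (auto simp: subdivision_def)
qed

text \<open>A contracted exceptional vertex hands its value -1 to the source or to the target of its
  edge, and the condition at a surviving exceptional vertex holds automatically. Sums over incoming
  and outgoing arcs treat loops correctly.\<close>

lemma specialization_iff:
  assumes "finite (verts G)" "finite (arcs G)" "E \<subseteq> arcs G"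
    and D: "\<And>e. e \<in> E \<Longrightarrow> D (Exc e) = -1" and D': "\<And>e. e \<in> E' \<Longrightarrow> D' (Exc e) = -1"
  shows "specialization G (E, D) (E', D') S \<longleftrightarrow> E' \<subseteq> E \<and> S \<subseteq> E - E' \<and>
    (\<forall>v\<in>verts G. D' (Orig v) = D (Orig v) -
      (\<Sum>e\<in>out_arcs G v. if e \<in> S then 1 else 0) -
      (\<Sum>e\<in>in_arcs G v. if e \<in> E - E' - S then 1 else 0))"
proof -
  have fE: "finite E" using assms finite_subset by blast
  have fib: "(\<Sum>u \<in> {u \<in> verts (subdivision G E). contract_vertex G E' S u = x}. D u) =
     (\<Sum>v\<in>verts G. if Orig v = x then D (Orig v) else 0) +
     (\<Sum>e\<in>E. if contract_vertex G E' S (Exc e) = x then - 1 else 0)" for x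
  proof -
    have fin: "finite (verts (subdivision G E))" using assms(1) fE by simp
    have "(\<Sum>u \<in> {u \<in> verts (subdivision G E). contract_vertex G E' S u = x}. D u) =
        (\<Sum>u\<in>Orig ` verts G \<union> Exc ` E. if contract_vertex G E' S u = x then D u else 0)"
      unfolding sum.inter_filter[OF fin] by simp
    also have "\<dots> = (\<Sum>v\<in>verts G. if Orig v = x then D (Orig v) else 0) +
        (\<Sum>e\<in>E. if contract_vertex G E' S (Exc e) = x then D (Exc e) else 0)"
      unfolding sum_verts_subdivision[OF assms(1) fE] by simp
    also have "(\<Sum>e\<in>E. if contract_vertex G E' S (Exc e) = x then D (Exc e) else 0) =
        (\<Sum>e\<in>E. if contract_vertex G E' S (Exc e) = x then - 1 else 0)"
      using D by (intro sum.cong if_cong) auto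
    finally show ?thesis .
  qed
  have exc: "D' (Exc e) = (\<Sum>u \<in> {u \<in> verts (subdivision G E). contract_vertex G E' S u = Exc e}. D u)"
    if "e \<in> E'" "E' \<subseteq> E" for e
  proof -
    have "(\<Sum>e'\<in>E. if contract_vertex G E' S (Exc e') = Exc e then - 1 else 0) =
        (\<Sum>e'\<in>E. if e' = e then - 1 else (0::int))"
      using that by (intro sum.cong) auto
    also have "\<dots> = -1" using that fE by auto
    finally show ?thesis using D' that by (simp only: fib) simp
  qed
  have orig: "(\<Sum>u \<in> {u \<in> verts (subdivision G E). contract_vertex G E' S u = Orig v}. D u) =
      D (Orig v) - (\<Sum>e\<in>out_arcs G v. if e \<in> S then 1 else 0) -
      (\<Sum>e\<in>in_arcs G v. if e \<in> E - E' - S then 1 else 0)" if v: "v \<in> verts G" and S: "S \<subseteq> E - E'" for v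
  proof -
    have "(\<Sum>e\<in>E. if contract_vertex G E' S (Exc e) = Orig v then - 1 else 0) =
        (\<Sum>e\<in>arcs G. if e \<in> E then if contract_vertex G E' S (Exc e) = Orig v then - 1 else 0 else (0::int))"
      using assms by (simp add: sum.inter_restrict[symmetric] Int_absorb1)
    also have "\<dots> = (\<Sum>e\<in>arcs G. - (if tail G e = v then if e \<in> S then 1 else 0 else 0)
        - (if head G e = v then if e \<in> E - E' - S then 1 else 0 else 0))"
      using S by (intro sum.cong) auto
    also have "\<dots> = - (\<Sum>e\<in>out_arcs G v. if e \<in> S then 1 else 0) -
      (\<Sum>e\<in>in_arcs G v. if e \<in> E - E' - S then 1 else 0)"
      using assms(2) unfolding in_arcs_def out_arcs_def by (simp only: sum.inter_filter sum_subtractf sum_negf mem_Collect_eq)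
    finally show ?thesis using v assms(1) by (simp only: fib) simp
  qed
  show ?thesis
    using exc orig by (auto simp: specialization_def)
qed

context polarized_graph
begin

abbreviation cells :: "('v, 'e) pseudo_divisor set" where
  "cells \<equiv> quasistable_pseudo_divisors G v\<^sub>0 \<mu> d"

text \<open>A vertex receives the ceiling from incoming edges and loses the floor to outgoing ones.
  The surplus 1 on each fractional edge is balanced by the value -1 at its exceptional
  vertex.\<close>

definition flow_div :: "('e \<Rightarrow> real) \<Rightarrow> 'v \<Rightarrow> int" where
  "flow_div z v = (if v = v\<^sub>0 then d else 0) + (\<Sum>e\<in>in_arcs G v. \<lceil>z e\<rceil>) - (\<Sum>e\<in>out_arcs G v. \<lfloor>z e\<rfloor>)"

definition frac_edges :: "('e \<Rightarrow> real) \<Rightarrow> 'e set" where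
  "frac_edges z = {e \<in> arcs G. z e \<notin> \<int>}"

definition cell_div :: "('e \<Rightarrow> real) \<Rightarrow> ('v, 'e) sub_vertex \<Rightarrow> int" where
  "cell_div z u = (case u of Orig v \<Rightarrow> if v \<in> verts G then flow_div z v else 0
                           | Exc e \<Rightarrow> if e \<in> frac_edges z then -1 else 0)"

definition cell :: "('e \<Rightarrow> real) \<Rightarrow> ('v, 'e) pseudo_divisor" where
  "cell z = (frac_edges z, cell_div z)"

lemma frac_edges_subset: "frac_edges z \<subseteq> arcs G"
  by (auto simp: frac_edges_def)

lemma finite_frac_edges [simp]: "finite (frac_edges z)"
  by (simp add: frac_edges_def)

lemma ceiling_frac_edges: "e \<in> arcs G \<Longrightarrow> \<lceil>z e\<rceil> = \<lfloor>z e\<rfloor> + (if e \<in> frac_edges z then 1 else 0)"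
  using Ints_iff_floor[of "z e"] by (auto simp: frac_edges_def ceiling_altdef)

lemma sum_flow_div:
  assumes "W \<subseteq> verts G"
  shows "(\<Sum>v\<in>W. real_of_int (flow_div z v) - \<mu> v) = sum charge W +
    (\<Sum>e\<in>arcs G. (if head G e \<in> W then of_int \<lceil>z e\<rceil> else 0) - (if tail G e \<in> W then of_int \<lfloor>z e\<rfloor> else 0))"
proof -
  have "(\<Sum>v\<in>W. real_of_int (flow_div z v) - \<mu> v) = sum charge W +
      (\<Sum>v\<in>W. \<Sum>e\<in>in_arcs G v. of_int \<lceil>z e\<rceil>) - (\<Sum>v\<in>W. \<Sum>e\<in>out_arcs G v. of_int \<lfloor>z e\<rfloor>)"
    unfolding sum.distrib[symmetric] sum_subtractf[symmetric]
    by (intro sum.cong) (auto simp: flow_div_def charge_def)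
  then show ?thesis
    unfolding sum_fibre_head[OF assms] sum_fibre_tail[OF assms] by (simp add: sum_subtractf)
qed

text \<open>
  The excess over the margin vanishes if \<open>F\<close> consists of the exceptional vertices adjacent to \<open>W\<close>, so
  only these vertex sets of the subdivision matter.
\<close>

lemma stability_value:
  assumes W: "W \<subseteq> verts G" and F: "F \<subseteq> frac_edges z"
  shows "(\<Sum>u\<in>Orig ` W \<union> Exc ` F. of_int (cell_div z u) - extend_pol \<mu> u) +
      real (cut_size (subdivision G (frac_edges z)) (Orig ` W \<union> Exc ` F)) / 2 =
    sum charge W + (\<Sum>e\<in>arcs G. cut_term z W e +
      (if e \<in> frac_edges z \<and> (e \<in> F) \<noteq> (tail G e \<in> W \<or> head G e \<in> W)
       then if tail G e \<in> W \<and> head G e \<in> W then 2 else if e \<in> F then 0 else 1 else 0))"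
proof -
  have fW: "finite W" "finite F" by (rule finite_subset[OF W finite_verts], rule finite_subset[OF F finite_frac_edges])
  have "(\<Sum>u\<in>Orig ` W \<union> Exc ` F. of_int (cell_div z u) - extend_pol \<mu> u) =
      (\<Sum>v\<in>W. real_of_int (flow_div z v) - \<mu> v) - real (card F)"
  proof -
    have "(\<Sum>v\<in>W. real_of_int (cell_div z (Orig v)) - \<mu> v) = (\<Sum>v\<in>W. real_of_int (flow_div z v) - \<mu> v)"
      using W by (intro sum.cong) (auto simp: cell_div_def)
    moreover have "(\<Sum>e\<in>F. real_of_int (cell_div z (Exc e))) = (\<Sum>e\<in>F. -1)"
      using F by (intro sum.cong) (auto simp: cell_div_def)
    ultimately show ?thesis using fW by (simp add: sum_verts_subdivision)
  qed
  also have "real (card F) = (\<Sum>e\<in>arcs G. if e \<in> F then 1 else 0)"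
    using F frac_edges_subset[of z] by (subst sum.inter_restrict[symmetric]) (auto simp: Int_absorb1)
  finally have eq: "(\<Sum>u\<in>Orig ` W \<union> Exc ` F. of_int (cell_div z u) - extend_pol \<mu> u) +
      real (cut_size (subdivision G (frac_edges z)) (Orig ` W \<union> Exc ` F)) / 2 =
      sum charge W + (\<Sum>e\<in>arcs G. (if head G e \<in> W then of_int \<lceil>z e\<rceil> else 0) - (if tail G e \<in> W then of_int \<lfloor>z e\<rfloor> else 0)
        - (if e \<in> F then 1 else 0) + (if e \<in> frac_edges z
       then (if (tail G e \<in> W) \<noteq> (e \<in> F) then 1 else 0) + (if (e \<in> F) \<noteq> (head G e \<in> W) then 1 else 0)
       else (if (tail G e \<in> W) \<noteq> (head G e \<in> W) then 1 else 0)) / 2)"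
    unfolding sum_flow_div[OF W] cut_size_subdivision[OF finite_arcs frac_edges_subset F]
    by (simp add: sum.distrib sum_subtractf sum_divide_distrib)
  show ?thesis
    unfolding eq
  proof (rule arg_cong2[where f = "(+)", OF refl], rule sum.cong[OF refl])
    fix e assume e: "e \<in> arcs G"
    have "e \<in> F \<Longrightarrow> e \<in> frac_edges z" using F by blast
    then show "(if head G e \<in> W then of_int \<lceil>z e\<rceil> else 0) - (if tail G e \<in> W then of_int \<lfloor>z e\<rfloor> else 0)
        - (if e \<in> F then 1 else 0) + (if e \<in> frac_edges z
       then (if (tail G e \<in> W) \<noteq> (e \<in> F) then 1 else 0) + (if (e \<in> F) \<noteq> (head G e \<in> W) then 1 else 0)
       else (if (tail G e \<in> W) \<noteq> (head G e \<in> W) then 1 else 0)) / 2 =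
      cut_term z W e +
      (if e \<in> frac_edges z \<and> (e \<in> F) \<noteq> (tail G e \<in> W \<or> head G e \<in> W)
       then if tail G e \<in> W \<and> head G e \<in> W then 2 else if e \<in> F then 0 else 1 else (0::real))"
      unfolding cut_term_def ceiling_frac_edges[OF e] by auto
  qed
qed

lemma divisor_cell_div: "divisor (subdivision G (frac_edges z)) d (cell_div z)"
  unfolding divisor_def
proof (intro conjI allI impI)
  fix u assume "u \<notin> verts (subdivision G (frac_edges z))"
  then show "cell_div z u = 0" by (cases u) (auto simp: cell_div_def)
next
  have "(\<Sum>u\<in>verts (subdivision G (frac_edges z)). cell_div z u) =
      (\<Sum>v\<in>verts G. flow_div z v) - int (card (frac_edges z))"
    by (simp add: sum_verts_subdivision cell_div_def)
  also have "(\<Sum>v\<in>verts G. flow_div z v) = d + (\<Sum>e\<in>arcs G. \<lceil>z e\<rceil> - \<lfloor>z e\<rfloor>)"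
    unfolding flow_div_def using base_vertex
    by (simp add: sum.distrib sum_subtractf sum_fibre_head[OF subset_refl] sum_fibre_tail[OF subset_refl] cong: sum.cong_simp)
  also have "(\<Sum>e\<in>arcs G. \<lceil>z e\<rceil> - \<lfloor>z e\<rfloor>) = (\<Sum>e\<in>arcs G. if e \<in> frac_edges z then 1 else 0)"
    by (intro sum.cong) (simp_all add: ceiling_frac_edges)
  also have "\<dots> = int (card (frac_edges z))"
    using frac_edges_subset[of z] by (subst sum.inter_restrict[symmetric]) (auto simp: Int_absorb1)
  finally show "(\<Sum>u\<in>verts (subdivision G (frac_edges z)). cell_div z u) = d" by simp
qed

lemma cell_in_cells_iff: "cell z \<in> cells \<longleftrightarrow> stable z"
proof -
  let ?H = "subdivision G (frac_edges z)"
  let ?x = "\<lambda>W F e. if e \<in> frac_edges z \<and> (e \<in> F) \<noteq> (tail G e \<in> W \<or> head G e \<in> W)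
       then if tail G e \<in> W \<and> head G e \<in> W then 2 else if e \<in> F then 0 else 1 else (0::real)"
  have "quasistable ?H (Orig v\<^sub>0) (extend_pol \<mu>) (cell_div z) \<longleftrightarrow> stable z"
  proof
    assume q: "quasistable ?H (Orig v\<^sub>0) (extend_pol \<mu>) (cell_div z)"
    show "stable z"
      unfolding stable_def
    proof (intro allI impI)
      fix W assume W: "W \<subset> verts G"
      define F where "F = {e \<in> frac_edges z. tail G e \<in> W \<or> head G e \<in> W}"
      have F: "F \<subseteq> frac_edges z" by (auto simp: F_def)
      have "(\<Sum>u\<in>Orig ` W \<union> Exc ` F. of_int (cell_div z u) - extend_pol \<mu> u) +
          real (cut_size ?H (Orig ` W \<union> Exc ` F)) / 2 = sum charge W + (\<Sum>e\<in>arcs G. cut_term z W e)"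
        unfolding stability_value[OF psubset_imp_subset[OF W] F] by (auto simp: F_def intro!: sum.cong)
      moreover have "Orig ` W \<union> Exc ` F \<subset> verts ?H" using W F by auto
      note q[unfolded quasistable_def, rule_format, OF this]
      ultimately show "0 \<le> margin z W \<and> (v\<^sub>0 \<in> W \<longrightarrow> 0 < margin z W)"
        unfolding margin_def by simp
    qed
  next
    assume st: "stable z"
    show "quasistable ?H (Orig v\<^sub>0) (extend_pol \<mu>) (cell_div z)"
      unfolding quasistable_def
    proof (intro allI impI)
      fix V assume V: "V \<subset> verts ?H"
      define W where "W = {v. Orig v \<in> V}"
      define F where "F = {e. Exc e \<in> V}"
      have VWF: "V = Orig ` W \<union> Exc ` F"
      proof (intro set_eqI)
        fix u show "u \<in> V \<longleftrightarrow> u \<in> Orig ` W \<union> Exc ` F"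
          by (cases u) (auto simp: W_def F_def)
      qed
      have W: "W \<subseteq> verts G" and F: "F \<subseteq> frac_edges z" using V by (auto simp: W_def F_def)
      have v0: "Orig v\<^sub>0 \<in> V \<longleftrightarrow> v\<^sub>0 \<in> W" by (simp add: W_def)
      have val: "(\<Sum>u\<in>V. of_int (cell_div z u) - extend_pol \<mu> u) + real (cut_size ?H V) / 2 =
          margin z W + (\<Sum>e\<in>arcs G. ?x W F e)"
        unfolding VWF stability_value[OF W F] by (simp add: margin_def sum.distrib)
      have x0: "0 \<le> (\<Sum>e\<in>arcs G. ?x W F e)" by (intro sum_nonneg) auto
      show "0 \<le> (\<Sum>u\<in>V. of_int (cell_div z u) - extend_pol \<mu> u) + real (cut_size ?H V) / 2 \<and>
        (Orig v\<^sub>0 \<in> V \<longrightarrow> 0 < (\<Sum>u\<in>V. of_int (cell_div z u) - extend_pol \<mu> u) + real (cut_size ?H V) / 2)"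
      \<comment> \<open>A proper vertex set of the subdivision may contain all vertices of
        \<open>G\<close>. It then misses an exceptional vertex whose excess is 2, while the margin
        of the full vertex set is 0.\<close>
      proof (cases "W = verts G")
        case True
        then have "F \<noteq> frac_edges z" using V VWF by auto
        then obtain e where e: "e \<in> frac_edges z" "e \<notin> F" using F by blast
        then have ea: "e \<in> arcs G" using frac_edges_subset by blast
        have "?x W F e \<le> (\<Sum>e\<in>arcs G. ?x W F e)" using ea by (intro member_le_sum) auto
        moreover have "?x W F e = 2" using e ea True by auto
        moreover have "margin z W = 0"
          using sum_charge True by (auto simp: margin_def cut_term_def intro!: sum.neutral)
        ultimately show ?thesis unfolding val by simp
      next
        case False
        then have "W \<subset> verts G" using W by blast
        then have "0 \<le> margin z W \<and> (v\<^sub>0 \<in> W \<longrightarrow> 0 < margin z W)" using st by (simp add: stable_def)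
        then show ?thesis unfolding val v0 using x0 by (simp add: add_pos_nonneg)
      qed
    qed
  qed
  then show ?thesis
    using divisor_cell_div[of z] frac_edges_subset[of z]
    by (auto simp: quasistable_pseudo_divisors_def cell_def) (auto simp: cell_div_def)
qed

text \<open>An integral flow with prescribed boundary produces the divisor; adding 1/2 on
  \<open>E\<close> makes exactly these edges fractional without changing any floor.\<close>

lemma cells_obtain:
  assumes "\<sigma> \<in> cells"
  obtains z where "cell z = \<sigma>" "stable z"
proof -
  obtain E D where \<sigma>: "\<sigma> = (E, D)" by (cases \<sigma>)
  have E: "E \<subseteq> arcs G" and D: "divisor (subdivision G E) d D" "\<And>e. e \<in> E \<Longrightarrow> D (Exc e) = -1"
    using assms by (auto simp: \<sigma> quasistable_pseudo_divisors_def)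
  have fE: "finite E" using finite_subset[OF E] by simp
  \<comment> \<open>The last sum is the extra unit by which the ceiling exceeds the floor at the
    target of an edge in \<open>E\<close>.\<close>
  define b where "b v = D (Orig v) - (if v = v\<^sub>0 then d else 0) -
    (\<Sum>e\<in>in_arcs G v. if e \<in> E then 1 else 0)" for v
  have "(\<Sum>v\<in>verts G. D (Orig v)) = d + int (card E)"
    using D fE by (simp add: divisor_def sum_verts_subdivision)
  moreover have "(\<Sum>v\<in>verts G. \<Sum>e\<in>in_arcs G v. if e \<in> E then 1 else 0) = int (card E)"
    unfolding sum_fibre_head[OF subset_refl] using E
    by (simp add: sum.inter_restrict[symmetric] Int_absorb1 cong: if_cong)
  ultimately have "sum b (verts G) = 0"
    using base_vertex by (simp add: b_def sum_subtractf)
  then obtain n where n: "\<And>v. v \<in> verts G \<Longrightarrow> boundary G n v = b v"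
    using boundary_surj[OF cut_conn] by blast
  define z where "z e = (if e \<in> E then real_of_int (n e) + 1 / 2 else of_int (n e))" for e
  have fl: "\<lfloor>z e\<rfloor> = n e" for e unfolding z_def by (simp add: floor_eq_iff)
  have ce: "\<lceil>z e\<rceil> = n e + (if e \<in> E then 1 else 0)" for e
    unfolding z_def by (simp add: ceiling_eq_iff)
  have "z e \<in> \<int> \<longleftrightarrow> e \<notin> E" for e
  proof -
    have "z e \<in> \<int> \<longleftrightarrow> \<lceil>z e\<rceil> = \<lfloor>z e\<rfloor>" by (metis Ints_cases Ints_of_int ceiling_of_int floor_of_int ceiling_eq_iff of_int_floor_le le_of_int_ceiling order_antisym)
    then show ?thesis by (simp add: fl ce)
  qed
  then have fr: "frac_edges z = E" using E by (auto simp: frac_edges_def)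
  have fd: "flow_div z v = D (Orig v)" if "v \<in> verts G" for v
    using n[OF that] by (simp add: flow_div_def fl ce sum.distrib boundary_def b_def)
  have "D u = 0" if "u \<notin> Orig ` verts G \<union> Exc ` E" for u
    using D(1) that by (simp add: divisor_def)
  then have "cell_div z u = D u" for u
    using D(2) fd by (cases u) (auto simp: cell_div_def fr)
  then have "cell z = \<sigma>" by (auto simp: cell_def \<sigma> fr)
  then show ?thesis using that assms cell_in_cells_iff by metis
qed

text \<open>\<open>z\<close> lies in the closed cell whose relative interior contains \<open>w\<close>.\<close>

definition in_closure :: "('e \<Rightarrow> real) \<Rightarrow> ('e \<Rightarrow> real) \<Rightarrow> bool" where
  "in_closure w z \<longleftrightarrow> (\<forall>e\<in>arcs G. of_int \<lfloor>w e\<rfloor> \<le> z e \<and> z e \<le> of_int \<lceil>w e\<rceil>)"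

lemma in_closure_refl: "in_closure w w"
  by (simp add: in_closure_def)

text \<open>Passing to the closure raises floors and lowers ceilings, so no cut term
  decreases.\<close>

lemma in_closure_stable:
  assumes "stable w" "in_closure w z"
  shows "stable z"
proof -
  have "cut_term w W e \<le> cut_term z W e" if "e \<in> arcs G" for W e
  proof -
    have "\<lfloor>w e\<rfloor> \<le> \<lfloor>z e\<rfloor>" "\<lceil>z e\<rceil> \<le> \<lceil>w e\<rceil>"
      using assms(2) that by (auto simp: in_closure_def le_floor_iff ceiling_le_iff)
    then show ?thesis by (simp add: cut_term_def)
  qed
  then have "margin w W \<le> margin z W" for W
    by (simp add: margin_def sum_mono)
  then show ?thesis
    using assms(1) unfolding stable_def by (meson order_trans less_le_trans)
qed

text \<open>A chain close to \<open>z\<close> may leave an integral value of \<open>z\<close> but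
  does not reach the next integer, so rounding it outwards encloses \<open>z\<close>.\<close>

lemma in_closure_near:
  obtains \<rho> where "0 < \<rho>" "\<And>w. (\<And>e. e \<in> arcs G \<Longrightarrow> \<bar>w e - z e\<bar> < \<rho>) \<Longrightarrow> in_closure w z"
proof -
  have "0 < min (of_int \<lfloor>z e\<rfloor> + 1 - z e) (z e - of_int \<lceil>z e\<rceil> + 1)" for e
    by (simp, linarith)
  then obtain \<rho> where \<rho>: "0 < \<rho>"
    "\<And>e. e \<in> arcs G \<Longrightarrow> \<rho> \<le> min (of_int \<lfloor>z e\<rfloor> + 1 - z e) (z e - of_int \<lceil>z e\<rceil> + 1)"
    using finite_positive_lower_bound[OF finite_arcs,
        of "\<lambda>e. min (of_int \<lfloor>z e\<rfloor> + 1 - z e) (z e - of_int \<lceil>z e\<rceil> + 1)"] by blast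
  have "in_closure w z" if w: "\<And>e. e \<in> arcs G \<Longrightarrow> \<bar>w e - z e\<bar> < \<rho>" for w
    unfolding in_closure_def
  proof (intro ballI conjI)
    fix e assume "e \<in> arcs G"
    then have *: "w e < of_int \<lfloor>z e\<rfloor> + 1" "of_int \<lceil>z e\<rceil> - 1 < w e"
      using w \<rho>(2) by fastforce+
    show "of_int \<lfloor>w e\<rfloor> \<le> z e" proof -
      have "\<lfloor>w e\<rfloor> < \<lfloor>z e\<rfloor> + 1" unfolding floor_less_iff using *(1) by simp
      then show ?thesis by linarith
    qed
    show "z e \<le> of_int \<lceil>w e\<rceil>"
    proof -
      have "\<lceil>z e\<rceil> - 1 < \<lceil>w e\<rceil>" unfolding less_ceiling_iff using *(2) by simp
      then show ?thesis by linarith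
    qed
  qed
  then show ?thesis using that \<rho>(1) by blast
qed

text \<open>At the upper end the whole edge carries the ceiling, which means that the exceptional
  vertex has moved to the source. These edges form the set \<open>S\<close> of the
  specialization.\<close>

definition upper_edges :: "('e \<Rightarrow> real) \<Rightarrow> ('e \<Rightarrow> real) \<Rightarrow> 'e set" where
  "upper_edges w z = {e \<in> frac_edges w - frac_edges z. z e = of_int \<lceil>w e\<rceil>}"

text \<open>In this order: interior of the unit interval, upper end, lower end, interval reduced to
  a point.\<close>

lemma in_closure_edge_cases:
  assumes "in_closure w z" "e \<in> arcs G"
  obtains "e \<in> frac_edges w" "e \<in> frac_edges z" "\<lceil>z e\<rceil> = \<lceil>w e\<rceil>" "\<lfloor>z e\<rfloor> = \<lfloor>w e\<rfloor>" "e \<notin> upper_edges w z"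
  | "e \<in> upper_edges w z" "e \<in> frac_edges w" "e \<notin> frac_edges z" "\<lceil>z e\<rceil> = \<lceil>w e\<rceil>" "\<lfloor>z e\<rfloor> = \<lfloor>w e\<rfloor> + 1" "z e = of_int \<lceil>w e\<rceil>"
  | "e \<in> frac_edges w" "e \<notin> frac_edges z" "e \<notin> upper_edges w z" "\<lceil>z e\<rceil> = \<lceil>w e\<rceil> - 1" "\<lfloor>z e\<rfloor> = \<lfloor>w e\<rfloor>" "z e = of_int \<lceil>w e\<rceil> - 1"
  | "e \<notin> frac_edges w" "e \<notin> frac_edges z" "e \<notin> upper_edges w z" "z e = w e" "\<lceil>z e\<rceil> = \<lceil>w e\<rceil>" "\<lfloor>z e\<rfloor> = \<lfloor>w e\<rfloor>"
proof -
  have b: "of_int \<lfloor>w e\<rfloor> \<le> z e" "z e \<le> of_int \<lceil>w e\<rceil>" using assms by (auto simp: in_closure_def)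
  have cw: "\<lceil>w e\<rceil> = \<lfloor>w e\<rfloor> + (if e \<in> frac_edges w then 1 else 0)"
    and cz: "\<lceil>z e\<rceil> = \<lfloor>z e\<rfloor> + (if e \<in> frac_edges z then 1 else 0)"
    using assms(2) by (rule ceiling_frac_edges)+
  have zi: "z e = of_int \<lfloor>z e\<rfloor>" if "e \<notin> frac_edges z"
    using that assms(2) by (auto simp: frac_edges_def elim: Ints_cases)
  have zn: "z e \<noteq> of_int \<lfloor>z e\<rfloor>" if "e \<in> frac_edges z"
    using that by (auto simp: frac_edges_def) (metis Ints_of_int)
  have wi: "w e = of_int \<lfloor>w e\<rfloor>" if "e \<notin> frac_edges w"
    using that assms(2) by (auto simp: frac_edges_def elim: Ints_cases)
  show ?thesis
  proof (cases "e \<in> frac_edges w")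
    case False
    then have "z e = w e" using b cw wi by simp
    then show ?thesis using False assms(2) that(4) by (auto simp: upper_edges_def frac_edges_def)
  next
    case w: True
    show ?thesis
    proof (cases "e \<in> frac_edges z")
      case True
      have "\<lfloor>z e\<rfloor> = \<lfloor>w e\<rfloor>"
        using b cw w zn[OF True] by (smt (verit) floor_eq_iff of_int_1 of_int_add of_int_floor_le le_floor_iff order_antisym floor_less_iff)
      then show ?thesis using True w cw cz that(1) by (simp add: upper_edges_def)
    next
      case False
      then have "\<lfloor>z e\<rfloor> = \<lfloor>w e\<rfloor> \<or> \<lfloor>z e\<rfloor> = \<lfloor>w e\<rfloor> + 1"
        using b cw w zi by (smt (verit) of_int_le_iff)
      then show ?thesis
        using False w cw cz zi that(2,3) by (auto simp: upper_edges_def)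
    qed
  qed
qed

lemma in_closure_specialization:
  assumes "in_closure w z"
  shows "specialization G (cell w) (cell z) (upper_edges w z)"
proof -
  let ?S = "upper_edges w z" and ?R = "frac_edges w - frac_edges z - upper_edges w z"
  have "frac_edges z \<subseteq> frac_edges w"
    using frac_edges_subset[of z] by (blast elim: in_closure_edge_cases[OF assms])
  moreover have "?S \<subseteq> frac_edges w - frac_edges z" by (auto simp: upper_edges_def)
  moreover have "flow_div z v = flow_div w v - (\<Sum>e\<in>out_arcs G v. if e \<in> ?S then 1 else 0)
      - (\<Sum>e\<in>in_arcs G v. if e \<in> ?R then 1 else 0)" for v
  proof -
    have "(\<Sum>e\<in>in_arcs G v. \<lceil>z e\<rceil>) = (\<Sum>e\<in>in_arcs G v. \<lceil>w e\<rceil> - (if e \<in> ?R then 1 else 0))"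
    proof (intro sum.cong refl)
      fix e assume "e \<in> in_arcs G v"
      then have "e \<in> arcs G" by simp
      then show "\<lceil>z e\<rceil> = \<lceil>w e\<rceil> - (if e \<in> ?R then 1 else 0)"
        by (rule in_closure_edge_cases[OF assms]) auto
    qed
    moreover have "(\<Sum>e\<in>out_arcs G v. \<lfloor>z e\<rfloor>) = (\<Sum>e\<in>out_arcs G v. \<lfloor>w e\<rfloor> + (if e \<in> ?S then 1 else 0))"
    proof (intro sum.cong refl)
      fix e assume "e \<in> out_arcs G v"
      then have "e \<in> arcs G" by simp
      then show "\<lfloor>z e\<rfloor> = \<lfloor>w e\<rfloor> + (if e \<in> ?S then 1 else 0)"
        by (rule in_closure_edge_cases[OF assms]) auto
    qed
    ultimately show ?thesis by (simp add: flow_div_def sum.distrib sum_subtractf)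
  qed
  ultimately show ?thesis
    unfolding cell_def
    by (subst specialization_iff[OF finite_verts finite_arcs frac_edges_subset]) (auto simp: cell_div_def)
qed


section \<open>Finiteness of the complex and its face order\<close>

lemma cells_fst: "(E, D) \<in> cells \<Longrightarrow> E \<subseteq> arcs G"
  and cells_Exc: "\<lbrakk>(E, D) \<in> cells; e \<in> E\<rbrakk> \<Longrightarrow> D (Exc e) = -1"
  and cells_divisor: "(E, D) \<in> cells \<Longrightarrow> divisor (subdivision G E) d D"
  and cells_quasistable:
    "(E, D) \<in> cells \<Longrightarrow> quasistable (subdivision G E) (Orig v\<^sub>0) (extend_pol \<mu>) D"
  by (auto simp: quasistable_pseudo_divisors_def)

lemma cells_specialization_iff:
  assumes "(E, D) \<in> cells" "(E', D') \<in> cells"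
  shows "specialization G (E, D) (E', D') S \<longleftrightarrow> E' \<subseteq> E \<and> S \<subseteq> E - E' \<and>
    (\<forall>v\<in>verts G. D' (Orig v) = D (Orig v) -
      (\<Sum>e\<in>out_arcs G v. if e \<in> S then 1 else 0) -
      (\<Sum>e\<in>in_arcs G v. if e \<in> E - E' - S then 1 else 0))"
  by (rule specialization_iff[OF finite_verts finite_arcs])
    (use cells_fst[OF assms(1)] cells_Exc[OF assms(1)] cells_Exc[OF assms(2)] in auto)

text \<open>Quasistability at single vertices bounds the values from below, and the fixed degree
  then bounds them from above.\<close>

lemma finite_cells: "finite cells"
proof -
  \<comment> \<open>\<open>2 * card (arcs G)\<close> bounds the edges of a subdivision,
    \<open>d\<close> covers a graph with a single vertex, and 1 covers the value -1 at exceptional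
    vertices.\<close>
  let ?m = "real (2 * card (arcs G)) + (\<Sum>v\<in>verts G. \<bar>\<mu> v\<bar>) + \<bar>real_of_int d\<bar> + 1"
  define B where "B = \<lceil>?m\<rceil>"
  define U :: "('v, 'e) sub_vertex set" where "U = Orig ` verts G \<union> Exc ` arcs G"
  define K where "K = \<bar>d\<bar> + int (card U) * B"
  have B0: "1 \<le> B" 
  proof -
    have "0 \<le> (\<Sum>v\<in>verts G. \<bar>\<mu> v\<bar>)" by (intro sum_nonneg) simp
    then have "1 \<le> ?m" by simp
    then show ?thesis unfolding B_def by (metis ceiling_mono ceiling_one)
  qed
  have fU: "finite U" by (simp add: U_def)
  have "D \<in> {f. \<forall>u. (u \<in> U \<longrightarrow> f u \<in> {- B..K}) \<and> (u \<notin> U \<longrightarrow> f u = 0)}"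
    if c: "(E, D) \<in> cells" for E D
  proof -
    have E: "E \<subseteq> arcs G" and Exc: "\<And>e. e \<in> E \<Longrightarrow> D (Exc e) = -1"
      and D0: "\<And>u. u \<notin> Orig ` verts G \<union> Exc ` E \<Longrightarrow> D u = 0"
      and Dd: "(\<Sum>u\<in>Orig ` verts G \<union> Exc ` E. D u) = d"
      using cells_fst[OF c] cells_Exc[OF c] cells_divisor[OF c] by (auto simp: divisor_def)
    have fE: "finite E" using finite_subset[OF E] by simp
    have V: "Orig ` verts G \<union> Exc ` E \<subseteq> U" using E by (auto simp: U_def)
    have low: "- B \<le> D u" for u
    proof (cases "u \<in> Orig ` verts G")
      case True
      then obtain v where v: "u = Orig v" "v \<in> verts G" by blast
      show ?thesis
      proof (cases "{u} = verts (subdivision G E)")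
        case True
        then have "Orig ` verts G \<union> Exc ` E = {u}" by (simp only: verts_subdivision)
        then have "D u = d" using Dd by simp
        moreover have "- ?m \<le> real_of_int d" using sum_nonneg[of "verts G" "\<lambda>v. \<bar>\<mu> v\<bar>"] by linarith
        ultimately show ?thesis unfolding B_def by (metis ceiling_mono ceiling_of_int ceiling_minus floor_le_ceiling le_of_int_ceiling minus_le_iff of_int_le_iff of_int_minus order_trans)
      next
        case False
        then have "{u} \<subset> verts (subdivision G E)" using v by auto
        then have "0 \<le> (\<Sum>u\<in>{u}. real_of_int (D u) - extend_pol \<mu> u) + real (cut_size (subdivision G E) {u}) / 2"
          using cells_quasistable[OF c] unfolding quasistable_def by blast
        then have "\<mu> v - real (cut_size (subdivision G E) {u}) \<le> real_of_int (D u)"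
          by (simp add: v(1))
        moreover have "cut_size (subdivision G E) {u} \<le> 2 * card (arcs G)"
        proof -
          have fin: "finite (arcs (subdivision G E))" using fE by (simp add: subdivision_def)
          have "real (cut_size (subdivision G E) {u}) \<le> (\<Sum>a\<in>arcs (subdivision G E). 1)"
            unfolding cut_size_def real_card_filter[OF fin] by (intro sum_mono) auto
          also have "\<dots> \<le> (\<Sum>e\<in>arcs G. 2)"
            unfolding sum_arcs_subdivision[OF finite_arcs E] by (intro sum_mono) auto
          finally show ?thesis by simp
        qed
        then have "real (cut_size (subdivision G E) {u}) \<le> real (2 * card (arcs G))"
          by (rule of_nat_mono)
        moreover have "\<bar>\<mu> v\<bar> \<le> (\<Sum>v\<in>verts G. \<bar>\<mu> v\<bar>)" using v by (intro member_le_sum) auto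
        ultimately have "- real_of_int (D u) \<le> ?m" by linarith
        then have "- D u \<le> B" unfolding B_def by (metis ceiling_mono ceiling_of_int of_int_minus)
        then show ?thesis by simp
      qed
    next
      case False
      then show ?thesis using Exc D0 B0 by (cases "u \<in> Exc ` E") auto
    qed
    have up: "D u \<le> K" if "u \<in> U" for u
    proof (cases "u \<in> Orig ` verts G \<union> Exc ` E")
      case True
      have fV: "finite (Orig ` verts G \<union> Exc ` E)" using fE by simp
      have "D u = d - (\<Sum>x\<in>Orig ` verts G \<union> Exc ` E - {u}. D x)"
        using sum.remove[OF fV True, of D] Dd by simp
      also have "\<dots> \<le> d + (\<Sum>x\<in>Orig ` verts G \<union> Exc ` E - {u}. B)"
        using sum_mono[of "Orig ` verts G \<union> Exc ` E - {u}" "\<lambda>_. - B" D] low by (simp add: sum_negf)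
      also have "\<dots> = d + int (card (Orig ` verts G \<union> Exc ` E - {u})) * B" by simp
      also have "\<dots> \<le> d + int (card U) * B"
        using B0 V fU by (intro add_left_mono mult_right_mono) (auto intro!: card_mono)
      finally show ?thesis by (simp add: K_def)
    next
      case False
      then show ?thesis using D0 B0 by (simp add: K_def)
    qed
    have "D u = 0" if "u \<notin> U" for u using that V by (intro D0) blast
    then show ?thesis using low up by simp
  qed
  then have "cells \<subseteq> Pow (arcs G) \<times> {f. \<forall>u. (u \<in> U \<longrightarrow> f u \<in> {- B..K}) \<and> (u \<notin> U \<longrightarrow> f u = 0)}"
    using cells_fst by (auto, blast)
  moreover have "finite (Pow (arcs G) \<times> {f. \<forall>u. (u \<in> U \<longrightarrow> f u \<in> {- B..K}) \<and> (u \<notin> U \<longrightarrow> f u = 0)})"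
    using finite_set_of_finite_funs[OF fU, of "{- B..K}" 0] by simp
  ultimately show ?thesis by (rule finite_subset)
qed

lemma cells_nonempty: "cells \<noteq> {}"
  using exists_stable[of "\<lambda>_. 0"] cell_in_cells_iff by blast

text \<open>For a composite contraction the sets of edges contracted at the source are
  united.\<close>

lemma is_face_trans:
  assumes c: "\<rho> \<in> cells" "\<sigma> \<in> cells" "\<tau> \<in> cells"
    and f: "is_face G \<tau> \<sigma>" "is_face G \<sigma> \<rho>"
  shows "is_face G \<tau> \<rho>"
proof -
  obtain E D E' D' E'' D'' where *: "\<rho> = (E, D)" "\<sigma> = (E', D')" "\<tau> = (E'', D'')"
    by (metis surj_pair)
  obtain S S' where S: "specialization G (E, D) (E', D') S" "specialization G (E', D') (E'', D'') S'"
    using f by (auto simp: is_face_def *)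
  note S1 = S(1)[unfolded cells_specialization_iff[OF c(1,2)[unfolded *]]]
    and S2 = S(2)[unfolded cells_specialization_iff[OF c(2,3)[unfolded *]]]
  have "D'' (Orig v) = D (Orig v) - (\<Sum>e\<in>out_arcs G v. if e \<in> S \<union> S' then 1 else 0)
      - (\<Sum>e\<in>in_arcs G v. if e \<in> E - E'' - (S \<union> S') then 1 else 0)" if "v \<in> verts G" for v
  proof -
    have "(\<Sum>e\<in>out_arcs G v. if e \<in> S \<union> S' then 1 else (0::int)) =
        (\<Sum>e\<in>out_arcs G v. (if e \<in> S then 1 else 0) + (if e \<in> S' then 1 else 0))"
      using S1 S2 by (intro sum.cong) auto
    moreover have "(\<Sum>e\<in>in_arcs G v. if e \<in> E - E'' - (S \<union> S') then 1 else (0::int)) =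
        (\<Sum>e\<in>in_arcs G v. (if e \<in> E - E' - S then 1 else 0) + (if e \<in> E' - E'' - S' then 1 else 0))"
      using S1 S2 by (intro sum.cong) auto
    ultimately show ?thesis using S1 S2 that by (simp add: sum.distrib)
  qed
  then have "specialization G (E, D) (E'', D'') (S \<union> S')"
    unfolding cells_specialization_iff[OF c(1,3)[unfolded *]] using S1 S2 by auto
  then show ?thesis by (auto simp: is_face_def *)
qed

lemma is_face_same_edges:
  assumes "\<sigma> \<in> cells" "\<tau> \<in> cells" "is_face G \<tau> \<sigma>" "fst \<sigma> = fst \<tau>"
  shows "\<tau> = \<sigma>"
proof -
  obtain E D D' where *: "\<sigma> = (E, D)" "\<tau> = (E, D')" using assms(4) by (metis fst_conv surj_pair)
  have c: "(E, D) \<in> cells" "(E, D') \<in> cells" using assms * by auto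
  have eq: "D' (Orig v) = D (Orig v)" if "v \<in> verts G" for v
    using assms(3) that by (auto simp: is_face_def * cells_specialization_iff[OF c])
  have D0: "D u = 0" "D' u = 0" if "u \<notin> Orig ` verts G \<union> Exc ` E" for u
    using cells_divisor[OF c(1)] cells_divisor[OF c(2)] that by (simp_all add: divisor_def)
  have "D' u = D u" for u
  proof (cases "u \<in> Orig ` verts G \<union> Exc ` E")
    case True
    then show ?thesis using eq cells_Exc[OF c(1)] cells_Exc[OF c(2)] by auto
  qed (simp add: D0)
  then show ?thesis by (auto simp: *)
qed

lemma is_face_subset:
  assumes "\<sigma> \<in> cells" "\<tau> \<in> cells" "is_face G \<tau> \<sigma>"
  shows "fst \<tau> \<subseteq> fst \<sigma>"
  using assms by (cases \<sigma>; cases \<tau>) (auto simp: is_face_def specialization_def)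

lemma finite_cell_edges: "\<sigma> \<in> cells \<Longrightarrow> finite (fst \<sigma>)"
  using cells_fst finite_subset[OF _ finite_arcs] by (metis prod.collapse)

text \<open>A coface of largest dimension is maximal: any coface of it has the same edge set and is
  therefore the same cell.\<close>

lemma maximal_above:
  assumes "\<tau> \<in> cells"
  obtains \<sigma> where "\<sigma> \<in> maximal_cells G cells" "is_face G \<tau> \<sigma>"
proof -
  define A where "A = {\<sigma> \<in> cells. is_face G \<tau> \<sigma>}"
  obtain z where z: "cell z = \<tau>" by (rule cells_obtain[OF assms])
  have "is_face G \<tau> \<tau>"
    unfolding is_face_def z[symmetric] using in_closure_specialization[OF in_closure_refl] by blast
  then have "\<tau> \<in> A" using assms by (simp add: A_def)
  moreover have "finite A" using finite_cells by (simp add: A_def)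
  ultimately obtain \<sigma> where \<sigma>: "\<sigma> \<in> A" "\<And>\<rho>. \<rho> \<in> A \<Longrightarrow> cell_dim \<rho> \<le> cell_dim \<sigma>"
    using finite_has_maximal[of "cell_dim ` A"] by (metis (no_types, lifting) Max_ge Max_in empty_iff finite_imageI imageE imageI)
  have "\<rho> = \<sigma>" if \<rho>: "\<rho> \<in> cells" "is_face G \<sigma> \<rho>" for \<rho>
  proof -
    have "\<rho> \<in> A" using \<rho> \<sigma>(1) assms is_face_trans unfolding A_def by blast
    then have "cell_dim \<rho> \<le> cell_dim \<sigma>" by (rule \<sigma>(2))
    then have "fst \<sigma> = fst \<rho>"
      using is_face_subset[OF \<rho>(1) _ \<rho>(2)] \<sigma>(1) finite_cell_edges[OF \<rho>(1)]
      unfolding A_def cell_dim_def by (simp add: card_seteq)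
    then show ?thesis using is_face_same_edges[OF \<rho>(1) _ \<rho>(2)] \<sigma>(1) by (simp add: A_def)
  qed
  then have "\<sigma> \<in> maximal_cells G cells" using \<sigma>(1) unfolding A_def maximal_cells_def by blast
  moreover have "is_face G \<tau> \<sigma>" using \<sigma>(1) unfolding A_def by blast
  ultimately show ?thesis by (rule that)
qed

end

section \<open>Pure dimension and connectedness in codimension 1\<close>

text \<open>Gaussian elimination: equation \<open>j\<close> is solved for the unknown
  \<open>i0\<close>, and the other equations are solved in the remaining unknowns.\<close>

lemma homogeneous_system_solution:
  fixes a :: "'j \<Rightarrow> 'i \<Rightarrow> real"
  assumes "finite J" "finite I" "card J < card I"
  shows "\<exists>x. (\<exists>i\<in>I. x i \<noteq> 0) \<and> (\<forall>j\<in>J. (\<Sum>i\<in>I. a j i * x i) = 0)"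
  using assms
proof (induction J arbitrary: I a rule: finite_induct)
  case empty
  then obtain i where "i \<in> I" by fastforce
  then show ?case by (intro exI[of _ "\<lambda>_. 1"]) auto
next
  case (insert j J)
  show ?case
  proof (cases "\<forall>i\<in>I. a j i = 0")
    case True
    have "card J < card I" using insert by simp
    then show ?thesis using insert.IH[of I a] insert.prems True by auto
  next
    case False
    then obtain i0 where i0: "i0 \<in> I" "a j i0 \<noteq> 0" by blast
    let ?I = "I - {i0}"
    have "card J < card ?I" using insert i0 by simp
    then obtain x where x: "\<exists>i\<in>?I. x i \<noteq> 0"
      "\<And>k. k \<in> J \<Longrightarrow> (\<Sum>i\<in>?I. (a k i - a k i0 * a j i / a j i0) * x i) = 0"
      using insert.IH[of ?I "\<lambda>k i. a k i - a k i0 * a j i / a j i0"] insert.prems by auto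
    define s where "s = (\<Sum>i\<in>?I. a j i * x i)"
    define y where "y = x(i0 := - s / a j i0)"
    have y: "(\<Sum>i\<in>I. a k i * y i) = (\<Sum>i\<in>?I. a k i * x i) - a k i0 * s / a j i0" for k
      using insert.prems i0 by (subst sum.remove[of _ i0]) (auto simp: y_def)
    have "(\<Sum>i\<in>I. a k i * y i) = 0" if "k \<in> insert j J" for k
    proof (cases "k = j")
      case True
      then show ?thesis using i0 unfolding y by (simp add: s_def)
    next
      case False
      then have "(\<Sum>i\<in>?I. a k i * x i) - a k i0 / a j i0 * (\<Sum>i\<in>?I. a j i * x i) = 0"
        using x(2)[of k] that by (simp add: sum_subtractf left_diff_distrib sum_distrib_left mult.assoc)
      then show ?thesis unfolding y s_def by simp
    qed
    moreover have "\<exists>i\<in>I. y i \<noteq> 0" using x(1) by (auto simp: y_def)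
    ultimately show ?thesis by blast
  qed
qed

lemma sum_fun_apply: "(\<Sum>i\<in>A. f i) x = (\<Sum>i\<in>A. f i x)" for f :: "'i \<Rightarrow> 'a \<Rightarrow> 'b::comm_monoid_add"
  by (induction A rule: infinite_finite_induct) auto

context polarized_graph
begin

section \<open>The pairing of chains with cycles\<close>

lemma integral_along_add:
  "integral_along G l (\<lambda>e. x e + y e) \<omega> = integral_along G l x \<omega> + integral_along G l y \<omega>"
  by (simp add: integral_along_def distrib_right sum.distrib)

lemma integral_along_diff:
  "integral_along G l (\<lambda>e. x e - y e) \<omega> = integral_along G l x \<omega> - integral_along G l y \<omega>"
  by (simp add: integral_along_def left_diff_distrib sum_subtractf)

lemma integral_along_scale:
  "integral_along G l (\<lambda>e. r * x e) \<omega> = r * integral_along G l x \<omega>"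
  by (simp add: integral_along_def sum_distrib_left mult.assoc)

lemma integral_along_cong:
  "(\<And>e. e \<in> arcs G \<Longrightarrow> x e = y e) \<Longrightarrow> integral_along G l x \<omega> = integral_along G l y \<omega>"
  by (simp add: integral_along_def)

lemma shift_add: "shift (\<lambda>e. y e + u e) h e = shift y h e + u e"
  by (simp add: shift_def)

text \<open>The length in the pairing cancels the one in \<open>shift\<close>, and cycles are
  orthogonal to differences of potentials.\<close>

lemma integral_along_shift:
  assumes "\<omega> \<in> H1 G"
  shows "integral_along G l (shift y h) \<omega> = integral_along G l y \<omega>"
proof -
  have "(\<Sum>e\<in>arcs G. (h (head G e) - h (tail G e)) / l e * \<omega> e * l e) =
      (\<Sum>e\<in>arcs G. \<omega> e * (h (head G e) - h (tail G e)))"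
  proof (intro sum.cong refl)
    fix e assume "e \<in> arcs G"
    then show "(h (head G e) - h (tail G e)) / l e * \<omega> e * l e = \<omega> e * (h (head G e) - h (tail G e))"
      using l_pos[of e] by simp
  qed
  also have "\<dots> = 0"
    unfolding sum_boundary_mult[symmetric] using assms by (simp add: H1_iff)
  finally show ?thesis
    by (simp add: integral_along_def shift_def distrib_right sum.distrib)
qed

text \<open>The potential at \<open>v\<close> is the integral of \<eta> along a chain from the base
  point to \<open>v\<close>. An edge closed up by two such chains is a cycle, on which the integral
  vanishes.\<close>

lemma exact_if_orthogonal:
  assumes "\<And>\<omega>. \<omega> \<in> H1 G \<Longrightarrow> integral_along G l \<eta> \<omega> = 0"
  shows "\<exists>h. \<forall>e\<in>arcs G. \<eta> e = (h (head G e) - h (tail G e)) / l e"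
proof -
  define P where "P v n \<longleftrightarrow> (\<forall>e. e \<notin> arcs G \<longrightarrow> n e = 0) \<and>
    (\<forall>w. boundary G n w = (if w = v then 1 else 0) - (if w = v\<^sub>0 then 1 else (0::real)))" for v n
  have "\<forall>v\<in>verts G. \<exists>n. P v n"
    unfolding P_def using boundary_surj_pair[OF cut_conn base_vertex, where r = "1::real"] by blast
  then obtain n where n: "\<forall>v\<in>verts G. P v (n v)" using bchoice by metis
  define h where "h v = integral_along G l \<eta> (n v)" for v
  have "\<eta> e = (h (head G e) - h (tail G e)) / l e" if e: "e \<in> arcs G" for e
  proof -
    define \<omega> where "\<omega> x = (if x = e then 1 else 0) + n (tail G e) x - n (head G e) x" for x
    have P: "P (tail G e) (n (tail G e))" "P (head G e) (n (head G e))" using n e by auto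
    have "boundary G (\<lambda>x. if x = e then 1 else 0) w =
        (if w = head G e then 1 else 0) - (if w = tail G e then 1 else (0::real))" for w
    proof -
      have "boundary G (\<lambda>x. if x = e then 1 else 0) w =
          (\<Sum>x\<in>arcs G. if x = e then (if w = head G e then 1 else 0) - (if w = tail G e then 1 else 0) else (0::real))"
        unfolding boundary_eq by (intro sum.cong) auto
      then show ?thesis using e by simp
    qed
    then have "\<omega> \<in> H1 G"
      using P e unfolding \<omega>_def H1_iff boundary_add boundary_diff P_def by auto
    then have "integral_along G l \<eta> \<omega> = 0" by (rule assms)
    moreover have "integral_along G l \<eta> \<omega> =
        (\<Sum>x\<in>arcs G. (if x = e then \<eta> x * l x else 0) + \<eta> x * n (tail G e) x * l x - \<eta> x * n (head G e) x * l x)"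
      unfolding integral_along_def by (intro sum.cong) (auto simp: \<omega>_def algebra_simps)
    moreover have "\<dots> = \<eta> e * l e + h (tail G e) - h (head G e)"
      using e by (simp add: sum.distrib sum_subtractf h_def integral_along_def)
    ultimately show ?thesis using l_pos[OF e] by (simp add: field_simps)
  qed
  then show ?thesis by blast
qed

lemma stable_cong:
  assumes "\<And>e. e \<in> arcs G \<Longrightarrow> z e = z' e"
  shows "stable z \<longleftrightarrow> stable z'"
proof -
  have "cut_term z W e = cut_term z' W e" if "e \<in> arcs G" for W e
    using assms[OF that] by (simp add: cut_term_def)
  then show ?thesis by (simp add: stable_def margin_def)
qed

text \<open>An integral cycle moves floors and ceilings by the same amount, and its boundary
  vanishes, so the divisor does not change.\<close>

lemma cell_translate:
  assumes k: "\<And>e. e \<in> arcs G \<Longrightarrow> z' e = z e + of_int (k e)"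
    and b: "\<And>v. v \<in> verts G \<Longrightarrow> boundary G k v = 0"
  shows "cell z' = cell z"
proof -
  have "frac_edges z' = frac_edges z"
    using k by (auto simp: frac_edges_def)
  moreover have "flow_div z' v = flow_div z v" if "v \<in> verts G" for v
  proof -
    have "(\<Sum>e\<in>in_arcs G v. \<lceil>z' e\<rceil>) = (\<Sum>e\<in>in_arcs G v. \<lceil>z e\<rceil> + k e)"
      using k by (intro sum.cong) auto
    moreover have "(\<Sum>e\<in>out_arcs G v. \<lfloor>z' e\<rfloor>) = (\<Sum>e\<in>out_arcs G v. \<lfloor>z e\<rfloor> + k e)"
      using k by (intro sum.cong) auto
    ultimately show ?thesis
      using b[OF that] by (simp add: flow_div_def sum.distrib boundary_def)
  qed
  ultimately show ?thesis
    by (auto simp: cell_def cell_div_def fun_eq_iff split: sub_vertex.split)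
qed

lemma cell_cong:
  assumes "\<And>e. e \<in> arcs G \<Longrightarrow> z' e = z e"
  shows "cell z' = cell z"
  using assms by (intro cell_translate[where k = "\<lambda>_. 0"]) auto

lemma cell_eqI:
  assumes "\<And>e. e \<in> arcs G \<Longrightarrow> \<lfloor>z' e\<rfloor> = \<lfloor>z e\<rfloor>" "\<And>e. e \<in> arcs G \<Longrightarrow> \<lceil>z' e\<rceil> = \<lceil>z e\<rceil>"
  shows "cell z' = cell z"
proof -
  have "e \<in> frac_edges z' \<longleftrightarrow> e \<in> frac_edges z" if "e \<in> arcs G" for e
    using ceiling_frac_edges[OF that, of z] ceiling_frac_edges[OF that, of z'] assms[OF that]
    by (auto split: if_splits)
  then have "frac_edges z' = frac_edges z" using frac_edges_subset by blast
  moreover have "flow_div z' v = flow_div z v" for v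
    using assms by (simp add: flow_div_def)
  ultimately show ?thesis
    by (auto simp: cell_def cell_div_def fun_eq_iff split: sub_vertex.split)
qed

text \<open>Once \<open>z\<close> is translated by the cycle \<open>c\<close>, the two chains have
  equal periods and hence differ by an exact chain, so uniqueness within a class applies.\<close>

lemma stable_unique_mod_lattice:
  fixes c :: "'e \<Rightarrow> int"
  assumes z: "stable z" "stable z'" and c: "c \<in> H1 G"
    and eq: "\<And>\<omega>. \<omega> \<in> H1 G \<Longrightarrow> integral_along G l z' \<omega> - integral_along G l z \<omega> = integral_along G l (\<lambda>e. of_int (c e)) \<omega>"
    and e: "e \<in> arcs G"
  shows "z' e = z e + of_int (c e)"
proof -
  let ?w = "\<lambda>e. z e + real_of_int (c e)"
  have "integral_along G l (\<lambda>e. z' e - ?w e) \<omega> = 0" if "\<omega> \<in> H1 G" for \<omega>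
    using eq[OF that] by (simp add: integral_along_diff integral_along_add)
  then obtain h where h: "\<And>e. e \<in> arcs G \<Longrightarrow> z' e - ?w e = (h (head G e) - h (tail G e)) / l e"
    using exact_if_orthogonal[of "\<lambda>e. z' e - ?w e"] by blast
  have "cell ?w = cell z"
    using c by (intro cell_translate[where k = c]) (auto simp: H1_iff)
  then have w: "stable ?w" using z(1) cell_in_cells_iff by metis
  have s: "z' e = shift ?w h e" if "e \<in> arcs G" for e
    using h[OF that] by (simp add: shift_def)
  then have "stable (shift ?w h)" using z(2) stable_cong[of z' "shift ?w h"] by blast
  then show ?thesis using stable_unique[OF w _ e] s[OF e] by simp
qed

text \<open>
  Otherwise the quasistable representative of \<open>z + s u\<close> for small \<open>s\<close> lies in the cell of \<open>z\<close>, so it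
  differs from \<open>z\<close> only on edges where \<open>u\<close> vanishes; but pairing with \<open>u\<close> detects the difference.
\<close>

lemma maximal_no_cycle:
  assumes z: "stable z" "cell z \<in> maximal_cells G cells"
    and u: "u \<in> H1 G" "\<And>e. e \<in> frac_edges z \<Longrightarrow> u e = 0"
  shows "u e = (0::real)"
proof (rule ccontr)
  assume "u e \<noteq> 0"
  then have e: "e \<in> arcs G" using u by (auto simp: H1_iff)
  obtain \<rho> where \<rho>: "0 < \<rho>" "\<And>w. (\<And>e. e \<in> arcs G \<Longrightarrow> \<bar>w e - z e\<bar> < \<rho>) \<Longrightarrow> in_closure w z"
    using in_closure_near[of z] by blast
  obtain \<epsilon> where \<epsilon>: "0 < \<epsilon>"
    "\<And>u h e. \<lbrakk>\<And>e. e \<in> arcs G \<Longrightarrow> \<bar>u e\<bar> < \<epsilon>; stable (\<lambda>e. shift z h e + u e); e \<in> arcs G\<rbrakk>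
      \<Longrightarrow> \<bar>shift z h e + u e - z e\<bar> < \<rho>"
    using stable_perturb[OF z(1) \<rho>(1)] by blast
  define s where "s = \<epsilon> / (1 + (\<Sum>e\<in>arcs G. \<bar>u e\<bar>))"
  have S0: "0 \<le> (\<Sum>e\<in>arcs G. \<bar>u e\<bar>)" by (intro sum_nonneg) simp
  then have s: "0 < s" unfolding s_def using \<epsilon>(1) by (intro divide_pos_pos) linarith+
  have su: "\<bar>s * u e\<bar> < \<epsilon>" if "e \<in> arcs G" for e
  proof -
    have "\<bar>u e\<bar> \<le> (\<Sum>e\<in>arcs G. \<bar>u e\<bar>)" using that by (intro member_le_sum) auto
    then have "\<epsilon> * \<bar>u e\<bar> < \<epsilon> * (1 + (\<Sum>e\<in>arcs G. \<bar>u e\<bar>))" using \<epsilon>(1) by simp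
    then show ?thesis using S0 \<epsilon>(1) by (simp add: s_def abs_mult pos_divide_less_eq)
  qed
  obtain h where "stable (shift (\<lambda>e. z e + s * u e) h)" using exists_stable by blast
  then have w: "stable (\<lambda>e. shift z h e + s * u e)" by (simp add: shift_add[abs_def])
  define w where "w = (\<lambda>e. shift z h e + s * u e)"
  have st: "stable w" using w by (simp add: w_def)
  have cl: "in_closure w z"
    using \<epsilon>(2)[of "\<lambda>e. s * u e" h, OF su w] by (intro \<rho>(2)) (simp add: w_def)
  have "cell w = cell z"
    using z(2) in_closure_specialization[OF cl] st
    unfolding maximal_cells_def is_face_def cell_in_cells_iff[symmetric] by blast
  then have fr: "frac_edges w = frac_edges z" by (simp add: cell_def)
  have "w e = z e" if "e \<in> arcs G" "e \<notin> frac_edges z" for e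
    using that fr by (cases rule: in_closure_edge_cases[OF cl that(1)]) auto
  then have "integral_along G l w u = integral_along G l z u"
    unfolding integral_along_def using u(2) by (intro sum.cong) auto
  moreover have "integral_along G l w u = integral_along G l z u + s * integral_along G l u u"
    using integral_along_shift[OF u(1)] by (simp add: w_def integral_along_add integral_along_scale)
  ultimately have "integral_along G l u u = 0" using s by simp
  moreover have "0 < integral_along G l u u"
    unfolding integral_along_def using e \<open>u e \<noteq> 0\<close> l_pos
    by (intro sum_pos2[of _ e]) (auto intro!: mult_nonneg_nonneg mult_pos_pos simp: less_imp_le zero_less_mult_iff) 
  ultimately show False by simp
qed

text \<open>Independence comes from stability: each fractional edge closes up through integral
  edges, so the resulting cycles are dual to the coordinates on the fractional edges. Spanning comes
  from maximality: what remains of \<omega> vanishes on all fractional edges.\<close>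

lemma maximal_basis:
  assumes "\<sigma> \<in> maximal_cells G cells"
  obtains c :: "'e \<Rightarrow> 'e \<Rightarrow> real" where "\<And>i. i \<in> fst \<sigma> \<Longrightarrow> c i \<in> H1 G"
    "\<And>i j. \<lbrakk>i \<in> fst \<sigma>; j \<in> fst \<sigma>\<rbrakk> \<Longrightarrow> c i j = (if i = j then 1 else 0)"
    "\<And>\<omega> e. \<omega> \<in> H1 G \<Longrightarrow> \<omega> e = (\<Sum>i\<in>fst \<sigma>. \<omega> i * c i e)"
proof -
  have sc: "\<sigma> \<in> cells" using assms by (simp add: maximal_cells_def)
  obtain z where z: "cell z = \<sigma>" "stable z" by (rule cells_obtain[OF sc])
  have fst: "fst \<sigma> = frac_edges z" using z(1) by (auto simp: cell_def)
  define F where "F = {e \<in> arcs G. z e \<in> \<int>}"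
  have F: "cut_connected G F" unfolding F_def by (rule stable_cut_connected[OF z(2)])
  define d1 where "d1 i x = (if x = i then 1 else (0::real))" for i x :: 'e
  have "\<exists>n. (\<forall>e. e \<notin> F \<longrightarrow> n e = 0) \<and> (\<forall>v\<in>verts G. boundary G n v = boundary G (d1 i) v)" for i
  proof (rule boundary_surj[OF F])
    show "sum (boundary G (d1 i)) (verts G) = 0"
      using sum_boundary_mult[of "d1 i" "\<lambda>_. 1"] by simp
  qed
  then obtain n where n: "\<And>i e. e \<notin> F \<Longrightarrow> n i e = 0"
    "\<And>i v. v \<in> verts G \<Longrightarrow> boundary G (n i) v = boundary G (d1 i) v" by metis
  define c where "c i e = d1 i e - n i e" for i e
  have cH: "c i \<in> H1 G" if "i \<in> fst \<sigma>" for i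
  proof -
    have "c i e = 0" if "e \<notin> arcs G" for e
      using that \<open>i \<in> fst \<sigma>\<close> n(1)[of e i] by (auto simp: c_def d1_def F_def fst frac_edges_def)
    moreover have "boundary G (c i) v = 0" if "v \<in> verts G" for v
      using n(2)[OF that] by (simp add: c_def[abs_def] boundary_diff)
    ultimately show ?thesis by (simp add: H1_iff)
  qed
  have cd: "c i j = (if i = j then 1 else 0)" if "i \<in> fst \<sigma>" "j \<in> fst \<sigma>" for i j
    using that n(1)[of j i] by (auto simp: c_def d1_def F_def fst frac_edges_def)
  have "\<omega> e = (\<Sum>i\<in>fst \<sigma>. \<omega> i * c i e)" if \<omega>: "\<omega> \<in> H1 G" for \<omega> e
  proof -
    let ?u = "\<lambda>e. 1 * \<omega> e + (-1) * (\<Sum>i\<in>fst \<sigma>. \<omega> i * c i e)"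
    have "?u e = 0"
    proof (rule maximal_no_cycle[OF z(2)])
      show "cell z \<in> maximal_cells G cells" using assms z by simp
      show "?u \<in> H1 G" by (intro H1_combination \<omega> H1_sum cH)
      show "?u e = 0" if "e \<in> frac_edges z" for e
      proof -
        have "(\<Sum>i\<in>fst \<sigma>. \<omega> i * c i e) = (\<Sum>i\<in>fst \<sigma>. if i = e then \<omega> i else 0)"
          using cd that fst by (intro sum.cong) auto
        also have "\<dots> = \<omega> e" using that by (simp add: fst)
        finally show ?thesis by simp
      qed
    qed
    then show ?thesis by simp
  qed
  then show ?thesis using cH cd by (intro that)
qed

lemma cell_dim_maximal:
  assumes "\<sigma> \<in> maximal_cells G cells"
  shows "cell_dim \<sigma> = betti_number_1 G"
proof -
  obtain c :: "'e \<Rightarrow> 'e \<Rightarrow> real" where c: "\<And>i. i \<in> fst \<sigma> \<Longrightarrow> c i \<in> H1 G"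
    "\<And>i j. \<lbrakk>i \<in> fst \<sigma>; j \<in> fst \<sigma>\<rbrakk> \<Longrightarrow> c i j = (if i = j then 1 else 0)"
    "\<And>\<omega> e. \<omega> \<in> H1 G \<Longrightarrow> \<omega> e = (\<Sum>i\<in>fst \<sigma>. \<omega> i * c i e)"
    using maximal_basis[OF assms] by blast
  have fin: "finite (fst \<sigma>)" using assms finite_cell_edges by (simp add: maximal_cells_def)
  interpret V: vector_space "\<lambda>(r::real) (c::'e \<Rightarrow> real) e. r * c e"
    by unfold_locales (auto simp: fun_eq_iff algebra_simps)
  have inj: "inj_on c (fst \<sigma>)"
  proof (rule inj_onI)
    fix i j assume ij: "i \<in> fst \<sigma>" "j \<in> fst \<sigma>" and "c i = c j"
    then have "c i i = c j i" by simp
    then show "i = j" unfolding c(2)[OF ij(1,1)] c(2)[OF ij(2,1)] by (simp split: if_splits)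
  qed
  have "V.dim (H1 G) = card (fst \<sigma>)"
  proof (rule V.dim_unique)
    show "c ` fst \<sigma> \<subseteq> H1 G" using c(1) by blast
    show "card (c ` fst \<sigma>) = card (fst \<sigma>)" using inj by (rule card_image)
    show "H1 G \<subseteq> V.span (c ` fst \<sigma>)"
    proof
      fix \<omega> :: "'e \<Rightarrow> real" assume "\<omega> \<in> H1 G"
      then have "\<omega> = (\<Sum>i\<in>fst \<sigma>. (\<lambda>e. \<omega> i * c i e))"
        using c(3) by (intro ext) (simp add: sum_fun_apply)
      moreover have "\<dots> \<in> V.span (c ` fst \<sigma>)"
        by (intro V.span_sum V.span_scale V.span_base) blast
      ultimately show "\<omega> \<in> V.span (c ` fst \<sigma>)" by simp
    qed
    show "V.independent (c ` fst \<sigma>)"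
    proof (rule V.independent_if_scalars_zero)
      show "finite (c ` fst \<sigma>)" using fin by simp
      fix f x assume 0: "(\<Sum>x\<in>c ` fst \<sigma>. (\<lambda>e. f x * x e)) = 0" and "x \<in> c ` fst \<sigma>"
      then obtain j where j: "j \<in> fst \<sigma>" "x = c j" by blast
      have "0 = (\<Sum>i\<in>fst \<sigma>. f (c i) * c i j)"
        using arg_cong[OF 0, of "\<lambda>g. g j"] by (simp add: sum_fun_apply sum.reindex[OF inj])
      also have "\<dots> = (\<Sum>i\<in>fst \<sigma>. if i = j then f (c j) else 0)"
        using c(2) j by (intro sum.cong) auto
      finally show "f x = 0" using j fin by simp
    qed
  qed
  then show ?thesis by (simp add: cell_dim_def betti_number_1_def)
qed

lemma pure_dimensional_cells: "pure_dimensional G cells (betti_number_1 G)"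
  by (simp add: pure_dimensional_def cell_dim_maximal)

lemma cell_dim_le:
  assumes "\<tau> \<in> cells"
  shows "cell_dim \<tau> \<le> betti_number_1 G"
proof -
  obtain \<sigma> where \<sigma>: "\<sigma> \<in> maximal_cells G cells" "is_face G \<tau> \<sigma>"
    by (rule maximal_above[OF assms])
  then have "\<sigma> \<in> cells" by (simp add: maximal_cells_def)
  then have "cell_dim \<tau> \<le> cell_dim \<sigma>"
    unfolding cell_dim_def using is_face_subset[OF _ assms \<sigma>(2)] finite_cell_edges by (intro card_mono) auto
  then show ?thesis using cell_dim_maximal[OF \<sigma>(1)] by simp
qed

lemma complex_dim_cells: "complex_dim cells = betti_number_1 G"
  unfolding complex_dim_def
proof (rule Max_eqI)
  show "finite (cell_dim ` cells)" using finite_cells by simp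
  show "k \<le> betti_number_1 G" if "k \<in> cell_dim ` cells" for k using that cell_dim_le by auto
  obtain \<tau> where "\<tau> \<in> cells" using cells_nonempty by blast
  then obtain \<sigma> where "\<sigma> \<in> maximal_cells G cells" by (rule maximal_above)
  then have "\<sigma> \<in> cells" "betti_number_1 G = cell_dim \<sigma>"
    by (simp_all add: cell_dim_maximal) (simp add: maximal_cells_def)
  then show "betti_number_1 G \<in> cell_dim ` cells" by (rule rev_image_eqI)
qed


section \<open>Maximal cells that share a wall\<close>

definition adjacent :: "('v, 'e) pseudo_divisor \<Rightarrow> ('v, 'e) pseudo_divisor \<Rightarrow> bool" where
  "adjacent \<sigma> \<sigma>' \<longleftrightarrow> \<sigma> \<in> maximal_cells G cells \<and> \<sigma>' \<in> maximal_cells G cells \<and>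
     (\<exists>\<tau> \<in> cells. cell_dim \<tau> + 1 = complex_dim cells \<and> is_face G \<tau> \<sigma> \<and> is_face G \<tau> \<sigma>')"

lemma adjacent_sequence:
  assumes "adjacent\<^sup>*\<^sup>* \<sigma> \<sigma>'" "\<sigma> \<in> maximal_cells G cells"
  shows "\<exists>(m::nat) s t. s 0 = \<sigma> \<and> s m = \<sigma>' \<and> (\<forall>i\<le>m. s i \<in> maximal_cells G cells) \<and>
    (\<forall>i\<in>{1..m}. t i \<in> cells \<and> cell_dim (t i) + 1 = complex_dim cells \<and>
       is_face G (t i) (s (i - 1)) \<and> is_face G (t i) (s i))"
  using assms
proof (induction rule: rtranclp_induct)
  case base
  then show ?case by (intro exI[of _ 0] exI[of _ "\<lambda>_. \<sigma>"]) auto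
next
  case (step \<rho> \<rho>')
  then obtain m s t where m: "s 0 = \<sigma>" "s m = \<rho>" "\<forall>i\<le>m. s i \<in> maximal_cells G cells"
    "\<forall>i\<in>{1..m::nat}. t i \<in> cells \<and> cell_dim (t i) + 1 = complex_dim cells \<and>
       is_face G (t i) (s (i - 1)) \<and> is_face G (t i) (s i)" by blast
  obtain \<tau> where \<tau>: "\<tau> \<in> cells" "cell_dim \<tau> + 1 = complex_dim cells" "is_face G \<tau> \<rho>" "is_face G \<tau> \<rho>'"
    and \<rho>': "\<rho>' \<in> maximal_cells G cells"
    using step.hyps(2) by (auto simp: adjacent_def)
  let ?s = "s(Suc m := \<rho>')" and ?t = "t(Suc m := \<tau>)"
  have "\<forall>i\<le>Suc m. ?s i \<in> maximal_cells G cells" using m(3) \<rho>' by auto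
  moreover have "\<forall>i\<in>{1..Suc m}. ?t i \<in> cells \<and> cell_dim (?t i) + 1 = complex_dim cells \<and>
       is_face G (?t i) (?s (i - 1)) \<and> is_face G (?t i) (?s i)"
  proof
    fix i assume i: "i \<in> {1..Suc m}"
    show "?t i \<in> cells \<and> cell_dim (?t i) + 1 = complex_dim cells \<and>
       is_face G (?t i) (?s (i - 1)) \<and> is_face G (?t i) (?s i)"
    proof (cases "i = Suc m")
      case True
      then show ?thesis using \<tau> m(2) by simp
    next
      case False
      then have "i \<in> {1..m}" "i - 1 \<noteq> Suc m" using i by auto
      then show ?thesis using m(4) False by simp
    qed
  qed
  moreover have "?s 0 = \<sigma>" "?s (Suc m) = \<rho>'" using m(1) by simp_all
  ultimately show ?case by (intro exI[of _ "Suc m"] exI[of _ ?s] exI[of _ ?t] conjI)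
qed

text \<open>There are \<open>card (fst \<sigma>)\<close> free coordinates on the space of cycles and
  only \<open>card E + 1\<close> linear conditions. If \<open>y\<close> is the start of a segment
  minus the integral part of a cell with fractional edges \<open>E\<close>, the form takes one
  constant value on the start and on that cell.\<close>

lemma low_cell_form:
  assumes \<sigma>: "\<sigma> \<in> maximal_cells G cells" and E: "finite E" "card E + 2 \<le> card (fst \<sigma>)"
  obtains \<omega> :: "'e \<Rightarrow> real" where "\<omega> \<in> H1 G" "\<exists>i\<in>fst \<sigma>. \<omega> i \<noteq> 0" "\<And>e. e \<in> E \<Longrightarrow> \<omega> e = 0"
    "integral_along G l y \<omega> = 0"
proof -
  obtain c :: "'e \<Rightarrow> 'e \<Rightarrow> real" where c: "\<And>i. i \<in> fst \<sigma> \<Longrightarrow> c i \<in> H1 G"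
    "\<And>i j. \<lbrakk>i \<in> fst \<sigma>; j \<in> fst \<sigma>\<rbrakk> \<Longrightarrow> c i j = (if i = j then 1 else 0)"
    by (rule maximal_basis[OF \<sigma>]) (rule that)
  have fin: "finite (fst \<sigma>)" using \<sigma> finite_cell_edges by (simp add: maximal_cells_def)
  \<comment> \<open>\<open>None\<close> stands for the pairing with \<open>y\<close> and
    \<open>Some e\<close> for vanishing on \<open>e\<close>.\<close>
  define J where "J = insert None (Some ` E)"
  define a where "a j i = (case j of None \<Rightarrow> integral_along G l y (c i) | Some e \<Rightarrow> c i e)" for j i
  have "card J \<le> card E + 1" unfolding J_def using E(1) by (simp add: card_insert_if card_image)
  then have "card J < card (fst \<sigma>)" using E(2) by simp
  moreover have "finite J" using E(1) by (simp add: J_def)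
  ultimately obtain x where x: "\<exists>i\<in>fst \<sigma>. x i \<noteq> 0" "\<And>j. j \<in> J \<Longrightarrow> (\<Sum>i\<in>fst \<sigma>. a j i * x i) = 0"
    using homogeneous_system_solution[of J "fst \<sigma>" a] fin by blast
  define \<omega> where "\<omega> e = (\<Sum>i\<in>fst \<sigma>. x i * c i e)" for e
  have "\<omega> \<in> H1 G" unfolding \<omega>_def[abs_def] by (intro H1_sum c)
  moreover have "\<omega> i = x i" if "i \<in> fst \<sigma>" for i
  proof -
    have "\<omega> i = (\<Sum>j\<in>fst \<sigma>. if j = i then x j else 0)"
      unfolding \<omega>_def using c(2) that by (intro sum.cong) auto
    then show ?thesis using that fin by simp
  qed
  moreover have "\<omega> e = 0" if "e \<in> E" for e
    using x(2)[of "Some e"] that by (simp add: J_def a_def \<omega>_def mult.commute)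
  moreover have "integral_along G l y \<omega> = (\<Sum>i\<in>fst \<sigma>. integral_along G l y (c i) * x i)"
    unfolding integral_along_def \<omega>_def sum_distrib_left sum_distrib_right
    by (subst sum.swap) (simp add: mult_ac)
  then have "integral_along G l y \<omega> = 0"
    using x(2)[of None] by (simp add: J_def a_def)
  ultimately show ?thesis using x(1) that by metis
qed

text \<open>
  The cells of codimension at least 2 meet the segment only if its endpoint lies in one of countably many
  hyperplanes through \<open>z\<close>. Moving the endpoint along the moment curve \<open>s \<mapsto> (s, s\<^sup>2, \<dots>)\<close> inside its cell
  avoids them, as each hyperplane contains only finitely many points of the curve.
\<close>

lemma generic_segment:
  assumes z: "stable z" "cell z \<in> maximal_cells G cells"
    and z1: "stable z1" "cell z1 \<in> maximal_cells G cells"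
  obtains z2 where "stable z2" "cell z2 = cell z1"
    "\<And>t h. stable (shift (\<lambda>e. z e + t * (z2 e - z e)) h) \<Longrightarrow>
      betti_number_1 G \<le> card (frac_edges (shift (\<lambda>e. z e + t * (z2 e - z e)) h)) + 1"
proof -
  let ?g = "betti_number_1 G" and ?E = "frac_edges z1"
  have fst: "fst (cell z1) = ?E" by (simp add: cell_def)
  have g: "card ?E = ?g" using cell_dim_maximal[OF z1(2)] by (simp add: cell_dim_def fst)
  \<comment> \<open>A low cell is recorded by its fractional edges and by the integral part of a
    chain in it. Taking the latter extensional on the finite edge set keeps the index set
    countable.\<close>
  define N where "N = {E \<in> Pow (arcs G). card E + 2 \<le> ?g} \<times> (arcs G \<rightarrow>\<^sub>E (UNIV :: int set))"
  have "\<forall>p\<in>N. \<exists>\<omega> :: 'e \<Rightarrow> real. \<omega> \<in> H1 G \<and> (\<exists>i\<in>?E. \<omega> i \<noteq> 0) \<and> (\<forall>e\<in>fst p. \<omega> e = 0) \<and>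
    integral_along G l (\<lambda>e. z e - of_int (snd p e)) \<omega> = 0"
  proof
    fix p assume "p \<in> N"
    then have p: "finite (fst p)" "card (fst p) + 2 \<le> card (fst (cell z1))"
      using finite_subset[OF _ finite_arcs] by (auto simp: N_def g fst)
    show "\<exists>\<omega> :: 'e \<Rightarrow> real. \<omega> \<in> H1 G \<and> (\<exists>i\<in>?E. \<omega> i \<noteq> 0) \<and> (\<forall>e\<in>fst p. \<omega> e = 0) \<and>
      integral_along G l (\<lambda>e. z e - of_int (snd p e)) \<omega> = 0"
      by (rule low_cell_form[OF z1(2) p, of "\<lambda>e. z e - of_int (snd p e)"]) (auto simp: fst)
  qed
  then obtain \<omega> :: "'e set \<times> ('e \<Rightarrow> int) \<Rightarrow> 'e \<Rightarrow> real" where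
    \<omega>: "\<forall>p\<in>N. \<omega> p \<in> H1 G \<and> (\<exists>i\<in>?E. \<omega> p i \<noteq> 0) \<and> (\<forall>e\<in>fst p. \<omega> p e = 0) \<and>
      integral_along G l (\<lambda>e. z e - of_int (snd p e)) (\<omega> p) = 0"
    by (rule bchoice[elim_format]) blast
  obtain k :: "'e \<Rightarrow> nat" where k: "inj_on k ?E"
    using finite_imp_inj_to_nat_seg[OF finite_frac_edges[of z1]] by blast
  \<comment> \<open>The exponents are positive and distinct, so in the pairing with a form, a
    polynomial in \<open>s\<close>, each edge of \<open>?E\<close> has a coefficient of its own,
    separate from the constant term.\<close>
  define y where "y s e = z1 e + (if e \<in> ?E then s ^ Suc (k e) else 0)" for s :: real and e
  define bad where "bad p = {s. integral_along G l (\<lambda>e. y s e - z e) (\<omega> p) = 0}" for p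
  have fin_bad: "finite (bad p)" if p: "p \<in> N" for p
  proof -
    obtain i where i: "i \<in> ?E" "\<omega> p i \<noteq> 0" using \<omega> p by blast
    define P where "P = [:integral_along G l (\<lambda>e. z1 e - z e) (\<omega> p):] +
      (\<Sum>e\<in>?E. monom (\<omega> p e * l e) (Suc (k e)))"
    have "poly P s = integral_along G l (\<lambda>e. y s e - z e) (\<omega> p)" for s
    proof -
      have "integral_along G l (\<lambda>e. y s e - z e) (\<omega> p) =
          integral_along G l (\<lambda>e. (z1 e - z e) + (if e \<in> ?E then s ^ Suc (k e) else 0)) (\<omega> p)"
        by (intro integral_along_cong) (simp add: y_def)
      also have "\<dots> = integral_along G l (\<lambda>e. z1 e - z e) (\<omega> p) +
          (\<Sum>e\<in>arcs G. if e \<in> ?E then \<omega> p e * l e * s ^ Suc (k e) else 0)"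
        unfolding integral_along_add
        by (intro arg_cong2[where f = "(+)"] refl) (auto simp: integral_along_def intro!: sum.cong)
      also have "(\<Sum>e\<in>arcs G. if e \<in> ?E then \<omega> p e * l e * s ^ Suc (k e) else 0) =
          (\<Sum>e\<in>?E. \<omega> p e * l e * s ^ Suc (k e))"
        using frac_edges_subset[of z1] by (subst sum.inter_restrict[symmetric]) (auto simp: Int_absorb1)
      finally show ?thesis by (simp add: P_def poly_sum poly_monom)
    qed
    moreover have "coeff P (Suc (k i)) = \<omega> p i * l i"
    proof -
      have "(\<Sum>e\<in>?E. if k e = k i then \<omega> p e * l e else 0) = (\<Sum>e\<in>?E. if e = i then \<omega> p e * l e else 0)"
        using k i(1) by (intro sum.cong) (auto dest: inj_onD)
      moreover have "coeff P (Suc (k i)) = (\<Sum>e\<in>?E. if k e = k i then \<omega> p e * l e else 0)"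
        unfolding P_def by (simp add: coeff_sum)
      ultimately show ?thesis using i by simp
    qed
    then have "P \<noteq> 0"
      using i l_pos[of i] frac_edges_subset[of z1] by (metis coeff_0 less_irrefl mult_eq_0_iff subsetD)
    ultimately show ?thesis using poly_roots_finite[of P] by (simp add: bad_def)
  qed
  have "countable N"
    unfolding N_def by (intro countable_SIGMA countable_PiE) (auto intro: countable_finite)
  then have cb: "countable (\<Union>p\<in>N. bad p)"
    using fin_bad by (intro countable_UN) (auto intro: countable_finite)
  have "0 < of_int \<lfloor>z1 e\<rfloor> + 1 - z1 e" for e by linarith
  then obtain \<delta> where \<delta>: "0 < \<delta>" "\<And>e. e \<in> arcs G \<Longrightarrow> \<delta> \<le> of_int \<lfloor>z1 e\<rfloor> + 1 - z1 e"
    using finite_positive_lower_bound[OF finite_arcs, of "\<lambda>e. of_int \<lfloor>z1 e\<rfloor> + 1 - z1 e"] by blast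
  \<comment> \<open>\<open>s < \<delta>\<close> keeps every coordinate below the next integer, and
    \<open>s < 1\<close> keeps the higher powers below \<open>s\<close>. Hence such a move stays in
    the cell of \<open>z1\<close>.\<close>
  have "uncountable ({0<..<min \<delta> 1} - (\<Union>p\<in>N. bad p))"
    using \<delta>(1) cb by (intro uncountable_minus_countable) (simp_all add: uncountable_open_interval)
  then obtain s where s: "s \<in> {0<..<min \<delta> 1}" "s \<notin> (\<Union>p\<in>N. bad p)"
    by (metis countable_empty Diff_iff ex_in_conv)
  have "cell (y s) = cell z1"
  proof (rule cell_eqI)
    fix e assume e: "e \<in> arcs G"
    show fl: "\<lfloor>y s e\<rfloor> = \<lfloor>z1 e\<rfloor>"
    proof (cases "e \<in> ?E")
      case True
      have "s ^ Suc (k e) \<le> s" "0 \<le> s ^ Suc (k e)" using s(1) by (auto simp: mult_left_le power_le_one)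
      then have "z1 e \<le> y s e" "y s e < of_int \<lfloor>z1 e\<rfloor> + 1" 
        using s(1) \<delta>(2)[OF e] True by (simp_all add: y_def del: power_Suc)
      then show ?thesis by linarith
    qed (simp add: y_def)
    show "\<lceil>y s e\<rceil> = \<lceil>z1 e\<rceil>"
    proof (cases "e \<in> ?E")
      case True
      have "0 < s ^ Suc (k e)" using s(1) by simp
      then have "of_int \<lfloor>y s e\<rfloor> < y s e" unfolding fl using True by (simp add: y_def) linarith
      then have "y s e \<notin> \<int>" by (simp add: Ints_iff_floor)
      then have "e \<in> frac_edges (y s)" using e by (simp add: frac_edges_def)
      then show ?thesis using True fl by (simp add: ceiling_frac_edges[OF e])
    qed (simp add: y_def)
  qed
  moreover have "?g \<le> card (frac_edges (shift (\<lambda>e. z e + t * (y s e - z e)) h)) + 1"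
    if st: "stable (shift (\<lambda>e. z e + t * (y s e - z e)) h)" for t h
  proof (rule ccontr)
    define w where "w = shift (\<lambda>e. z e + t * (y s e - z e)) h"
    define n where "n = (\<lambda>e\<in>arcs G. \<lfloor>w e\<rfloor>)"
    assume "\<not> ?thesis"
    then have low: "card (frac_edges w) + 2 \<le> ?g" by (simp add: w_def)
    then have p: "(frac_edges w, n) \<in> N"
      using frac_edges_subset by (auto simp: N_def n_def)
    let ?\<omega> = "\<omega> (frac_edges w, n)"
    have \<omega>H: "?\<omega> \<in> H1 G" and \<omega>0: "\<And>e. e \<in> frac_edges w \<Longrightarrow> ?\<omega> e = 0"
      and i0: "integral_along G l (\<lambda>e. z e - of_int (n e)) ?\<omega> = 0"
      using \<omega> p by auto
    \<comment> \<open>The form vanishes where \<open>w\<close> is fractional, so it sees only the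
      integral part of \<open>w\<close>, which pairs like \<open>z\<close>. The motion along the
      segment must then be orthogonal to the form.\<close>
    have "integral_along G l w ?\<omega> = integral_along G l (\<lambda>e. of_int (n e)) ?\<omega>"
      unfolding integral_along_def
    proof (intro sum.cong refl)
      fix e assume e: "e \<in> arcs G"
      show "w e * ?\<omega> e * l e = of_int (n e) * ?\<omega> e * l e"
      proof (cases "e \<in> frac_edges w")
        case False
        then have "w e \<in> \<int>" using e by (simp add: frac_edges_def)
        then show ?thesis using e by (simp add: n_def Ints_iff_floor)
      qed (simp add: \<omega>0)
    qed
    moreover have "integral_along G l w \<omega>' = integral_along G l z \<omega>' + t * integral_along G l (\<lambda>e. y s e - z e) \<omega>'"
      if "\<omega>' \<in> H1 G" for \<omega>'
      unfolding w_def integral_along_shift[OF that] integral_along_add integral_along_scale by simp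
    note this[OF \<omega>H]
    ultimately have "t * integral_along G l (\<lambda>e. y s e - z e) ?\<omega> = 0"
      using i0 by (simp add: integral_along_diff)
    moreover have "integral_along G l (\<lambda>e. y s e - z e) ?\<omega> \<noteq> 0"
      using s(2) p by (auto simp: bad_def)
    \<comment> \<open>The start of the segment lies on every one of the hyperplanes and is treated
      separately: its cell is maximal, not low.\<close>
    ultimately have "t = 0" by simp
    then have "w e = z e" if "e \<in> arcs G" for e
      using stable_unique[OF z(1) _ that, of h] st by (simp add: w_def)
    then have "cell w = cell z" by (rule cell_cong)
    then have "card (frac_edges w) = ?g"
      using cell_dim_maximal[OF z(2)] by (simp add: cell_def cell_dim_def)
    then show False using low by simp
  qed
  ultimately show ?thesis
    using z1(1) cell_in_cells_iff[of "y s"] cell_in_cells_iff[of z1] by (intro that[of "y s"]) auto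
qed

text \<open>All cells met along the generic segment have codimension at most 1. Reachability between
  the maximal cofaces at two parameters is a locally valid relation, and the line is
  connected.\<close>

lemma connected_maximal_cells:
  assumes \<sigma>: "\<sigma> \<in> maximal_cells G cells" "\<sigma>' \<in> maximal_cells G cells"
  shows "adjacent\<^sup>*\<^sup>* \<sigma> \<sigma>'"
proof -
  have sc: "\<sigma> \<in> cells" "\<sigma>' \<in> cells" using \<sigma> by (auto simp: maximal_cells_def)
  obtain z where z: "cell z = \<sigma>" "stable z" by (rule cells_obtain[OF sc(1)])
  obtain z1 where z1: "cell z1 = \<sigma>'" "stable z1" by (rule cells_obtain[OF sc(2)])
  have mx: "cell z \<in> maximal_cells G cells" "cell z1 \<in> maximal_cells G cells"
    using \<sigma> z z1 by simp_all
  obtain z2 where z2: "stable z2" "cell z2 = cell z1"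
    "\<And>t h. stable (shift (\<lambda>e. z e + t * (z2 e - z e)) h) \<Longrightarrow>
      betti_number_1 G \<le> card (frac_edges (shift (\<lambda>e. z e + t * (z2 e - z e)) h)) + 1"
    by (rule generic_segment[OF z(2) mx(1) z1(2) mx(2)]) (rule that)
  define y where "y t = (\<lambda>e. z e + t * (z2 e - z e))" for t
  have "\<forall>t. \<exists>h. stable (shift (y t) h)" using exists_stable by blast
  then obtain h where h: "\<And>t. stable (shift (y t) (h t))" by (rule choice[elim_format]) blast
  define w where "w t = shift (y t) (h t)" for t
  define \<tau> where "\<tau> t = cell (w t)" for t
  have w: "stable (w t)" for t using h by (simp add: w_def)
  have \<tau>c: "\<tau> t \<in> cells" for t using w by (simp add: \<tau>_def cell_in_cells_iff)
  have dim: "betti_number_1 G \<le> cell_dim (\<tau> t) + 1" for t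
    using z2(3)[of t "h t"] h[of t] by (simp add: \<tau>_def w_def y_def cell_def cell_dim_def)
  have face_refl: "is_face G (cell x) (cell x)" for x
    unfolding is_face_def using in_closure_specialization[OF in_closure_refl] by blast
  \<comment> \<open>Quantifying over all maximal cofaces makes the relation independent of the one
    picked at a wall.\<close>
  define R where "R t t' \<longleftrightarrow> (\<forall>M M'. M \<in> maximal_cells G cells \<longrightarrow> M' \<in> maximal_cells G cells \<longrightarrow>
    is_face G (\<tau> t) M \<longrightarrow> is_face G (\<tau> t') M' \<longrightarrow> adjacent\<^sup>*\<^sup>* M M')" for t t' :: real
  have adj_sym: "adjacent\<^sup>*\<^sup>* M' M" if "adjacent\<^sup>*\<^sup>* M M'" for M M'
  proof -
    have "symp adjacent" by (auto simp: symp_def adjacent_def)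
    then show ?thesis using that by (meson symp_rtranclp sympD)
  qed
  have "R 0 1"
  proof (rule connected_equivalence_relation[where S = UNIV and R = R])
    show "R t t'" if "R t' t" for t t' using that adj_sym unfolding R_def by blast
    show "R t t''" if "R t t'" "R t' t''" for t t' t''
    proof -
      obtain M where "M \<in> maximal_cells G cells" "is_face G (\<tau> t') M"
        by (rule maximal_above[OF \<tau>c])
      then show ?thesis using that unfolding R_def by (meson rtranclp_trans)
    qed
    show "\<exists>T. openin (top_of_set UNIV) T \<and> t \<in> T \<and> (\<forall>t'\<in>T. R t t')" for t
    proof -
      obtain \<rho> where \<rho>: "0 < \<rho>" "\<And>x. (\<And>e. e \<in> arcs G \<Longrightarrow> \<bar>x e - w t e\<bar> < \<rho>) \<Longrightarrow> in_closure x (w t)"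
        using in_closure_near[of "w t"] by blast
      obtain \<epsilon> where \<epsilon>: "0 < \<epsilon>"
        "\<And>u h e. \<lbrakk>\<And>e. e \<in> arcs G \<Longrightarrow> \<bar>u e\<bar> < \<epsilon>; stable (\<lambda>e. shift (w t) h e + u e); e \<in> arcs G\<rbrakk>
          \<Longrightarrow> \<bar>shift (w t) h e + u e - w t e\<bar> < \<rho>"
        using stable_perturb[OF w \<rho>(1)] by blast
      define S where "S = (\<Sum>e\<in>arcs G. \<bar>z2 e - z e\<bar>) + 1"
      have S: "0 < S" "\<And>e. e \<in> arcs G \<Longrightarrow> \<bar>z2 e - z e\<bar> \<le> S"
      proof -
        show "0 < S" unfolding S_def by (intro add_nonneg_pos sum_nonneg) auto
        show "\<bar>z2 e - z e\<bar> \<le> S" if "e \<in> arcs G" for e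
          unfolding S_def using member_le_sum[OF that, of "\<lambda>e. \<bar>z2 e - z e\<bar>"] by simp
      qed
      have "R t t'" if t': "t' \<in> ball t (\<epsilon> / S)" for t'
      proof -
        have d: "\<bar>t' - t\<bar> * S < \<epsilon>" using t' S by (simp add: dist_real_def field_simps abs_minus_commute)
        define u where "u e = (t' - t) * (z2 e - z e)" for e
        have u: "\<bar>u e\<bar> < \<epsilon>" if "e \<in> arcs G" for e
        proof -
          have "\<bar>u e\<bar> \<le> \<bar>t' - t\<bar> * S" unfolding u_def abs_mult using S(2)[OF that] by (intro mult_left_mono) auto
          then show ?thesis using d by linarith
        qed
        have eq: "(\<lambda>e. shift (w t) (\<lambda>v. h t' v - h t v) e + u e) = w t'"
        proof
          fix e
          have "y t' e = y t e + u e" by (simp add: y_def u_def algebra_simps)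
          then show "shift (w t) (\<lambda>v. h t' v - h t v) e + u e = w t' e"
            unfolding w_def shift_shift by (simp add: shift_def)
        qed
        have st: "stable (\<lambda>e. shift (w t) (\<lambda>v. h t' v - h t v) e + u e)"
          unfolding eq by (rule w)
        have "\<bar>w t' e - w t e\<bar> < \<rho>" if "e \<in> arcs G" for e
        proof -
          have "\<bar>shift (w t) (\<lambda>v. h t' v - h t v) e + u e - w t e\<bar> < \<rho>"
            by (rule \<epsilon>(2)[OF _ st that]) (rule u)
          then show ?thesis using fun_cong[OF eq, of e] by simp
        qed
        then have "in_closure (w t') (w t)" by (rule \<rho>(2))
        then have face: "is_face G (\<tau> t) (\<tau> t')"
          unfolding is_face_def \<tau>_def using in_closure_specialization by blast
        show ?thesis
          unfolding R_def
        proof (intro allI impI)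
          fix M M' assume M: "M \<in> maximal_cells G cells" "M' \<in> maximal_cells G cells"
            and f: "is_face G (\<tau> t) M" "is_face G (\<tau> t') M'"
          have Mc: "M \<in> cells" "M' \<in> cells" using M by (auto simp: maximal_cells_def)
          have f': "is_face G (\<tau> t) M'" using is_face_trans[OF Mc(2) \<tau>c \<tau>c face f(2)] .
          show "adjacent\<^sup>*\<^sup>* M M'"
          \<comment> \<open>Both \<open>M\<close> and \<open>M'\<close> have the cell at
            \<open>t\<close> as a face: either it is maximal and they coincide with it, or it is a
            wall between them.\<close>
          proof (cases "cell_dim (\<tau> t) = betti_number_1 G")
            case True
            have "K = \<tau> t" if K: "K \<in> maximal_cells G cells" "is_face G (\<tau> t) K" for K
            proof -
              have Kc: "K \<in> cells" using K by (simp add: maximal_cells_def)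
              have "fst (\<tau> t) = fst K"
                using is_face_subset[OF Kc \<tau>c K(2)] finite_cell_edges[OF Kc] True cell_dim_maximal[OF K(1)]
                by (simp add: cell_dim_def card_subset_eq)
              then show ?thesis using is_face_same_edges[OF Kc \<tau>c K(2)] by simp
            qed
            then have "M = M'" using M f(1) f' by metis
            then show ?thesis by simp
          next
            case False
            then have "cell_dim (\<tau> t) + 1 = complex_dim cells"
              using dim[of t] cell_dim_le[OF \<tau>c[of t]] by (simp add: complex_dim_cells)
            then have "adjacent M M'" unfolding adjacent_def using M \<tau>c f(1) f' by blast
            then show ?thesis by (rule r_into_rtranclp)
          qed
        qed
      qed
      then show ?thesis using \<epsilon>(1) S(1) by (intro exI[of _ "ball t (\<epsilon> / S)"]) auto
    qed
  qed (auto simp: connected_UNIV)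
  \<comment> \<open>At both ends the chain on the segment is already stable, so its stable shift
    agrees with it on all edges.\<close>
  moreover have "\<tau> 0 = \<sigma>"
  proof -
    have "w 0 e = z e" if "e \<in> arcs G" for e
      using stable_unique[OF z(2) _ that, of "h 0"] w[of 0] by (simp add: w_def y_def)
    then show ?thesis unfolding \<tau>_def z(1)[symmetric] by (rule cell_cong)
  qed
  moreover have "\<tau> 1 = \<sigma>'"
  proof -
    have "w 1 e = z2 e" if "e \<in> arcs G" for e
      using stable_unique[OF z2(1) _ that, of "h 1"] w[of 1] by (simp add: w_def y_def)
    then show ?thesis unfolding \<tau>_def z1(1)[symmetric] z2(2)[symmetric] by (rule cell_cong)
  qed
  ultimately show ?thesis
    using \<sigma> face_refl z(1) z1(1) unfolding R_def by metis
qed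

lemma connected_in_codim_1_cells: "connected_in_codim_1 G cells"
  unfolding connected_in_codim_1_def
  using adjacent_sequence[OF connected_maximal_cells] by blast

end

section \<open>The homeomorphism\<close>

lemma continuous_map_from_sum_topology:
  assumes "\<And>i. i \<in> I \<Longrightarrow> continuous_map (X i) Y (\<lambda>x. f (i, x))"
  shows "continuous_map (sum_topology X I) Y f"
  unfolding continuous_map_def
proof (intro conjI allI impI)
  show "f \<in> topspace (sum_topology X I) \<rightarrow> topspace Y"
    using assms by (auto simp: continuous_map_def Pi_iff)
  fix U assume U: "openin Y U"
  show "openin (sum_topology X I) {x \<in> topspace (sum_topology X I). f x \<in> U}"
    unfolding openin_sum_topology
  proof (intro conjI ballI)
    fix i assume i: "i \<in> I"
    have "openin (X i) {x \<in> topspace (X i). f (i, x) \<in> U}"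
      using openin_continuous_map_preimage[OF assms[OF i] U] .
    then show "openin (X i) {x. (i, x) \<in> {x \<in> topspace (sum_topology X I). f x \<in> U}}"
      using i by simp
  qed auto
qed

lemma symmetric_closure_class_eq:
  assumes "(p, q) \<in> (r \<union> r\<inverse>)\<^sup>*"
  shows "(r \<union> r\<inverse>)\<^sup>* `` {p} = (r \<union> r\<inverse>)\<^sup>* `` {q}"
proof -
  have "(q, p) \<in> (r \<union> r\<inverse>)\<^sup>*"
    using assms symD[OF sym_rtrancl[OF sym_Un_converse[of r]]] by blast
  then show ?thesis using assms by (auto intro: rtrancl_trans)
qed

text \<open>Continuity and inversion are required only after composition with the quotient maps;
  this allows \<open>b\<close> to jump between representatives of a class.\<close>

lemma homeomorphic_quotients:
  assumes q: "quotient_map T1 Q1 q1" "quotient_map T2 Q2 q2"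
    and cont: "continuous_map T1 Q2 (\<lambda>x. q2 (a x))" "continuous_map T2 Q1 (\<lambda>y. q1 (b y))"
    and a: "\<And>x. x \<in> topspace T1 \<Longrightarrow> a x \<in> topspace T2"
    and b: "\<And>y. y \<in> topspace T2 \<Longrightarrow> b y \<in> topspace T1"
    and a_resp: "\<And>x x'. \<lbrakk>x \<in> topspace T1; x' \<in> topspace T1; q1 x = q1 x'\<rbrakk> \<Longrightarrow> q2 (a x) = q2 (a x')"
    and b_resp: "\<And>y y'. \<lbrakk>y \<in> topspace T2; y' \<in> topspace T2; q2 y = q2 y'\<rbrakk> \<Longrightarrow> q1 (b y) = q1 (b y')"
    and ba: "\<And>x. x \<in> topspace T1 \<Longrightarrow> q1 (b (a x)) = q1 x"
    and ab: "\<And>y. y \<in> topspace T2 \<Longrightarrow> q2 (a (b y)) = q2 y"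
  shows "Q1 homeomorphic_space Q2"
proof -
  obtain f where f: "continuous_map Q1 Q2 f" "\<And>x. x \<in> topspace T1 \<Longrightarrow> f (q1 x) = q2 (a x)"
    by (rule quotient_map_lift_exists[OF q(1) cont(1)]) (rule a_resp, assumption+, rule that, assumption+)
  obtain g where g: "continuous_map Q2 Q1 g" "\<And>y. y \<in> topspace T2 \<Longrightarrow> g (q2 y) = q1 (b y)"
    by (rule quotient_map_lift_exists[OF q(2) cont(2)]) (rule b_resp, assumption+, rule that, assumption+)
  have "g (f u) = u" if "u \<in> topspace Q1" for u
  proof -
    have "u \<in> q1 ` topspace T1" using that quotient_imp_surjective_map[OF q(1)] by simp
    then obtain x where x: "x \<in> topspace T1" "u = q1 x" by (rule imageE)
    show ?thesis unfolding x(2) f(2)[OF x(1)] g(2)[OF a[OF x(1)]] by (rule ba[OF x(1)])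
  qed
  moreover have "f (g u) = u" if "u \<in> topspace Q2" for u
  proof -
    have "u \<in> q2 ` topspace T2" using that quotient_imp_surjective_map[OF q(2)] by simp
    then obtain y where y: "y \<in> topspace T2" "u = q2 y" by (rule imageE)
    show ?thesis unfolding y(2) g(2)[OF y(1)] f(2)[OF b[OF y(1)]] by (rule ab[OF y(1)])
  qed
  ultimately show ?thesis
    using f(1) g(1) unfolding homeomorphic_space_def homeomorphic_maps_def by blast
qed

lemma topspace_cell_topology [simp]:
  "topspace (cell_topology l \<sigma>) = (\<Pi>\<^sub>E e\<in>fst \<sigma>. {0..l e})"
  by (simp add: cell_topology_def)

text \<open>As the product is finite, a basic open set contains a cube around each of its
  points.\<close>

lemma openin_cell_topology_box:
  assumes "finite (fst \<sigma>)" "openin (cell_topology l \<sigma>) U" "p \<in> U"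
  obtains r where "0 < r"
    "\<And>x. \<lbrakk>x \<in> topspace (cell_topology l \<sigma>); \<And>e. e \<in> fst \<sigma> \<Longrightarrow> \<bar>x e - p e\<bar> < r\<rbrakk> \<Longrightarrow> x \<in> U"
proof -
  obtain V where V: "\<And>e. e \<in> fst \<sigma> \<Longrightarrow> openin (top_of_set {0..l e}) (V e)"
    "p \<in> Pi\<^sub>E (fst \<sigma>) V" "Pi\<^sub>E (fst \<sigma>) V \<subseteq> U"
    using bspec[OF assms(2)[unfolded cell_topology_def openin_product_topology_alt] assms(3)]
    by (elim exE conjE) (rule that; blast)
  have "\<exists>r>0. \<forall>t\<in>{0..l e}. \<bar>t - p e\<bar> < r \<longrightarrow> t \<in> V e" if e: "e \<in> fst \<sigma>" for e
  proof -
    have "p e \<in> V e" using V(2) e by (auto simp: PiE_iff)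
    then have "\<exists>r>0. \<forall>t\<in>{0..l e}. dist t (p e) < r \<longrightarrow> t \<in> V e"
      using V(1)[OF e] unfolding openin_euclidean_subtopology_iff by blast
    then show ?thesis by (simp only: dist_real_def)
  qed
  then obtain s where s: "\<And>e. e \<in> fst \<sigma> \<Longrightarrow> 0 < s e \<and> (\<forall>t\<in>{0..l e}. \<bar>t - p e\<bar> < s e \<longrightarrow> t \<in> V e)"
    by metis
  then obtain r where r: "0 < r" "\<And>e. e \<in> fst \<sigma> \<Longrightarrow> r \<le> s e"
    using finite_positive_lower_bound[OF assms(1), of s] by blast
  have "x \<in> U" if x: "x \<in> topspace (cell_topology l \<sigma>)" "\<And>e. e \<in> fst \<sigma> \<Longrightarrow> \<bar>x e - p e\<bar> < r" for x
  proof -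
    have "x e \<in> V e" if "e \<in> fst \<sigma>" for e
      using s[OF that] r(2)[OF that] x(2)[OF that] x(1) that by (auto simp: PiE_iff)
    then have "x \<in> Pi\<^sub>E (fst \<sigma>) V" using x(1) by (auto simp: PiE_iff)
    then show ?thesis using V(3) by blast
  qed
  then show ?thesis using that r(1) by blast
qed

context polarized_graph
begin

text \<open>The distance of the exceptional vertex from the source: with the floor on a length
  \<open>x\<close> and the ceiling on the rest, the average flow on a fractional edge is
  \<open>\<lceil>w e\<rceil> - x / l e\<close>.\<close>

definition cell_coord :: "('e \<Rightarrow> real) \<Rightarrow> ('e \<Rightarrow> real) \<Rightarrow> 'e \<Rightarrow> real" where
  "cell_coord w z = (\<lambda>e\<in>frac_edges w. l e * (of_int \<lceil>w e\<rceil> - z e))"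

abbreviation cell_class :: "('v, 'e) pseudo_divisor \<times> ('e \<Rightarrow> real) \<Rightarrow> (('v, 'e) pseudo_divisor \<times> ('e \<Rightarrow> real)) set" where
  "cell_class p \<equiv> (face_gluing G l cells \<union> (face_gluing G l cells)\<inverse>)\<^sup>* `` {p}"

abbreviation cell_points :: "(('v, 'e) pseudo_divisor \<times> ('e \<Rightarrow> real)) topology" where
  "cell_points \<equiv> sum_topology (cell_topology l) cells"

lemma fst_cell [simp]: "fst (cell z) = frac_edges z"
  by (simp add: cell_def)

lemma cell_coord_in_box:
  assumes "in_closure w z"
  shows "cell_coord w z \<in> topspace (cell_topology l (cell w))"
proof -
  have "l e * (of_int \<lceil>w e\<rceil> - z e) \<in> {0..l e}" if e: "e \<in> frac_edges w" for e
  proof -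
    have ea: "e \<in> arcs G" using e frac_edges_subset by blast
    have "of_int \<lceil>w e\<rceil> = of_int \<lfloor>w e\<rfloor> + (1::real)" using ceiling_frac_edges[OF ea, of w] e by simp
    then have "0 \<le> of_int \<lceil>w e\<rceil> - z e" "of_int \<lceil>w e\<rceil> - z e \<le> 1"
      using assms ea by (auto simp: in_closure_def)
    then show ?thesis using l_pos[OF ea] by (simp add: mult_left_le)
  qed
  then show ?thesis by (simp add: cell_coord_def PiE_iff)
qed

lemma cell_coord_face_map:
  assumes "in_closure w z"
  shows "cell_coord w z = face_map l (cell w) (cell z) (upper_edges w z) (cell_coord z z)"
proof
  fix e
  show "cell_coord w z e = face_map l (cell w) (cell z) (upper_edges w z) (cell_coord z z) e"
  proof (cases "e \<in> frac_edges w")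
    case True
    then have "e \<in> arcs G" using frac_edges_subset by blast
    then show ?thesis
      using True by (cases rule: in_closure_edge_cases[OF assms]) (auto simp: cell_coord_def face_map_def)
  qed (simp add: cell_coord_def face_map_def)
qed

lemma in_closure_gluing:
  assumes "stable w" "in_closure w z"
  shows "((cell z, cell_coord z z), (cell w, cell_coord w z)) \<in> face_gluing G l cells"
  unfolding face_gluing_def cell_coord_face_map[OF assms(2)]
  using assms in_closure_stable[OF assms] in_closure_specialization[OF assms(2)]
    cell_coord_in_box[OF in_closure_refl, of z] cell_in_cells_iff by blast

lemma in_closure_cell_class:
  assumes "stable w" "in_closure w z"
  shows "cell_class (cell z, cell_coord z z) = cell_class (cell w, cell_coord w z)"
  using in_closure_gluing[OF assms] by (intro symmetric_closure_class_eq) blast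

text \<open>The ceilings of two chains with the same cell differ by an integral cycle on the edges,
  so the choice affects periods of lifts only by a lattice element.\<close>

definition cell_rep :: "('v, 'e) pseudo_divisor \<Rightarrow> 'e \<Rightarrow> real" where
  "cell_rep \<sigma> = (SOME w. cell w = \<sigma>)"

definition lift :: "('v, 'e) pseudo_divisor \<times> ('e \<Rightarrow> real) \<Rightarrow> 'e \<Rightarrow> real" where
  "lift p e = (if e \<in> fst (fst p) then of_int \<lceil>cell_rep (fst p) e\<rceil> - snd p e / l e else cell_rep (fst p) e)"

lemma cell_cell_rep:
  assumes "\<sigma> \<in> cells"
  shows "cell (cell_rep \<sigma>) = \<sigma>"
proof -
  obtain z where "cell z = \<sigma>" by (rule cells_obtain[OF assms])
  then show ?thesis unfolding cell_rep_def by (rule someI[of "\<lambda>w. cell w = \<sigma>"])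
qed

lemma stable_cell_rep: "\<sigma> \<in> cells \<Longrightarrow> stable (cell_rep \<sigma>)"
  using cell_cell_rep cell_in_cells_iff by metis

lemma lift_cell:
  assumes "\<sigma> \<in> cells" "x \<in> topspace (cell_topology l \<sigma>)"
  shows "in_closure (cell_rep \<sigma>) (lift (\<sigma>, x))" "cell_coord (cell_rep \<sigma>) (lift (\<sigma>, x)) = x"
proof -
  let ?w = "cell_rep \<sigma>"
  have fr: "frac_edges ?w = fst \<sigma>" using cell_cell_rep[OF assms(1)] by (metis fst_cell)
  have b: "0 \<le> x e / l e" "x e / l e \<le> 1" "0 < l e" "e \<in> arcs G" if "e \<in> fst \<sigma>" for e
  proof -
    show e: "e \<in> arcs G" using that frac_edges_subset[of ?w] fr by blast
    show "0 < l e" using e by (rule l_pos)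
    then show "0 \<le> x e / l e" "x e / l e \<le> 1" using assms(2) that by (auto simp: PiE_iff)
  qed
  show "in_closure ?w (lift (\<sigma>, x))"
    unfolding in_closure_def
  proof
    fix e assume e: "e \<in> arcs G"
    show "of_int \<lfloor>?w e\<rfloor> \<le> lift (\<sigma>, x) e \<and> lift (\<sigma>, x) e \<le> of_int \<lceil>?w e\<rceil>"
    proof (cases "e \<in> fst \<sigma>")
      case True
      then show ?thesis using b[OF True] ceiling_frac_edges[OF e, of ?w] by (simp add: lift_def fr)
    qed (simp add: lift_def)
  qed
  show "cell_coord ?w (lift (\<sigma>, x)) = x"
  proof
    fix e
    show "cell_coord ?w (lift (\<sigma>, x)) e = x e"
    proof (cases "e \<in> fst \<sigma>")
      case True
      then show ?thesis using b[OF True] by (simp add: cell_coord_def fr lift_def)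
    next
      case False
      then show ?thesis using assms(2) by (auto simp: cell_coord_def fr PiE_iff extensional_def)
    qed
  qed
qed

lemma lift_stable:
  assumes "\<sigma> \<in> cells" "x \<in> topspace (cell_topology l \<sigma>)"
  shows "stable (lift (\<sigma>, x))"
  using in_closure_stable[OF stable_cell_rep lift_cell(1)] assms by blast

lemma lift_cell_class:
  assumes "\<sigma> \<in> cells" "x \<in> topspace (cell_topology l \<sigma>)"
  shows "cell_class (cell (lift (\<sigma>, x)), cell_coord (lift (\<sigma>, x)) (lift (\<sigma>, x))) = cell_class (\<sigma>, x)"
  using in_closure_cell_class[OF stable_cell_rep[OF assms(1)] lift_cell(1)[OF assms]]
  by (simp only: lift_cell(2)[OF assms] cell_cell_rep[OF assms(1)])

section \<open>Periods of lifted points modulo the lattice\<close>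

definition period :: "('e \<Rightarrow> real) \<Rightarrow> ('e \<Rightarrow> real) \<Rightarrow> real" where
  "period z = (\<lambda>\<omega>\<in>harmonic_forms G. integral_along G l z \<omega>)"

lemma period_in_dual: "period z \<in> harmonic_dual G"
proof -
  have "(\<lambda>e. \<omega> e + \<eta> e) \<in> harmonic_forms G" "(\<lambda>e. r * \<omega> e) \<in> harmonic_forms G"
    if "\<omega> \<in> harmonic_forms G" "\<eta> \<in> harmonic_forms G" for \<omega> \<eta> r
    using that by (simp_all add: harmonic_forms_eq_H1 H1_iff boundary_add boundary_scale)
  then show ?thesis
    by (simp add: harmonic_dual_def period_def integral_along_def sum.distrib sum_distrib_left algebra_simps)
qed

lemma topspace_harmonic_dual [simp]: "topspace (harmonic_dual_topology G) = harmonic_dual G"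
  by (auto simp: harmonic_dual_topology_def harmonic_dual_def PiE_def)

lemma lattice_relationI:
  assumes "\<phi> \<in> harmonic_dual G" "\<psi> \<in> harmonic_dual G" "(c :: 'e \<Rightarrow> int) \<in> H1 G"
    "\<And>\<omega>. \<omega> \<in> harmonic_forms G \<Longrightarrow> \<psi> \<omega> - \<phi> \<omega> = integral_along G l (\<lambda>e. of_int (c e)) \<omega>"
  shows "(\<phi>, \<psi>) \<in> lattice_relation G l"
  unfolding lattice_relation_def using assms(1,2) bexI[of _ c, OF _ assms(3)] assms(4) by simp

lemma lattice_relationE:
  assumes "(\<phi>, \<psi>) \<in> lattice_relation G l"
  obtains c :: "'e \<Rightarrow> int" where "\<phi> \<in> harmonic_dual G" "\<psi> \<in> harmonic_dual G" "c \<in> H1 G"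
    "\<And>\<omega>. \<omega> \<in> harmonic_forms G \<Longrightarrow> \<psi> \<omega> - \<phi> \<omega> = integral_along G l (\<lambda>e. of_int (c e)) \<omega>"
proof -
  have *: "\<phi> \<in> harmonic_dual G" "\<psi> \<in> harmonic_dual G"
    "\<exists>c\<in>H1 G :: ('e \<Rightarrow> int) set. \<forall>\<omega>\<in>harmonic_forms G. \<psi> \<omega> - \<phi> \<omega> = integral_along G l (\<lambda>e. of_int (c e)) \<omega>"
    using assms unfolding lattice_relation_def by simp_all
  from *(3) show ?thesis by (elim bexE) (rule that[OF *(1,2)]; simp)
qed

lemma lattice_relation_equiv: "equiv (harmonic_dual G) (lattice_relation G l)"
proof (rule equivI)
  show "lattice_relation G l \<subseteq> harmonic_dual G \<times> harmonic_dual G"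
    by (auto simp: lattice_relation_def)
  show "refl_on (harmonic_dual G) (lattice_relation G l)"
  proof (rule refl_onI)
    fix \<phi> assume "\<phi> \<in> harmonic_dual G"
    then show "(\<phi>, \<phi>) \<in> lattice_relation G l"
      by (intro lattice_relationI[of _ _ "\<lambda>_. 0"]) (simp_all add: integral_along_def H1_iff)
  qed
  show "sym (lattice_relation G l)"
  proof (rule symI)
    fix \<phi> \<psi> assume "(\<phi>, \<psi>) \<in> lattice_relation G l"
    then obtain c :: "'e \<Rightarrow> int" where c: "\<phi> \<in> harmonic_dual G" "\<psi> \<in> harmonic_dual G" "c \<in> H1 G"
      "\<And>\<omega>. \<omega> \<in> harmonic_forms G \<Longrightarrow> \<psi> \<omega> - \<phi> \<omega> = integral_along G l (\<lambda>e. of_int (c e)) \<omega>"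
      by (rule lattice_relationE) (rule that)
    have "(\<lambda>e. (-1) * c e + 0 * c e) \<in> H1 G" using H1_combination[OF c(3) c(3)] .
    moreover have "\<phi> \<omega> - \<psi> \<omega> = integral_along G l (\<lambda>e. of_int ((-1) * c e + 0 * c e)) \<omega>"
      if "\<omega> \<in> harmonic_forms G" for \<omega>
      using c(4)[OF that] by (simp add: integral_along_def sum_negf)
    ultimately show "(\<psi>, \<phi>) \<in> lattice_relation G l"
      using c(1,2) by (intro lattice_relationI)
  qed
  show "trans (lattice_relation G l)"
  proof (rule transI)
    fix \<phi> \<psi> \<xi> assume "(\<phi>, \<psi>) \<in> lattice_relation G l" "(\<psi>, \<xi>) \<in> lattice_relation G l"
    then obtain c c' :: "'e \<Rightarrow> int" where c: "\<phi> \<in> harmonic_dual G" "\<xi> \<in> harmonic_dual G" "c \<in> H1 G" "c' \<in> H1 G"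
      "\<And>\<omega>. \<omega> \<in> harmonic_forms G \<Longrightarrow> \<psi> \<omega> - \<phi> \<omega> = integral_along G l (\<lambda>e. of_int (c e)) \<omega>"
      "\<And>\<omega>. \<omega> \<in> harmonic_forms G \<Longrightarrow> \<xi> \<omega> - \<psi> \<omega> = integral_along G l (\<lambda>e. of_int (c' e)) \<omega>"
      by (elim lattice_relationE) (rule that; assumption)
    have "(\<lambda>e. 1 * c e + 1 * c' e) \<in> H1 G" using H1_combination[OF c(3) c(4)] .
    moreover have "\<xi> \<omega> - \<phi> \<omega> = integral_along G l (\<lambda>e. of_int (1 * c e + 1 * c' e)) \<omega>"
      if "\<omega> \<in> harmonic_forms G" for \<omega>
      using c(5,6)[OF that] by (simp add: integral_along_add)
    ultimately show "(\<phi>, \<xi>) \<in> lattice_relation G l"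
      using c(1,2) by (intro lattice_relationI)
  qed
qed

lemma period_related:
  assumes eq: "\<And>e. e \<in> arcs G \<Longrightarrow> z' e = z e + of_int (k e)"
    and b: "\<And>v. v \<in> verts G \<Longrightarrow> boundary G k v = 0"
  shows "(period z, period z') \<in> lattice_relation G l"
proof -
  define c where "c e = (if e \<in> arcs G then k e else 0)" for e
  have "boundary G c v = boundary G k v" for v
    by (rule boundary_cong) (simp add: c_def)
  then have c: "c \<in> H1 G" using b by (simp add: H1_iff c_def)
  have "integral_along G l z' \<omega> = integral_along G l (\<lambda>e. z e + of_int (c e)) \<omega>" for \<omega>
    by (rule integral_along_cong) (simp add: eq c_def)
  then have "period z' \<omega> - period z \<omega> = integral_along G l (\<lambda>e. of_int (c e)) \<omega>"
    if "\<omega> \<in> harmonic_forms G" for \<omega>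
    using that by (simp add: period_def integral_along_add)
  then show ?thesis by (rule lattice_relationI[OF period_in_dual period_in_dual c])
qed

text \<open>The two chains differ on edges by an integral cycle, which changes neither the cell nor
  the difference between the ceiling and the value.\<close>

lemma related_stable_eq:
  assumes "stable z" "stable z'" "(period z, period z') \<in> lattice_relation G l"
  shows "(cell z', cell_coord z' z') = (cell z, cell_coord z z)"
proof -
  obtain c :: "'e \<Rightarrow> int" where c: "c \<in> H1 G"
    "\<And>\<omega>. \<omega> \<in> harmonic_forms G \<Longrightarrow> period z' \<omega> - period z \<omega> = integral_along G l (\<lambda>e. of_int (c e)) \<omega>"
    using assms(3) by (rule lattice_relationE) (rule that)
  have eq: "z' e = z e + of_int (c e)" if "e \<in> arcs G" for e
    using c(2) by (intro stable_unique_mod_lattice[OF assms(1,2) c(1) _ that])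
      (simp add: period_def harmonic_forms_eq_H1)
  have cell: "cell z' = cell z" using eq c(1) by (intro cell_translate[where k = c]) (auto simp: H1_iff)
  then have fr: "frac_edges z' = frac_edges z" by (metis fst_cell)
  have "cell_coord z' z' e = cell_coord z z e" for e
    using frac_edges_subset[of z] by (auto simp: cell_coord_def fr eq subset_iff)
  then show ?thesis using cell by auto
qed

text \<open>That the divisor of \<sigma> pushes forward to that of \<tau> says precisely that the
  difference of the two integral flows is a cycle.\<close>

lemma lift_face_map_related:
  assumes c: "\<sigma> \<in> cells" "\<tau> \<in> cells" and sp: "specialization G \<sigma> \<tau> S"
    and x: "x \<in> topspace (cell_topology l \<tau>)"
  shows "(period (lift (\<tau>, x)), period (lift (\<sigma>, face_map l \<sigma> \<tau> S x))) \<in> lattice_relation G l"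
proof -
  let ?w = "cell_rep \<sigma>" and ?v = "cell_rep \<tau>"
  have w: "frac_edges ?w = fst \<sigma>" "frac_edges ?v = fst \<tau>" using cell_cell_rep c by (metis fst_cell)+
  have dv: "flow_div ?w u = snd \<sigma> (Orig u)" "flow_div ?v u = snd \<tau> (Orig u)" if "u \<in> verts G" for u
  proof -
    have "snd (cell y) (Orig u) = flow_div y u" for y using that by (simp add: cell_def cell_div_def)
    then show "flow_div ?w u = snd \<sigma> (Orig u)" "flow_div ?v u = snd \<tau> (Orig u)"
      using cell_cell_rep c by metis+
  qed
  have spec: "fst \<tau> \<subseteq> fst \<sigma>" "S \<subseteq> fst \<sigma> - fst \<tau>"
    "\<And>v. v \<in> verts G \<Longrightarrow> snd \<tau> (Orig v) = snd \<sigma> (Orig v) -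
      (\<Sum>e\<in>out_arcs G v. if e \<in> S then 1 else 0) -
      (\<Sum>e\<in>in_arcs G v. if e \<in> fst \<sigma> - fst \<tau> - S then 1 else 0)"
    using sp cells_specialization_iff[of "fst \<sigma>" "snd \<sigma>" "fst \<tau>" "snd \<tau>" S] c by simp_all
  \<comment> \<open>Where the target half is contracted the coordinate is \<open>l e\<close>, which
    puts the lift one below the ceiling. Expressed by floors, the correction moves to the edges in
    \<open>S\<close>.\<close>
  define k where "k e = \<lceil>?w e\<rceil> - \<lceil>?v e\<rceil> - (if e \<in> fst \<sigma> - fst \<tau> - S then 1 else 0)" for e
  show ?thesis
  proof (rule period_related[where k = k])
    fix e assume e: "e \<in> arcs G"
    have int: "y e = of_int \<lceil>y e\<rceil>" if "e \<notin> frac_edges y" for y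
      using that e by (auto simp: frac_edges_def elim: Ints_cases)
    have le: "l e \<noteq> 0" using l_pos[OF e] by simp
    show "lift (\<sigma>, face_map l \<sigma> \<tau> S x) e = lift (\<tau>, x) e + of_int (k e)"
      using spec(1,2) int[of ?w] int[of ?v] le
      by (auto simp: lift_def face_map_def k_def w)
  next
    fix u assume u: "u \<in> verts G"
    have k': "k e = \<lfloor>?w e\<rfloor> - \<lfloor>?v e\<rfloor> + (if e \<in> S then 1 else 0)" if "e \<in> arcs G" for e
      using spec(1,2) by (auto simp: k_def w ceiling_frac_edges[OF that])
    have "(\<Sum>e\<in>out_arcs G u. k e) = (\<Sum>e\<in>out_arcs G u. \<lfloor>?w e\<rfloor> - \<lfloor>?v e\<rfloor> + (if e \<in> S then 1 else 0))"
      using k' by (intro sum.cong) auto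
    then show "boundary G k u = 0"
      using spec(3)[OF u] dv[OF u]
      unfolding boundary_def by (simp add: k_def flow_div_def sum.distrib sum_subtractf)
  qed
qed

text \<open>It suffices to check the generating identifications, which may be traversed in either
  direction.\<close>

lemma lift_respects_class:
  assumes "cell_class p = cell_class p'"
  shows "lattice_relation G l `` {period (lift p)} = lattice_relation G l `` {period (lift p')}"
proof -
  have "p' \<in> cell_class p'" by blast
  then have "(p, p') \<in> (face_gluing G l cells \<union> (face_gluing G l cells)\<inverse>)\<^sup>*" using assms by blast
  then show ?thesis
  proof (induction rule: rtrancl_induct)
    case (step q q')
    have "(period (lift q), period (lift q')) \<in> lattice_relation G l \<or>
        (period (lift q'), period (lift q)) \<in> lattice_relation G l"
      using step.hyps(2) lift_face_map_related by (fastforce simp: face_gluing_def)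
    then have "lattice_relation G l `` {period (lift q)} = lattice_relation G l `` {period (lift q')}"
      using equiv_class_eq[OF lattice_relation_equiv] by metis
    then show ?case using step.IH by simp
  qed simp
qed

lemma lift_cell_coord_related:
  assumes "stable z"
  shows "(period z, period (lift (cell z, cell_coord z z))) \<in> lattice_relation G l"
proof -
  have c: "cell z \<in> cells" using assms cell_in_cells_iff by blast
  let ?w = "cell_rep (cell z)"
  have cw: "cell ?w = cell z" by (rule cell_cell_rep[OF c])
  then have fr: "frac_edges ?w = frac_edges z" by (metis fst_cell)
  have fd: "flow_div ?w v = flow_div z v" if "v \<in> verts G" for v
  proof -
    have "snd (cell y) (Orig v) = flow_div y v" for y using that by (simp add: cell_def cell_div_def)
    then show ?thesis using cw by metis
  qed
  define k where "k e = \<lceil>?w e\<rceil> - \<lceil>z e\<rceil>" for e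
  show ?thesis
  proof (rule period_related[where k = k])
    fix e assume e: "e \<in> arcs G"
    have int: "y e = of_int \<lceil>y e\<rceil>" if "e \<notin> frac_edges y" for y
      using that e by (auto simp: frac_edges_def elim: Ints_cases)
    show "lift (cell z, cell_coord z z) e = z e + of_int (k e)"
      using int[of ?w] int[of z] l_pos[OF e] by (auto simp: lift_def cell_coord_def k_def fr)
  next
    fix v assume v: "v \<in> verts G"
    have "(\<Sum>e\<in>out_arcs G v. k e) = (\<Sum>e\<in>out_arcs G v. \<lfloor>?w e\<rfloor> - \<lfloor>z e\<rfloor>)"
      by (intro sum.cong) (auto simp: k_def ceiling_frac_edges fr)
    then show "boundary G k v = 0"
      using fd[OF v] unfolding boundary_def by (simp add: k_def flow_div_def sum_subtractf)
  qed
qed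

section \<open>Continuity in both directions and the homeomorphism\<close>

lemma continuous_period_lift:
  "continuous_map cell_points (harmonic_dual_topology G) (\<lambda>p. period (lift p))"
proof (rule continuous_map_from_sum_topology)
  fix \<sigma> assume \<sigma>: "\<sigma> \<in> cells"
  have coord: "continuous_map (cell_topology l \<sigma>) euclideanreal (\<lambda>x. x e)" if "e \<in> fst \<sigma>" for e
    unfolding cell_topology_def
    using continuous_map_product_projection[OF that, of "\<lambda>e. top_of_set {0..l e}"]
    by (rule continuous_map_into_fulltopology)
  have "continuous_map (cell_topology l \<sigma>) euclideanreal (\<lambda>x. lift (\<sigma>, x) e)" for e
  proof (cases "e \<in> fst \<sigma>")
    case True
    have "continuous_map (cell_topology l \<sigma>) euclideanreal (\<lambda>x. of_int \<lceil>cell_rep \<sigma> e\<rceil> - (1 / l e) * x e)"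
      by (intro continuous_intros coord True)
    then show ?thesis using True by (simp add: lift_def)
  qed (simp add: lift_def)
  then have "continuous_map (cell_topology l \<sigma>) euclideanreal (\<lambda>x. integral_along G l (lift (\<sigma>, x)) \<omega>)" for \<omega>
    unfolding integral_along_def by (intro continuous_intros) auto
  then have "continuous_map (cell_topology l \<sigma>) (product_topology (\<lambda>_. euclideanreal) (harmonic_forms G))
      (\<lambda>x. period (lift (\<sigma>, x)))"
    unfolding continuous_map_componentwise by (auto simp: period_def)
  then show "continuous_map (cell_topology l \<sigma>) (harmonic_dual_topology G) (\<lambda>x. period (lift (\<sigma>, x)))"
    unfolding harmonic_dual_topology_def continuous_map_in_subtopology using period_in_dual by auto
qed

lemma dual_linear_sum:
  assumes \<phi>: "\<phi> \<in> harmonic_dual G" and c: "\<And>i. i \<in> I \<Longrightarrow> c i \<in> harmonic_forms G"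
  shows "\<phi> (\<lambda>e. \<Sum>i\<in>I. r i * c i e) = (\<Sum>i\<in>I. r i * \<phi> (c i))"
  using c
proof (induction I rule: infinite_finite_induct)
  case (insert i I)
  have H: "c i \<in> harmonic_forms G" "(\<lambda>e. \<Sum>i\<in>I. r i * c i e) \<in> harmonic_forms G"
    using insert.prems by (auto simp: harmonic_forms_eq_H1 intro: H1_sum)
  then have "(\<lambda>e. r i * c i e) \<in> harmonic_forms G"
    by (simp add: harmonic_forms_eq_H1 H1_iff boundary_scale)
  then have "\<phi> (\<lambda>e. r i * c i e + (\<Sum>i\<in>I. r i * c i e)) = \<phi> (\<lambda>e. r i * c i e) + \<phi> (\<lambda>e. \<Sum>i\<in>I. r i * c i e)"
    using \<phi> H by (simp add: harmonic_dual_def)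
  moreover have "\<phi> (\<lambda>e. r i * c i e) = r i * \<phi> (c i)" using \<phi> H by (simp add: harmonic_dual_def)
  ultimately show ?case using insert by simp
next
  case empty
  have "\<phi> (\<lambda>e. 0 * (0::real)) = 0 * \<phi> (\<lambda>e. 0)"
    using \<phi> by (simp only: harmonic_dual_def) (force simp: harmonic_forms_eq_H1 H1_iff)
  then show ?case by simp
next
  case (infinite I)
  have "\<phi> (\<lambda>e. 0 * (0::real)) = 0 * \<phi> (\<lambda>e. 0)"
    using \<phi> by (simp only: harmonic_dual_def) (force simp: harmonic_forms_eq_H1 H1_iff)
  then show ?case using infinite by simp
qed

text \<open>The fractional edges of a maximal cell give coordinates on the cycles, so every
  functional is the period of a chain supported there, depending linearly on the functional.\<close>

lemma dual_section:
  obtains y where "\<And>\<phi>. \<phi> \<in> harmonic_dual G \<Longrightarrow> period (y \<phi>) = \<phi>"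
    "\<And>e. continuous_map (harmonic_dual_topology G) euclideanreal (\<lambda>\<phi>. y \<phi> e)"
proof -
  obtain \<tau> where "\<tau> \<in> cells" using cells_nonempty by blast
  then obtain \<sigma> where \<sigma>: "\<sigma> \<in> maximal_cells G cells" by (rule maximal_above)
  obtain c :: "'e \<Rightarrow> 'e \<Rightarrow> real" where c: "\<And>i. i \<in> fst \<sigma> \<Longrightarrow> c i \<in> H1 G"
    "\<And>i j. \<lbrakk>i \<in> fst \<sigma>; j \<in> fst \<sigma>\<rbrakk> \<Longrightarrow> c i j = (if i = j then 1 else 0)"
    "\<And>\<omega> e. \<omega> \<in> H1 G \<Longrightarrow> \<omega> e = (\<Sum>i\<in>fst \<sigma>. \<omega> i * c i e)"
    by (rule maximal_basis[OF \<sigma>]) (rule that)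
  have sub: "fst \<sigma> \<subseteq> arcs G" using \<sigma> cells_fst[of "fst \<sigma>" "snd \<sigma>"] by (simp add: maximal_cells_def)
  define y where "y \<phi> e = (if e \<in> fst \<sigma> then \<phi> (c e) / l e else 0)" for \<phi> :: "('e \<Rightarrow> real) \<Rightarrow> real" and e
  have "period (y \<phi>) \<omega> = \<phi> \<omega>" if \<phi>: "\<phi> \<in> harmonic_dual G" for \<phi> \<omega>
  proof (cases "\<omega> \<in> harmonic_forms G")
    case True
    then have \<omega>: "\<omega> \<in> H1 G" by (simp add: harmonic_forms_eq_H1)
    have "integral_along G l (y \<phi>) \<omega> = (\<Sum>e\<in>arcs G. if e \<in> fst \<sigma> then \<omega> e * \<phi> (c e) else 0)"
      unfolding integral_along_def by (intro sum.cong) (auto simp: y_def dest: l_pos)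
    also have "\<dots> = (\<Sum>e\<in>fst \<sigma>. \<omega> e * \<phi> (c e))"
      using sub by (subst sum.inter_restrict[symmetric]) (auto simp: Int_absorb1)
    also have "\<dots> = \<phi> (\<lambda>e. \<Sum>i\<in>fst \<sigma>. \<omega> i * c i e)"
      using c(1) by (subst dual_linear_sum[OF \<phi>]) (simp_all add: harmonic_forms_eq_H1)
    also have "(\<lambda>e. \<Sum>i\<in>fst \<sigma>. \<omega> i * c i e) = \<omega>"
      by (rule ext) (rule c(3)[OF \<omega>, symmetric])
    finally show ?thesis using True by (simp add: period_def)
  next
    case False
    then show ?thesis using \<phi> by (auto simp: period_def harmonic_dual_def extensional_def)
  qed
  moreover have "continuous_map (harmonic_dual_topology G) euclideanreal (\<lambda>\<phi>. y \<phi> e)" for e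
  proof (cases "e \<in> fst \<sigma>")
    case True
    then have "c e \<in> harmonic_forms G" using c(1) by (simp add: harmonic_forms_eq_H1)
    then have "continuous_map (harmonic_dual_topology G) euclideanreal (\<lambda>\<phi>. \<phi> (c e))"
      unfolding harmonic_dual_topology_def
      by (intro continuous_map_from_subtopology continuous_map_product_projection)
    then have "continuous_map (harmonic_dual_topology G) euclideanreal (\<lambda>\<phi>. (1 / l e) * \<phi> (c e))"
      by (rule continuous_map_real_mult_left)
    then show ?thesis using True by (simp add: y_def)
  qed (simp add: y_def)
  ultimately show ?thesis by (intro that[of y] ext)
qed

text \<open>A nearby stable chain lies in a coface of the cell at \<open>\<phi>0\<close>, but in
  which one depends on \<phi>. As there are finitely many cofaces and face maps, a single radius
  works for all of them.\<close>

lemma continuous_stable_class: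
  assumes y: "\<And>e. e \<in> arcs G \<Longrightarrow> continuous_map T euclideanreal (\<lambda>\<phi>. y \<phi> e)"
    and st: "\<And>\<phi>. \<phi> \<in> topspace T \<Longrightarrow> stable (shift (y \<phi>) (h \<phi>))"
  defines "z \<equiv> \<lambda>\<phi>. shift (y \<phi>) (h \<phi>)"
  shows "continuous_map T (complex_space G l cells) (\<lambda>\<phi>. cell_class (cell (z \<phi>), cell_coord (z \<phi>) (z \<phi>)))"
proof -
  have stz: "stable (z \<phi>)" if "\<phi> \<in> topspace T" for \<phi> using st[OF that] by (simp add: z_def)
  have pt: "(cell (z \<phi>), cell_coord (z \<phi>) (z \<phi>)) \<in> topspace cell_points" if "\<phi> \<in> topspace T" for \<phi>
    using cell_in_cells_iff stz[OF that] cell_coord_in_box[OF in_closure_refl, of "z \<phi>"] by auto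
  show ?thesis
    unfolding continuous_map_def
  proof (intro conjI allI impI)
    show "(\<lambda>\<phi>. cell_class (cell (z \<phi>), cell_coord (z \<phi>) (z \<phi>))) \<in> topspace T \<rightarrow> topspace (complex_space G l cells)"
      using pt unfolding complex_space_def topspace_quotient_topology by (blast intro: quotientI)
    fix U assume "openin (complex_space G l cells) U"
    then have U: "openin cell_points {p \<in> topspace cell_points. cell_class p \<in> U}"
      unfolding complex_space_def openin_quotient_topology by blast
    define V where "V \<sigma> = {x \<in> topspace (cell_topology l \<sigma>). cell_class (\<sigma>, x) \<in> U}" for \<sigma>
    have V: "openin (cell_topology l \<sigma>) (V \<sigma>)" if "\<sigma> \<in> cells" for \<sigma>
    proof -
      have "openin (cell_topology l \<sigma>) {x. (\<sigma>, x) \<in> {p \<in> topspace cell_points. cell_class p \<in> U}}"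
        using U that unfolding openin_sum_topology by blast
      moreover have "{x. (\<sigma>, x) \<in> {p \<in> topspace cell_points. cell_class p \<in> U}} = V \<sigma>"
        using that by (auto simp: V_def)
      ultimately show ?thesis by simp
    qed
    show "openin T {\<phi> \<in> topspace T. cell_class (cell (z \<phi>), cell_coord (z \<phi>) (z \<phi>)) \<in> U}"
      unfolding openin_subopen[of T "{\<phi> \<in> topspace T. cell_class (cell (z \<phi>), cell_coord (z \<phi>) (z \<phi>)) \<in> U}"]
    proof
      fix \<phi>0 assume "\<phi>0 \<in> {\<phi> \<in> topspace T. cell_class (cell (z \<phi>), cell_coord (z \<phi>) (z \<phi>)) \<in> U}"
      then have \<phi>0: "\<phi>0 \<in> topspace T" "cell_class (cell (z \<phi>0), cell_coord (z \<phi>0) (z \<phi>0)) \<in> U" by auto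
      let ?z = "z \<phi>0"
      let ?P = "\<lambda>(\<sigma>, S). face_map l \<sigma> (cell ?z) S (cell_coord ?z ?z)"
      \<comment> \<open>Candidate cofaces with a choice of contracted halves, restricted to those
        for which the image of the point at \<open>\<phi>0\<close> lies in the preimage of
        \<open>U\<close>.\<close>
      define K where "K = {k \<in> cells \<times> Pow (arcs G). ?P k \<in> V (fst k)}"
      have fK: "finite K" unfolding K_def using finite_cells by simp
      have "\<exists>r>0. \<forall>x \<in> topspace (cell_topology l (fst k)). (\<forall>e\<in>fst (fst k). \<bar>x e - ?P k e\<bar> < r) \<longrightarrow> x \<in> V (fst k)"
        if k: "k \<in> K" for k
      proof -
        have "fst k \<in> cells" "?P k \<in> V (fst k)" using k by (auto simp: K_def)
        then obtain r where "0 < r" "\<And>x. \<lbrakk>x \<in> topspace (cell_topology l (fst k)); \<And>e. e \<in> fst (fst k) \<Longrightarrow> \<bar>x e - ?P k e\<bar> < r\<rbrakk> \<Longrightarrow> x \<in> V (fst k)"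
          using openin_cell_topology_box[OF finite_cell_edges V] by metis
        then show ?thesis by blast
      qed
      then obtain r where r: "\<And>k. k \<in> K \<Longrightarrow> 0 < r k \<and> (\<forall>x \<in> topspace (cell_topology l (fst k)).
          (\<forall>e\<in>fst (fst k). \<bar>x e - ?P k e\<bar> < r k) \<longrightarrow> x \<in> V (fst k))" by metis
      then obtain r0 where r0: "0 < r0" "\<And>k. k \<in> K \<Longrightarrow> r0 \<le> r k"
        using finite_positive_lower_bound[OF fK, of r] by blast
      obtain \<rho> where \<rho>: "0 < \<rho>" "\<And>w. (\<And>e. e \<in> arcs G \<Longrightarrow> \<bar>w e - ?z e\<bar> < \<rho>) \<Longrightarrow> in_closure w ?z"
        using in_closure_near[of ?z] by blast
      \<comment> \<open>Cell coordinates multiply differences of chains by \<open>l e\<close>;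
        dividing by it converts the radius.\<close>
      have "0 < r0 / l e" if "e \<in> arcs G" for e using r0(1) l_pos[OF that] by simp
      then obtain \<eta>' where \<eta>': "0 < \<eta>'" "\<And>e. e \<in> arcs G \<Longrightarrow> \<eta>' \<le> r0 / l e"
        using finite_positive_lower_bound[OF finite_arcs, of "\<lambda>e. r0 / l e"] by blast
      have "0 < min \<rho> \<eta>'" using \<rho>(1) \<eta>'(1) by simp
      then obtain \<epsilon> where \<epsilon>: "0 < \<epsilon>"
        "\<And>u h e. \<lbrakk>\<And>e. e \<in> arcs G \<Longrightarrow> \<bar>u e\<bar> < \<epsilon>; stable (\<lambda>e. shift ?z h e + u e); e \<in> arcs G\<rbrakk>
          \<Longrightarrow> \<bar>shift ?z h e + u e - ?z e\<bar> < min \<rho> \<eta>'"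
        using stable_perturb[OF stz[OF \<phi>0(1)]] by blast
      define N where "N = (\<Inter>e\<in>arcs G. {\<phi> \<in> topspace T. y \<phi> e \<in> ball (y \<phi>0 e) \<epsilon>}) \<inter> topspace T"
      have "openin T N"
        unfolding N_def
        by (intro openin_INT finite_arcs openin_continuous_map_preimage[OF y]) auto
      moreover have "\<phi>0 \<in> N" using \<phi>0(1) \<epsilon>(1) by (auto simp: N_def)
      moreover have "cell_class (cell (z \<phi>), cell_coord (z \<phi>) (z \<phi>)) \<in> U" if \<phi>: "\<phi> \<in> N" for \<phi>
      proof -
        have \<phi>T: "\<phi> \<in> topspace T" using \<phi> by (simp add: N_def)
        define u where "u e = y \<phi> e - y \<phi>0 e" for e
        have u: "\<bar>u e\<bar> < \<epsilon>" if "e \<in> arcs G" for e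
          using \<phi> that by (auto simp: N_def u_def dist_real_def abs_minus_commute)
        have eq: "(\<lambda>e. shift ?z (\<lambda>v. h \<phi> v - h \<phi>0 v) e + u e) = z \<phi>"
          unfolding z_def shift_shift by (rule ext) (simp add: shift_def u_def)
        have st': "stable (\<lambda>e. shift ?z (\<lambda>v. h \<phi> v - h \<phi>0 v) e + u e)"
          unfolding eq by (rule stz[OF \<phi>T])
        have near: "\<bar>z \<phi> e - ?z e\<bar> < min \<rho> \<eta>'" if "e \<in> arcs G" for e
        proof -
          have "\<bar>shift ?z (\<lambda>v. h \<phi> v - h \<phi>0 v) e + u e - ?z e\<bar> < min \<rho> \<eta>'"
            by (rule \<epsilon>(2)[OF _ st' that]) (rule u)
          then show ?thesis using fun_cong[OF eq, of e] by simp
        qed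
        have cl: "in_closure (z \<phi>) ?z" by (rule \<rho>(2)) (use near in auto)
        define k where "k = (cell (z \<phi>), upper_edges (z \<phi>) ?z)"
        have P: "?P k = cell_coord (z \<phi>) ?z"
          by (simp add: k_def cell_coord_face_map[OF cl])
        have kc: "fst k \<in> cells" using stz[OF \<phi>T] cell_in_cells_iff by (simp add: k_def)
        have "cell_class (fst k, ?P k) \<in> U"
          using \<phi>0(2) in_closure_cell_class[OF stz[OF \<phi>T] cl] unfolding P by (simp add: k_def)
        then have "?P k \<in> V (fst k)"
          unfolding V_def using cell_coord_in_box[OF cl] P by (simp add: k_def)
        moreover have "snd k \<subseteq> arcs G"
          using frac_edges_subset[of "z \<phi>"] by (auto simp: k_def upper_edges_def)
        ultimately have k: "k \<in> K" using kc by (simp add: K_def mem_Times_iff)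
        have "\<bar>cell_coord (z \<phi>) (z \<phi>) e - ?P k e\<bar> < r k" if e: "e \<in> fst (fst k)" for e
        proof -
          have e': "e \<in> frac_edges (z \<phi>)" using e by (simp add: k_def)
          then have ea: "e \<in> arcs G" using frac_edges_subset by blast
          have "cell_coord (z \<phi>) (z \<phi>) e - cell_coord (z \<phi>) ?z e = l e * (?z e - z \<phi> e)"
            using e' by (simp add: cell_coord_def algebra_simps)
          then have "\<bar>cell_coord (z \<phi>) (z \<phi>) e - ?P k e\<bar> = l e * \<bar>z \<phi> e - ?z e\<bar>"
            unfolding P using l_pos[OF ea] by (simp add: abs_mult abs_minus_commute)
          also have "\<dots> < l e * (r0 / l e)"
            using near[OF ea] \<eta>'(2)[OF ea] l_pos[OF ea] by (intro mult_strict_left_mono) auto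
          also have "\<dots> = r0" using l_pos[OF ea] by simp
          also have "r0 \<le> r k" by (rule r0(2)[OF k])
          finally show ?thesis .
        qed
        moreover have "cell_coord (z \<phi>) (z \<phi>) \<in> topspace (cell_topology l (fst k))"
          using cell_coord_in_box[OF in_closure_refl] by (simp add: k_def)
        ultimately have "cell_coord (z \<phi>) (z \<phi>) \<in> V (fst k)" using r[OF k] by blast
        then show ?thesis by (simp add: V_def k_def)
      qed
      then have "N \<subseteq> {\<phi> \<in> topspace T. cell_class (cell (z \<phi>), cell_coord (z \<phi>) (z \<phi>)) \<in> U}"
        by (auto simp: N_def)
      ultimately show "\<exists>N. openin T N \<and> \<phi>0 \<in> N \<and>
          N \<subseteq> {\<phi> \<in> topspace T. cell_class (cell (z \<phi>), cell_coord (z \<phi>) (z \<phi>)) \<in> U}" by blast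
    qed
  qed
qed


text \<open>One map takes the period of a lifted point, the other the point of the stable chain with
  a given period. Each round trip changes the chain only by an integral cycle.\<close>

lemma complex_homeomorphic_jacobian:
  "complex_space G l cells homeomorphic_space tropical_jacobian G l"
proof -
  obtain y where y: "\<And>\<phi>. \<phi> \<in> harmonic_dual G \<Longrightarrow> period (y \<phi>) = \<phi>"
    "\<And>e. continuous_map (harmonic_dual_topology G) euclideanreal (\<lambda>\<phi>. y \<phi> e)"
    by (rule dual_section) (rule that)
  have "\<forall>\<phi>. \<exists>h. stable (shift (y \<phi>) h)" using exists_stable by blast
  then obtain h where h: "\<And>\<phi>. stable (shift (y \<phi>) (h \<phi>))" by (rule choice[elim_format]) blast
  define z where "z \<phi> = shift (y \<phi>) (h \<phi>)" for \<phi>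
  have z: "stable (z \<phi>)" for \<phi> using h by (simp add: z_def)
  have period_z: "period (z \<phi>) = \<phi>" if "\<phi> \<in> harmonic_dual G" for \<phi>
  proof -
    have "period (z \<phi>) = period (y \<phi>)"
      unfolding period_def z_def by (rule restrict_ext) (simp add: harmonic_forms_eq_H1 integral_along_shift)
    then show ?thesis using y(1)[OF that] by simp
  qed
  define pt where "pt \<zeta> = (cell \<zeta>, cell_coord \<zeta> \<zeta>)" for \<zeta>
  have pt_eq: "pt \<zeta>' = pt \<zeta>"
    if "stable \<zeta>" "stable \<zeta>'" "(period \<zeta>, period \<zeta>') \<in> lattice_relation G l" for \<zeta> \<zeta>'
    unfolding pt_def using that by (rule related_stable_eq)
  let ?q = "\<lambda>\<phi>. lattice_relation G l `` {\<phi>}"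
  have qD: "(\<phi>, \<psi>) \<in> lattice_relation G l" if "?q \<phi> = ?q \<psi>" "\<psi> \<in> harmonic_dual G" for \<phi> \<psi>
    using that equiv_class_self[OF lattice_relation_equiv that(2)] by blast
  show ?thesis
  proof (rule homeomorphic_quotients[where a = "\<lambda>p. period (lift p)" and b = "\<lambda>\<phi>. pt (z \<phi>)"])
    show "quotient_map cell_points (complex_space G l cells) (\<lambda>p. cell_class p)"
      unfolding complex_space_def by (rule quotient_map_quotient_topology)
    show q2: "quotient_map (harmonic_dual_topology G) (tropical_jacobian G l) ?q"
      unfolding tropical_jacobian_def by (rule quotient_map_quotient_topology)
    show "continuous_map cell_points (tropical_jacobian G l) (\<lambda>p. ?q (period (lift p)))"
      using continuous_map_compose[OF continuous_period_lift quotient_imp_continuous_map[OF q2]]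
      by (simp add: comp_def)
    show "continuous_map (harmonic_dual_topology G) (complex_space G l cells) (\<lambda>\<phi>. cell_class (pt (z \<phi>)))"
      unfolding pt_def z_def by (rule continuous_stable_class[OF y(2) h])
    show "period (lift p) \<in> topspace (harmonic_dual_topology G)" for p
      by (simp add: period_in_dual)
    show "pt (z \<phi>) \<in> topspace cell_points" for \<phi>
      using z cell_in_cells_iff cell_coord_in_box[OF in_closure_refl, of "z \<phi>"] by (auto simp: pt_def)
    show "?q (period (lift p)) = ?q (period (lift p'))" if "cell_class p = cell_class p'" for p p'
      using that by (rule lift_respects_class)
    show "cell_class (pt (z \<phi>)) = cell_class (pt (z \<psi>))"
      if "\<phi> \<in> topspace (harmonic_dual_topology G)" "\<psi> \<in> topspace (harmonic_dual_topology G)" "?q \<phi> = ?q \<psi>" for \<phi> \<psi>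
    proof -
      have "\<phi> \<in> harmonic_dual G" "\<psi> \<in> harmonic_dual G" using that by simp_all
      then have "pt (z \<psi>) = pt (z \<phi>)"
        using qD[OF that(3)] by (intro pt_eq z) (simp add: period_z)
      then show ?thesis by simp
    qed
    show "cell_class (pt (z (period (lift p)))) = cell_class p" if "p \<in> topspace cell_points" for p
    proof -
      obtain \<sigma> x where p: "p = (\<sigma>, x)" "\<sigma> \<in> cells" "x \<in> topspace (cell_topology l \<sigma>)"
        using \<open>p \<in> topspace cell_points\<close> unfolding topspace_sum_topology by auto
      have "(period (lift p), period (z (period (lift p)))) \<in> lattice_relation G l"
        unfolding period_z[OF period_in_dual] by (rule qD[OF refl period_in_dual])
      then have "pt (z (period (lift p))) = pt (lift p)"
        using z lift_stable[OF p(2,3)] p(1) by (intro pt_eq) auto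
      then show ?thesis
        using lift_cell_class[OF p(2,3)] by (simp add: pt_def p(1))
    qed
    show "?q (period (lift (pt (z \<phi>)))) = ?q \<phi>" if "\<phi> \<in> topspace (harmonic_dual_topology G)" for \<phi>
    proof -
      have "\<phi> \<in> harmonic_dual G" using that by simp
      then have "(\<phi>, period (lift (pt (z \<phi>)))) \<in> lattice_relation G l"
        using lift_cell_coord_related[OF z, of \<phi>] by (simp add: pt_def period_z)
      then show ?thesis using equiv_class_eq[OF lattice_relation_equiv] by blast
    qed
  qed
qed

end

section \<open>Application to the model of a polarized tropical curve\<close>

lemma model_of_polarized_graph:
  assumes "p\<^sub>0 \<in> mspace X" "polarization X \<mu> d" "model_of X \<Gamma> l"
    and verts: "verts \<Gamma> = curve_vertices X p\<^sub>0 w \<union> supp_on X \<mu>"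
  shows "polarized_graph \<Gamma> l p\<^sub>0 \<mu> d"
proof -
  have m: "fin_digraph \<Gamma>" "Digraph_Component.connected \<Gamma>" "\<forall>e\<in>arcs \<Gamma>. 0 < l e"
    using assms(3) by (auto simp: model_of_def)
  interpret fin_digraph \<Gamma> by (rule m(1))
  have "(\<Sum>v\<in>verts \<Gamma>. \<mu> v) = (\<Sum>v\<in>supp_on X \<mu>. \<mu> v)"
    using verts by (intro sum.mono_neutral_right[OF finite_verts]) (auto simp: curve_vertices_def supp_on_def)
  then show ?thesis
    using m assms(1,2) verts
    by unfold_locales (auto simp: polarization_def curve_vertices_def)
qed

theorem theorem5p10:
  fixes X :: "'a metric" and p\<^sub>0 :: 'a and w :: "'a \<Rightarrow> nat"
    and \<mu> :: "'a \<Rightarrow> real" and d :: int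
    and \<Gamma> :: "('a, 'e) pre_digraph" and l :: "'e \<Rightarrow> real"
  assumes "tropical_curve X" and "p\<^sub>0 \<in> mspace X" and "finite (supp_on X w)"
    and "polarization X \<mu> d"
    and "model_of X \<Gamma> l" and "verts \<Gamma> = curve_vertices X p\<^sub>0 w \<union> supp_on X \<mu>"
  shows "pure_dimensional \<Gamma> (quasistable_pseudo_divisors \<Gamma> p\<^sub>0 \<mu> d) (betti_number_1 \<Gamma>) \<and>
    connected_in_codim_1 \<Gamma> (quasistable_pseudo_divisors \<Gamma> p\<^sub>0 \<mu> d) \<and>
    complex_space \<Gamma> l (quasistable_pseudo_divisors \<Gamma> p\<^sub>0 \<mu> d)
      homeomorphic_space tropical_jacobian \<Gamma> l"
proof -
  interpret polarized_graph \<Gamma> l p\<^sub>0 \<mu> d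
    using assms by (intro model_of_polarized_graph)
  show ?thesis
    using pure_dimensional_cells connected_in_codim_1_cells complex_homeomorphic_jacobian by blast
qed

end
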